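(* Let $n\ge 2$, $0<\alpha<1$, and put $2_\alpha^*=\frac{2n}{n-2\alpha}$. Let $V:\mathbb{R}^n\to\mathbb{R}$, $f:\mathbb{R}\to\mathbb{R}$ and $h:\mathbb{R}^n\to\mathbb{R}$ satisfy: (V1) $V\in C(\mathbb{R}^n,\mathbb{R})$ and there is a constant $V_0>0$ with $V(x)\ge V_0$ for all $x\in\mathbb{R}^n$; (V2) $\lim_{|x|\to\infty}V(x)=\infty$; (f1) $f\in C(\mathbb{R})$ and $f(0)=0$; (f2) $f(t)=o(|t|)$ as $t\to 0$; (f3) $f(t)=o\big(|t|^{\frac{n+2\alpha}{n-2\alpha}}\big)$ as $|t|\to\infty$; (f4) there is a constant $\mu>2$ such that, with $F(t)=\int_0^t f(s)\,ds$, one has $0<\mu F(t)\le t f(t)$ for all $t\ne 0$; (H) $h\in L^2(\mathbb{R}^n)$, $h\not\equiv 0$, and $$\|h\|_{L^2(\mathbb{R}^n)}<\frac{\varrho}{C_e}\left(\frac12-\epsilon C_e^2-(\epsilon+K_\epsilon)C_e^{2_\alpha^*}\varrho^{2_\alpha^*-2}\right)$$ for some $\epsilon>0$ and $\varrho>0$, where $C_e$ and $K_\epsilon$ are the constants described in the context. Then the equation $$(-\Delta)^\alpha u(x)+V(x)u(x)=f(u(x))+h(x)\quad\text{in }\mathbb{R}^n$$ has at least two (distinct) weak solutions $u\in H_V^\alpha(\mathbb{R}^n)$.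
   Context: All functions are real-valued. For $0<\alpha<1$, $$H^\alpha(\mathbb{R}^n)=\Big\{u\in L^2(\mathbb{R}^n):\int_{\mathbb{R}^n}\int_{\mathbb{R}^n}\frac{|u(x)-u(z)|^2}{|x-z|^{n+2\alpha}}\,dz\,dx<\infty\Big\},$$ $$H_V^\alpha(\mathbb{R}^n)=\Big\{u\in H^\alpha(\mathbb{R}^n):\int_{\mathbb{R}^n}V(x)u^2(x)\,dx<\infty\Big\},$$ the latter being a Hilbert space with inner product $$\langle u,w\rangle_V=\int_{\mathbb{R}^n}\int_{\mathbb{R}^n}\frac{[u(x)-u(z)][w(x)-w(z)]}{|x-z|^{n+2\alpha}}\,dz\,dx+\int_{\mathbb{R}^n}V(x)u(x)w(x)\,dx$$ and norm $\|u\|_V=\langle u,u\rangle_V^{1/2}$. The fractional Laplacian is $(-\Delta)^\alpha u(x)=\mathrm{p.v.}\int_{\mathbb{R}^n}\frac{u(x)-u(z)}{|x-z|^{n+2\alpha}}\,dz$. By definition, $u\in H_V^\alpha(\mathbb{R}^n)$ is a weak solution of the equation $(-\Delta)^\alpha u+Vu=f(u)+h$ if $$\langle u,w\rangle_V=\int_{\mathbb{R}^n}\big(f(u(x))+h(x)\big)w(x)\,dx\quad\text{for all }w\in H_V^\alpha(\mathbb{R}^n).$$ "Solution" always means weak solution in this sense. Constants in (H): $C_e>0$ is a fixed (Sobolev) embedding constant such that $\|u\|_{L^2(\mathbb{R}^n)}\le C_e\|u\|_V$ and $\|u\|_{L^{2_\alpha^*}(\mathbb{R}^n)}\le C_e\|u\|_V$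 for all $u\in H_V^\alpha(\mathbb{R}^n)$. Given $\epsilon>0$, choose (using (f2), (f3)) numbers $0<\delta<\rho$ such that $|f(t)|\le\epsilon|t|$ for $|t|\le\delta$ and $|f(t)|\le\epsilon|t|^{\frac{n+2\alpha}{n-2\alpha}}$ for $|t|\ge\rho$; then $K_\epsilon=\delta^{-\frac{n+2\alpha}{n-2\alpha}}\max_{\delta\le|t|\le\rho}|f(t)|$. *)

theory Defs
  imports "HOL-Analysis.Analysis" "HOL-Library.Landau_Symbols"
begin

text \<open>Elements of $L^p$ and of the Sobolev spaces below are Lebesgue measurable representatives;
  identification almost everywhere is made explicit where it matters.\<close>

definition memLp :: "real \<Rightarrow> ('a::euclidean_space \<Rightarrow> real) \<Rightarrow> bool" where
  "memLp p u \<longleftrightarrow>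
     u \<in> borel_measurable lebesgue \<and> integrable lebesgue (\<lambda>x. \<bar>u x\<bar> powr p)"

definition Lp_norm :: "real \<Rightarrow> ('a::euclidean_space \<Rightarrow> real) \<Rightarrow> real" where
  "Lp_norm p u = (\<integral>x. \<bar>u x\<bar> powr p \<partial>lebesgue) powr (1 / p)"

text \<open>In the next two definitions the quotients take the value 0 on the diagonal
  (division by zero), which is a null set.\<close>

definition frac_sobolev :: "real \<Rightarrow> (real^'n \<Rightarrow> real) set" where
  "frac_sobolev \<alpha> = {u. memLp 2 u \<and>
     (\<integral>\<^sup>+x. (\<integral>\<^sup>+z. ennreal (\<bar>u x - u z\<bar>\<^sup>2 / norm (x - z) powr (real CARD('n) + 2 * \<alpha>))
        \<partial>lebesgue) \<partial>lebesgue) < \<infinity>}"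

definition frac_form :: "real \<Rightarrow> (real^'n \<Rightarrow> real) \<Rightarrow> (real^'n \<Rightarrow> real) \<Rightarrow> real" where
  "frac_form \<alpha> u w =
     (\<integral>x. (\<integral>z. (u x - u z) * (w x - w z) / norm (x - z) powr (real CARD('n) + 2 * \<alpha>)
        \<partial>lebesgue) \<partial>lebesgue)"

definition HV :: "real \<Rightarrow> (real^'n \<Rightarrow> real) \<Rightarrow> (real^'n \<Rightarrow> real) set" where
  "HV \<alpha> V = {u \<in> frac_sobolev \<alpha>. integrable lebesgue (\<lambda>x. V x * (u x)\<^sup>2)}"

definition HV_inner ::
    "real \<Rightarrow> (real^'n \<Rightarrow> real) \<Rightarrow> (real^'n \<Rightarrow> real) \<Rightarrow> (real^'n \<Rightarrow> real) \<Rightarrow> real" where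
  "HV_inner \<alpha> V u w = frac_form \<alpha> u w + (\<integral>x. V x * u x * w x \<partial>lebesgue)"

definition HV_norm :: "real \<Rightarrow> (real^'n \<Rightarrow> real) \<Rightarrow> (real^'n \<Rightarrow> real) \<Rightarrow> real" where
  "HV_norm \<alpha> V u = sqrt (HV_inner \<alpha> V u u)"

text \<open>Integrability of the right-hand side is required explicitly, because the Bochner integral
  of a non-integrable function is 0 by convention.\<close>

definition weak_solution ::
    "real \<Rightarrow> (real^'n \<Rightarrow> real) \<Rightarrow> (real \<Rightarrow> real) \<Rightarrow> (real^'n \<Rightarrow> real) \<Rightarrow> (real^'n \<Rightarrow> real) \<Rightarrow> bool" where
  "weak_solution \<alpha> V f h u \<longleftrightarrow> u \<in> HV \<alpha> V \<and>
     (\<forall>w \<in> HV \<alpha> V. integrable lebesgue (\<lambda>x. (f (u x) + h x) * w x) \<and>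
        HV_inner \<alpha> V u w = (\<integral>x. (f (u x) + h x) * w x \<partial>lebesgue))"

definition crit_exponent :: "nat \<Rightarrow> real \<Rightarrow> real" where
  "crit_exponent n \<alpha> = 2 * real n / (real n - 2 * \<alpha>)"

text \<open>Membership in $L^{2_\alpha^*}$ is part of the second inequality, again because of
  the convention for non-integrable functions.\<close>

definition embedding_constant :: "real \<Rightarrow> (real^'n \<Rightarrow> real) \<Rightarrow> real \<Rightarrow> bool" where
  "embedding_constant \<alpha> V C \<longleftrightarrow> C > 0 \<and>
     (\<forall>u \<in> HV \<alpha> V.
        Lp_norm 2 u \<le> C * HV_norm \<alpha> V u \<and>
        memLp (crit_exponent CARD('n) \<alpha>) u \<and>
        Lp_norm (crit_exponent CARD('n) \<alpha>) u \<le> C * HV_norm \<alpha> V u)"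

definition growth_thresholds :: "nat \<Rightarrow> real \<Rightarrow> (real \<Rightarrow> real) \<Rightarrow> real \<Rightarrow> real \<Rightarrow> real \<Rightarrow> bool" where
  "growth_thresholds n \<alpha> f \<epsilon> \<delta> \<rho> \<longleftrightarrow> 0 < \<delta> \<and> \<delta> < \<rho> \<and>
     (\<forall>t. \<bar>t\<bar> \<le> \<delta> \<longrightarrow> \<bar>f t\<bar> \<le> \<epsilon> * \<bar>t\<bar>) \<and>
     (\<forall>t. \<bar>t\<bar> \<ge> \<rho> \<longrightarrow> \<bar>f t\<bar> \<le> \<epsilon> * \<bar>t\<bar> powr ((real n + 2 * \<alpha>) / (real n - 2 * \<alpha>)))"

text \<open>For continuous \<open>f\<close> the supremum is a maximum.\<close>

definition K_const :: "nat \<Rightarrow> real \<Rightarrow> (real \<Rightarrow> real) \<Rightarrow> real \<Rightarrow> real \<Rightarrow> real" where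
  "K_const n \<alpha> f \<delta> \<rho> =
     \<delta> powr (- ((real n + 2 * \<alpha>) / (real n - 2 * \<alpha>))) *
     (SUP t \<in> {t. \<delta> \<le> \<bar>t\<bar> \<and> \<bar>t\<bar> \<le> \<rho>}. \<bar>f t\<bar>)"

definition primitive :: "(real \<Rightarrow> real) \<Rightarrow> real \<Rightarrow> real" where
  "primitive f t = (LBINT s=ereal 0..ereal t. f s)"

end

theory Submission
  imports Defs "HOL-Library.Function_Algebras" "HOL-Complex_Analysis.Great_Picard"
begin

text \<open>Weak solutions are the critical points of the energy
  \<open>J u = \<parallel>u\<parallel>\<^sub>V\<^sup>2 / 2 - \<integral> F(u) - \<integral> h u\<close>. The smallness condition on \<open>h\<close> gives \<open>J \<ge> \<eta> > 0\<close> on the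
  sphere of radius \<open>r\<close>, while \<open>J 0 \<le> 0\<close> and, by the Ambrosetti--Rabinowitz condition, \<open>J \<le> 0\<close> at some
  point outside the sphere. Hence there is a critical point with \<open>J \<le> 0\<close> inside the ball (a gradient
  step from an almost minimal point stays in the ball and would decrease \<open>J\<close> below its infimum) and one
  with \<open>J \<ge> \<eta>\<close> at the mountain pass level. Both use the Palais--Smale condition. Its source is
  that bounded sets of the energy space are precompact in \<open>L\<^sup>2\<close>: on a cube, \<open>v\<close> minus its mean is
  controlled by the Gagliardo seminorm times a power of the side length, so up to a small error \<open>v\<close> is
  determined by finitely many means, and \<open>V \<longlongrightarrow> \<infinity>\<close> controls \<open>v\<close> far away. As
  \<open>\<nabla>J = id - K\<close> with \<open>K\<close> continuous from \<open>L\<^sup>2\<close> on bounded sets, Palais--Smale sequences subconverge.\<close>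

subsection \<open>Semi-inner product spaces\<close>

text \<open>The nonlinearity is only little-o of the critical power, so the argument cannot rest on
  strong convergence in the critical Lebesgue space; only boundedness of that embedding is
  available. The little-o supplies an arbitrarily small factor in front of every term of critical
  growth, and what remains of \<open>f a - f b\<close> is a multiple of
  \<open>\<bar>a - b\<bar>\<close>, for which compactness in L2 is enough. The smallness condition
  on \<open>h\<close>, multiplied by the embedding constant times the radius, says exactly that the
  lower bound for \<open>J\<close> on the sphere is positive. As functions are not identified almost
  everywhere, two different functions could still be the same solution. The two critical points are
  told apart by their energies, one at most 0 and one at least \<eta>, because \<open>J\<close>
  takes equal values at weak solutions that agree almost everywhere. For the same reason a critical
  point means \<open>N (G u) = 0\<close>, not \<open>G u = 0\<close>.\<close>

text \<open>The carrier \<open>S\<close> will consist of functions that are not identified almost everywhere, so the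
  form \<open>B\<close> is only positive semidefinite.\<close>

locale semi_inner =
  fixes S :: "'v::real_vector set" and B :: "'v \<Rightarrow> 'v \<Rightarrow> real"
  assumes subspace: "subspace S"
    and B_add: "\<lbrakk>u \<in> S; v \<in> S; w \<in> S\<rbrakk> \<Longrightarrow> B (u + v) w = B u w + B v w"
    and B_scale: "\<lbrakk>u \<in> S; w \<in> S\<rbrakk> \<Longrightarrow> B (c *\<^sub>R u) w = c * B u w"
    and B_sym: "\<lbrakk>u \<in> S; w \<in> S\<rbrakk> \<Longrightarrow> B u w = B w u"
    and B_nonneg: "u \<in> S \<Longrightarrow> 0 \<le> B u u"
begin

definition N :: "'v \<Rightarrow> real" where "N u = sqrt (B u u)"

lemma S_add: "u \<in> S \<Longrightarrow> v \<in> S \<Longrightarrow> u + v \<in> S"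
  and S_diff: "u \<in> S \<Longrightarrow> v \<in> S \<Longrightarrow> u - v \<in> S"
  and S_scale: "u \<in> S \<Longrightarrow> c *\<^sub>R u \<in> S"
  and S_0: "0 \<in> S"
  using subspace by (auto simp: subspace_add subspace_diff subspace_scale subspace_0)

lemmas S_intros = S_add S_diff S_scale S_0

lemma B_add_right: "\<lbrakk>u \<in> S; v \<in> S; w \<in> S\<rbrakk> \<Longrightarrow> B w (u + v) = B w u + B w v"
  using B_add B_sym S_add by metis

lemma B_scale_right: "\<lbrakk>u \<in> S; w \<in> S\<rbrakk> \<Longrightarrow> B w (c *\<^sub>R u) = c * B w u"
  using B_scale B_sym S_scale by metis

lemma B_diff: "\<lbrakk>u \<in> S; v \<in> S; w \<in> S\<rbrakk> \<Longrightarrow> B (u - v) w = B u w - B v w"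
  using B_add[of u "(-1) *\<^sub>R v" w] B_scale[of v w "-1"] S_scale[of v "-1"] by simp

lemma B_diff_right: "\<lbrakk>u \<in> S; v \<in> S; w \<in> S\<rbrakk> \<Longrightarrow> B w (u - v) = B w u - B w v"
  using B_diff B_sym S_diff by metis

lemmas B_simps = B_add B_add_right B_scale B_scale_right B_diff B_diff_right

lemma N_nonneg: "u \<in> S \<Longrightarrow> 0 \<le> N u"
  by (simp add: N_def B_nonneg)

lemma N_sq: "u \<in> S \<Longrightarrow> (N u)\<^sup>2 = B u u"
  by (simp add: N_def B_nonneg)

lemma N_scale: "u \<in> S \<Longrightarrow> N (c *\<^sub>R u) = \<bar>c\<bar> * N u"
  by (simp add: N_def B_simps S_scale real_sqrt_mult flip: mult.assoc power2_eq_square)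

lemma N_0: "N 0 = 0"
  using N_scale[of 0 0] S_0 by simp

lemma N_minus_commute: "u \<in> S \<Longrightarrow> v \<in> S \<Longrightarrow> N (u - v) = N (v - u)"
  using N_scale[of "v - u" "-1"] S_diff by simp

lemma Cauchy_Schwarz:
  assumes u: "u \<in> S" and v: "v \<in> S"
  shows "\<bar>B u v\<bar> \<le> N u * N v"
proof -
  have q: "0 \<le> B u u + 2 * t * B u v + t\<^sup>2 * B v v" for t
  proof -
    have "0 \<le> B (u + t *\<^sub>R v) (u + t *\<^sub>R v)"
      by (intro B_nonneg S_intros u v)
    also have "\<dots> = B u u + 2 * t * B u v + t\<^sup>2 * B v v"
      using u v B_sym[OF u v]
      by (simp add: B_simps S_intros power2_eq_square algebra_simps)
    finally show ?thesis .
  qed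
  have "(B u v)\<^sup>2 \<le> B u u * B v v"
  proof (cases "B v v = 0")
    case True
    have "B u v = 0"
    proof (rule ccontr)
      assume "B u v \<noteq> 0"
      \<comment> \<open>Here \<open>v\<close> may be nonzero although \<open>B v v = 0\<close>. The
        quadratic is then affine in \<open>t\<close>, and the chosen \<open>t\<close> gives it the
        value -1.\<close>
      then show False
        using q[of "- (B u u + 1) / (2 * B u v)"] True by (simp add: field_simps)
    qed
    then show ?thesis using True by simp
  next
    case False
    then have "B v v > 0" using B_nonneg[OF v] by linarith
    then show ?thesis
      using q[of "- B u v / B v v"] by (simp add: field_simps power2_eq_square)
  qed
  then have "sqrt ((B u v)\<^sup>2) \<le> sqrt (B u u * B v v)"
    by (rule real_sqrt_le_mono)
  then show ?thesis by (simp add: N_def real_sqrt_mult)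
qed

lemma N_triangle:
  assumes u: "u \<in> S" and v: "v \<in> S"
  shows "N (u + v) \<le> N u + N v"
proof -
  have "(N (u + v))\<^sup>2 = (N u)\<^sup>2 + 2 * B u v + (N v)\<^sup>2"
    using u v B_sym[OF u v] by (simp add: N_sq S_intros B_simps)
  also have "\<dots> \<le> (N u + N v)\<^sup>2"
    using Cauchy_Schwarz[OF u v] by (simp add: power2_sum abs_le_iff)
  finally show ?thesis
    using N_nonneg u v by (metis add_nonneg_nonneg power2_le_imp_le)
qed

lemma N_triangle_diff: "u \<in> S \<Longrightarrow> v \<in> S \<Longrightarrow> N (u - v) \<le> N u + N v"
  using N_triangle[of u "(-1) *\<^sub>R v"] N_scale[of v "-1"] S_scale[of v "-1"] by simp

lemma N_reverse_triangle:
  assumes "u \<in> S" "v \<in> S"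
  shows "\<bar>N u - N v\<bar> \<le> N (u - v)"
  using N_triangle[of "u - v" v] N_triangle[of "v - u" u] N_minus_commute[of u v] assms
  by (simp add: S_diff)

text \<open>Pointwise estimates of integrands are not homogeneous, so they are applied on the unit
  ball only and extended by scaling. Homogeneity is asked of \<open>\<bar>L v\<bar>\<close> alone,
  which admits functionals that are not linear. If \<open>N v = 0\<close>, all multiples of
  \<open>v\<close> stay in the unit ball, and this forces \<open>L v = 0\<close>.\<close>

lemma bounded_functional_homogeneous:
  assumes scale: "\<And>c v. v \<in> S \<Longrightarrow> \<bar>L (c *\<^sub>R v)\<bar> = \<bar>c\<bar> * \<bar>L v\<bar>"
    and bound: "\<And>v. v \<in> S \<Longrightarrow> N v \<le> 1 \<Longrightarrow> \<bar>L v\<bar> \<le> M"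
    and v: "v \<in> S"
  shows "\<bar>L v\<bar> \<le> M * N v"
proof (cases "N v = 0")
  case True
  have "L v = 0"
  proof (rule ccontr)
    assume *: "L v \<noteq> 0"
    define t where "t = (\<bar>M\<bar> + 1) / \<bar>L v\<bar>"
    have "\<bar>L (t *\<^sub>R v)\<bar> \<le> M"
      by (rule bound) (simp_all add: S_scale N_scale v True)
    then show False using scale[OF v, of t] * by (simp add: t_def)
  qed
  then show ?thesis using True by simp
next
  case False
  then have p: "N v > 0" using N_nonneg[OF v] by linarith
  have "\<bar>L ((1 / N v) *\<^sub>R v)\<bar> \<le> M"
    by (rule bound) (use p in \<open>simp_all add: S_scale N_scale v\<close>)
  then show ?thesis using scale[OF v, of "1 / N v"] p
    by (simp add: field_simps)
qed

end

section \<open>Riesz representation in complete semi-inner product spaces\<close>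

locale semi_hilbert = semi_inner +
  assumes complete: "\<And>X. \<lbrakk>\<And>k. X k \<in> S; \<And>e. e > 0 \<Longrightarrow> \<exists>K. \<forall>i\<ge>K. \<forall>j\<ge>K. N (X i - X j) < e\<rbrakk>
      \<Longrightarrow> \<exists>x\<in>S. (\<lambda>k. N (X k - x)) \<longlonglongrightarrow> 0"
begin

text \<open>The representative minimises \<open>B v v - 2 * L v\<close>: the parallelogram identity
  makes minimising sequences Cauchy, and the limit satisfies the Euler equation. It is unique only
  up to elements of length zero.\<close>

lemma Riesz_representation:
  assumes add: "\<And>v w. v \<in> S \<Longrightarrow> w \<in> S \<Longrightarrow> L (v + w) = L v + L w"
    and scale: "\<And>c v. v \<in> S \<Longrightarrow> L (c *\<^sub>R v) = c * L v"
    and bound: "\<And>v. v \<in> S \<Longrightarrow> \<bar>L v\<bar> \<le> M * N v"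
  obtains g where "g \<in> S" "\<And>v. v \<in> S \<Longrightarrow> L v = B g v"
proof -
  define Q where "Q v = B v v - 2 * L v" for v
  define m where "m = Inf (Q ` S)"
  have lower: "- M\<^sup>2 \<le> Q v" if "v \<in> S" for v
  proof -
    have "0 \<le> (N v - M)\<^sup>2" by simp
    then show ?thesis using bound[OF that] N_sq[OF that]
      unfolding Q_def power2_diff by (simp add: abs_le_iff mult.commute mult.left_commute)
  qed
  have bdd: "bdd_below (Q ` S)" by (rule bdd_belowI2[OF lower])
  have m: "m \<le> Q v" if "v \<in> S" for v
    unfolding m_def using bdd that by (auto intro: cInf_lower)
  have "\<exists>v\<in>S. Q v < m + 1 / real (Suc k)" for k
  proof -
    have "Inf (Q ` S) < m + 1 / real (Suc k)" by (simp add: m_def)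
    then show ?thesis using S_0 by (subst (asm) cInf_less_iff) (auto simp: bdd)
  qed
  then obtain X where X: "\<And>k. X k \<in> S" "\<And>k. Q (X k) < m + 1 / real (Suc k)" by metis
  have par: "(N (a - b))\<^sup>2 = 2 * Q a + 2 * Q b - 4 * Q ((1/2) *\<^sub>R (a + b))"
    if "a \<in> S" "b \<in> S" for a b
  proof -
    have "Q ((1/2) *\<^sub>R c) = (1/4) * B c c - L c" if "c \<in> S" for c
      unfolding Q_def using that by (simp add: B_scale B_scale_right scale S_scale)
    from this[of "a + b"] have "Q ((1/2) *\<^sub>R (a + b)) = (1/4) * B (a + b) (a + b) - (L a + L b)"
      using that by (simp add: add S_add)
    moreover have "B (a + b) (a + b) = B a a + 2 * B a b + B b b"
        "B (a - b) (a - b) = B a a - 2 * B a b + B b b"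
      using that B_sym[OF that] by (simp_all add: S_intros B_simps)
    ultimately show ?thesis using that by (simp add: N_sq S_intros Q_def field_simps)
  qed
  have cau: "\<exists>K. \<forall>i\<ge>K. \<forall>j\<ge>K. N (X i - X j) < e" if "e > 0" for e
  proof -
    obtain K where K: "1 / real (Suc K) < e\<^sup>2 / 4"
      by (rule nat_approx_posE[of "e\<^sup>2 / 4"]) (use \<open>e > 0\<close> in auto)
    have "N (X i - X j) < e" if "i \<ge> K" "j \<ge> K" for i j
    proof -
      have "1 / real (Suc i) \<le> 1 / real (Suc K)" "1 / real (Suc j) \<le> 1 / real (Suc K)"
        using that by (simp_all add: frac_le)
      moreover have "m \<le> Q ((1/2) *\<^sub>R (X i + X j))"
        by (intro m S_intros X)
      ultimately have "(N (X i - X j))\<^sup>2 < e\<^sup>2"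
        using par[of "X i" "X j"] X(1)[of i] X(1)[of j] X(2)[of i] X(2)[of j] K by linarith
      then show ?thesis using \<open>e > 0\<close> by (simp add: power2_less_imp_less)
    qed
    then show ?thesis by blast
  qed
  obtain g where g: "g \<in> S" "(\<lambda>k. N (X k - g)) \<longlonglongrightarrow> 0"
    using complete[of X] X(1) cau by blast
  have "L w = B g w" if w: "w \<in> S" for w
  proof -
    have "(\<lambda>k. B (X k - g) w) \<longlonglongrightarrow> 0"
    proof (rule Lim_null_comparison)
      show "\<forall>\<^sub>F k in sequentially. norm (B (X k - g) w) \<le> N (X k - g) * N w"
        using Cauchy_Schwarz[OF S_diff[OF X(1) g(1)] w] by auto
      show "(\<lambda>k. N (X k - g) * N w) \<longlonglongrightarrow> 0"
        using tendsto_mult_right[OF g(2), of "N w"] by simp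
    qed
    then have lim: "(\<lambda>k. B (X k) w) \<longlonglongrightarrow> B g w"
      using X(1) g(1) w by (simp add: B_diff LIM_zero_iff)
    \<comment> \<open>The first variation at \<open>g\<close>, read off in the limit from the values
      of \<open>Q\<close> at \<open>X k + t *\<^sub>R w\<close>, each of which is at least
      \<open>m\<close>.\<close>
    have *: "0 \<le> 2 * t * (B g w - L w) + t\<^sup>2 * B w w" for t
    proof -
      have "(\<lambda>k. 1 / real (Suc k) + 2 * t * (B (X k) w - L w) + t\<^sup>2 * B w w)
          \<longlonglongrightarrow> 0 + 2 * t * (B g w - L w) + t\<^sup>2 * B w w"
        by (intro tendsto_intros lim LIMSEQ_Suc[OF lim_1_over_n])
      moreover have "0 \<le> 1 / real (Suc k) + 2 * t * (B (X k) w - L w) + t\<^sup>2 * B w w" for k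
      proof -
        have "m \<le> Q (X k + t *\<^sub>R w)" by (intro m S_intros X w)
        also have "\<dots> = Q (X k) + 2 * t * (B (X k) w - L w) + t\<^sup>2 * B w w"
          using X(1)[of k] w B_sym[of "X k" w] unfolding Q_def
          by (simp add: S_intros B_simps scale add power2_eq_square algebra_simps)
        finally show ?thesis using X(2)[of k] by linarith
      qed
      ultimately show ?thesis
        by (metis (no_types, lifting) LIMSEQ_le_const add_0)
    qed
    \<comment> \<open>The slope \<open>x\<close> is played against the quadratic term at
      \<open>t = - x / b\<close>; the added 1 keeps \<open>b\<close> positive when \<open>w\<close>
      has length zero.\<close>
    define x b where "x = B g w - L w" and "b = B w w + 1"
    have b: "b > 0" using B_nonneg[OF w] by (simp add: b_def)
    have "0 \<le> 2 * (- x / b) * x + (- x / b)\<^sup>2 * (b - 1)"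
      using *[of "- x / b"] by (simp add: x_def b_def)
    also have "\<dots> = - (x\<^sup>2 / b) - (x / b)\<^sup>2"
      using b by (simp add: field_simps power2_eq_square)
    finally have "x\<^sup>2 / b \<le> 0" by (smt (verit) zero_le_power2)
    then have "x = 0" using b by (simp add: divide_le_0_iff)
    then show ?thesis by (simp add: x_def)
  qed
  with g(1) show ?thesis using that by blast
qed

end

subsection \<open>Critical points\<close>

text \<open>The expansion of \<open>J\<close> and the continuity of its gradient \<open>G\<close>
  are uniform on bounded sets, so that step lengths can be chosen independently of the point.
  \<open>Palais_Smale\<close> asks only for a critical point at the limit level, which is what both
  existence arguments extract from an approximating sequence.\<close>

locale smooth_functional = semi_inner +
  fixes J :: "'a \<Rightarrow> real" and G :: "'a \<Rightarrow> 'a"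
  assumes G_in: "u \<in> S \<Longrightarrow> G u \<in> S"
    and diff: "\<eta> > 0 \<Longrightarrow> \<exists>d>0. \<forall>u\<in>S. \<forall>w\<in>S. N u \<le> R \<longrightarrow> N w \<le> d \<longrightarrow>
                 \<bar>J (u + w) - J u - B (G u) w\<bar> \<le> \<eta> * N w"
    and G_cont: "\<eta> > 0 \<Longrightarrow> \<exists>d>0. \<forall>u\<in>S. \<forall>v\<in>S. N u \<le> R \<longrightarrow> N v \<le> R \<longrightarrow> N (u - v) \<le> d \<longrightarrow>
                 N (G u - G v) \<le> \<eta>"
    and Palais_Smale: "\<lbrakk>\<And>k. X k \<in> S; (\<lambda>k. J (X k)) \<longlonglongrightarrow> c; (\<lambda>k. N (G (X k))) \<longlonglongrightarrow> 0\<rbrakk>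
                 \<Longrightarrow> \<exists>u\<in>S. J u = c \<and> N (G u) = 0"
begin

text \<open>Dividing by \<open>1 + N (G u)\<close> instead of \<open>N (G u)\<close> keeps the field
  continuous where the gradient vanishes, and its length is still at most 1.\<close>

definition direction :: "'a \<Rightarrow> 'a" where "direction u = (1 / (1 + N (G u))) *\<^sub>R G u"

lemma direction_in: "u \<in> S \<Longrightarrow> direction u \<in> S"
  by (simp add: direction_def S_scale G_in)

lemma N_direction: "u \<in> S \<Longrightarrow> N (direction u) \<le> 1"
  using N_nonneg[OF G_in, of u] by (simp add: direction_def N_scale G_in divide_le_eq)

text \<open>The pairing equals y^2 / (1 + y) at \<open>y = N (G u)\<close>, and this function is
  increasing.\<close>

lemma B_G_direction:
  assumes u: "u \<in> S" and e: "0 < e" "e \<le> N (G u)"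
  shows "e\<^sup>2 / (1 + e) \<le> B (G u) (direction u)"
proof -
  have "B (G u) (direction u) = (N (G u))\<^sup>2 / (1 + N (G u))"
    using u by (simp add: direction_def B_simps G_in N_sq)
  moreover have "e\<^sup>2 / (1 + e) \<le> (N (G u))\<^sup>2 / (1 + N (G u))"
  proof -
    have "e * e \<le> N (G u) * N (G u)" "e * e * N (G u) \<le> e * (N (G u) * N (G u))"
      using e by (auto intro!: mult_mono)
    then have "e\<^sup>2 * (1 + N (G u)) \<le> (N (G u))\<^sup>2 * (1 + e)"
      by (simp add: power2_eq_square algebra_simps)
    then show ?thesis using e by (simp add: divide_le_eq le_divide_eq mult.commute)
  qed
  ultimately show ?thesis by simp
qed

text \<open>The linear term lowers \<open>J\<close> at rate at least
  \<open>e\<^sup>2 / (1 + e)\<close>; the length \<open>d\<close> is such that the error of the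
  expansion consumes at most half of this gain.\<close>

lemma gradient_step:
  assumes e: "e > 0"
  shows "\<exists>d>0. \<forall>u\<in>S. \<forall>s. N u \<le> R \<longrightarrow> 0 \<le> s \<longrightarrow> s \<le> d \<longrightarrow> e \<le> N (G u) \<longrightarrow>
           J (u - s *\<^sub>R direction u) \<le> J u - s * (e\<^sup>2 / (1 + e) / 2)"
proof -
  define \<kappa> where "\<kappa> = e\<^sup>2 / (1 + e)"
  have \<kappa>: "\<kappa> > 0" using e by (simp add: \<kappa>_def)
  obtain d where d: "d > 0" and D: "\<And>u w. \<lbrakk>u\<in>S; w\<in>S; N u \<le> R; N w \<le> d\<rbrakk> \<Longrightarrow>
                 \<bar>J (u + w) - J u - B (G u) w\<bar> \<le> \<kappa> / 2 * N w"
    using diff[of "\<kappa> / 2" R] \<kappa> by auto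
  have "J (u - s *\<^sub>R direction u) \<le> J u - s * (\<kappa> / 2)"
    if u: "u \<in> S" "N u \<le> R" and s: "0 \<le> s" "s \<le> d" and eN: "e \<le> N (G u)" for u s
  proof -
    let ?w = "(- s) *\<^sub>R direction u"
    have w: "?w \<in> S" and Nw: "N ?w \<le> s" "N ?w \<le> d"
      using u N_direction[OF u(1)] s mult_left_mono[OF N_direction[OF u(1)] s(1)]
      by (simp_all add: S_scale direction_in N_scale del: scaleR_minus_left)
    have "J (u + ?w) \<le> J u + B (G u) ?w + \<kappa> / 2 * N ?w"
      using D[OF u(1) w u(2) Nw(2)] by linarith
    also have "B (G u) ?w = - s * B (G u) (direction u)"
      using u by (simp add: B_scale_right G_in direction_in del: scaleR_minus_left)
    also have "- s * B (G u) (direction u) \<le> - s * \<kappa>"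
      using mult_left_mono[OF B_G_direction[OF u(1) e eN] s(1)] by (simp add: \<kappa>_def)
    also have "\<kappa> / 2 * N ?w \<le> \<kappa> / 2 * s"
      using Nw(1) \<kappa> by (simp add: mult_left_mono)
    finally show ?thesis by (simp add: algebra_simps)
  qed
  then show ?thesis using d by (auto simp: \<kappa>_def)
qed

lemma critical_point_of_approximate:
  assumes "\<And>e. e > 0 \<Longrightarrow> \<exists>u\<in>S. \<bar>J u - c\<bar> \<le> e \<and> N (G u) \<le> e"
  shows "\<exists>u\<in>S. J u = c \<and> N (G u) = 0"
proof -
  have "\<exists>u\<in>S. \<bar>J u - c\<bar> \<le> 1 / real (Suc k) \<and> N (G u) \<le> 1 / real (Suc k)" for k
    by (rule assms) simp
  then obtain X where X: "\<And>k. X k \<in> S" "\<And>k. \<bar>J (X k) - c\<bar> \<le> 1 / real (Suc k)"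
      "\<And>k. N (G (X k)) \<le> 1 / real (Suc k)"
    by metis
  have l: "(\<lambda>k. 1 / real (Suc k)) \<longlonglongrightarrow> 0"
    by (rule LIMSEQ_Suc[OF lim_1_over_n])
  have "(\<lambda>k. J (X k) - c) \<longlonglongrightarrow> 0"
    by (rule Lim_null_comparison[OF _ l]) (use X(2) in auto)
  moreover have "(\<lambda>k. N (G (X k))) \<longlonglongrightarrow> 0"
    by (rule Lim_null_comparison[OF _ l]) (use X N_nonneg[OF G_in] in auto)
  ultimately show ?thesis using Palais_Smale[OF X(1)] by (simp add: LIM_zero_iff)
qed

lemma N_segment_continuous:
  assumes "u \<in> S" "w \<in> S"
  shows "continuous_on A (\<lambda>s. N (u - s *\<^sub>R w))"
proof -
  have "N (u - s *\<^sub>R w) = sqrt (B u u - 2 * s * B u w + s\<^sup>2 * B w w)" for s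
    using assms B_sym[of u w]
    by (simp add: N_def B_simps S_intros power2_eq_square algebra_simps)
  then show ?thesis by (simp, intro continuous_intros)
qed

text \<open>Almost minimal points in the ball have small gradient: otherwise a step of fixed length along the
  gradient decreases \<open>J\<close> below its infimum, and it cannot leave the ball because \<open>J\<close> is larger on the
  sphere than along the step.\<close>

lemma critical_point_in_ball:
  assumes r: "r > 0" and \<eta>: "\<eta> > 0"
    and sphere: "\<And>u. u \<in> S \<Longrightarrow> N u = r \<Longrightarrow> \<eta> \<le> J u"
    and lower: "\<And>u. u \<in> S \<Longrightarrow> N u \<le> r \<Longrightarrow> b \<le> J u"
    and J0: "J 0 \<le> 0"
  shows "\<exists>u\<in>S. J u \<le> 0 \<and> N (G u) = 0"
proof -
  define A where "A = {u\<in>S. N u \<le> r}"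
  define m where "m = Inf (J ` A)"
  have A0: "0 \<in> A" using r S_0 by (simp add: A_def N_0)
  have bdd: "bdd_below (J ` A)" using lower by (auto simp: A_def intro!: bdd_belowI2)
  have m: "m \<le> J u" if "u \<in> A" for u
    unfolding m_def using bdd that by (auto intro: cInf_lower)
  have m0: "m \<le> 0" using m[OF A0] J0 by simp
  have "\<exists>u\<in>S. \<bar>J u - m\<bar> \<le> e \<and> N (G u) \<le> e" if e: "e > 0" for e
  proof (rule ccontr)
    assume con: "\<not> ?thesis"
    define \<kappa> where "\<kappa> = e\<^sup>2 / (1 + e)"
    have \<kappa>: "\<kappa> > 0" using e by (simp add: \<kappa>_def)
    obtain d where d: "d > 0" and D: "\<And>u s. \<lbrakk>u\<in>S; N u \<le> r; 0 \<le> s; s \<le> d; e \<le> N (G u)\<rbrakk> \<Longrightarrow>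
           J (u - s *\<^sub>R direction u) \<le> J u - s * (\<kappa> / 2)"
      using gradient_step[OF e, of r] unfolding \<kappa>_def by blast
    \<comment> \<open>The excess over the infimum has three tasks: being at most \<open>e\<close> it
      makes \<open>J u\<close> close to \<open>m\<close>, being at most \<eta> it puts
      \<open>J u\<close> below the values on the sphere, and being at most
      \<open>d * (\<kappa> / 2)\<close> it makes the full step fall below \<open>m\<close>.\<close>
    define \<tau> where "\<tau> = Min {e, \<eta>, d * (\<kappa> / 2)}"
    have \<tau>: "\<tau> > 0" "\<tau> \<le> e" "\<tau> \<le> \<eta>" "\<tau> \<le> d * (\<kappa> / 2)" using e \<eta> d \<kappa> by (auto simp: \<tau>_def)
    have "Inf (J ` A) < m + \<tau>" using \<tau>(1) by (simp add: m_def)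
    then obtain u where u: "u \<in> A" "J u < m + \<tau>"
      using A0 by (subst (asm) cInf_less_iff) (auto simp: bdd)
    have uS: "u \<in> S" "N u \<le> r" using u(1) by (auto simp: A_def)
    have "e \<le> N (G u)" using con uS(1) m[OF u(1)] u(2) \<tau>(2) by force
    then have step: "J (u - s *\<^sub>R direction u) \<le> J u - s * (\<kappa> / 2)" if "0 \<le> s" "s \<le> d" for s
      using D uS that by blast
    have "J (u - d *\<^sub>R direction u) < m" using step[of d] d u(2) \<tau>(4) by linarith
    then have "r \<le> N (u - d *\<^sub>R direction u)"
      using m[of "u - d *\<^sub>R direction u"] uS(1) by (force simp: A_def S_intros direction_in)
    then obtain s where s: "0 \<le> s" "s \<le> d" "N (u - s *\<^sub>R direction u) = r"
      using IVT'[of "\<lambda>s. N (u - s *\<^sub>R direction u)" 0 r d] uS d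
        N_segment_continuous[OF uS(1) direction_in[OF uS(1)]] by auto
    have "\<eta> \<le> J (u - s *\<^sub>R direction u)"
      by (rule sphere) (use s uS direction_in in \<open>auto intro: S_intros\<close>)
    also have "\<dots> \<le> J u" using step[OF s(1,2)] s(1) \<kappa>
      by (smt (verit) mult_nonneg_nonneg half_gt_zero)
    finally show False using u(2) m0 \<tau>(3) by linarith
  qed
  then show ?thesis using critical_point_of_approximate[of m] m0 by auto
qed

section \<open>Deformation of paths and the mountain pass level\<close>

definition cpath :: "(real \<Rightarrow> 'a) \<Rightarrow> bool" where
  "cpath \<gamma> \<longleftrightarrow> (\<forall>t\<in>{0..1}. \<gamma> t \<in> S) \<and>
     (\<forall>t\<in>{0..1}. ((\<lambda>x. N (\<gamma> x - \<gamma> t)) \<longlongrightarrow> 0) (at t within {0..1}))"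

text \<open>The carrier has no topology, so continuity of paths is expressed through
  \<open>N\<close>. A Lipschitz bound near the point \<open>\<gamma> t\<close> is then enough, and
  both \<open>N\<close> and \<open>J\<close> satisfy one.\<close>

lemma cpath_tendsto:
  assumes \<gamma>: "cpath \<gamma>" and t: "t \<in> {0..1}"
    and near: "\<exists>d>0. \<exists>C. \<forall>v\<in>S. N (v - \<gamma> t) \<le> d \<longrightarrow> \<bar>\<psi> v - \<psi> (\<gamma> t)\<bar> \<le> C * N (v - \<gamma> t)"
  shows "((\<lambda>x. \<psi> (\<gamma> x)) \<longlongrightarrow> \<psi> (\<gamma> t)) (at t within {0..1})"
proof -
  obtain d C where d: "d > 0"
    and C: "\<And>v. v \<in> S \<Longrightarrow> N (v - \<gamma> t) \<le> d \<Longrightarrow> \<bar>\<psi> v - \<psi> (\<gamma> t)\<bar> \<le> C * N (v - \<gamma> t)"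
    using near by blast
  have lim: "((\<lambda>x. N (\<gamma> x - \<gamma> t)) \<longlongrightarrow> 0) (at t within {0..1})"
    using \<gamma> t by (simp add: cpath_def)
  have "((\<lambda>x. \<psi> (\<gamma> x) - \<psi> (\<gamma> t)) \<longlongrightarrow> 0) (at t within {0..1})"
  proof (rule Lim_null_comparison)
    have "\<forall>\<^sub>F x in at t within {0..1}. N (\<gamma> x - \<gamma> t) < d"
      using lim d by (auto dest: order_tendstoD)
    moreover have "\<forall>\<^sub>F x in at t within {0..1}. x \<in> {0..1::real}"
      by (simp add: eventually_at_filter)
    ultimately show "\<forall>\<^sub>F x in at t within {0..1}. norm (\<psi> (\<gamma> x) - \<psi> (\<gamma> t)) \<le> C * N (\<gamma> x - \<gamma> t)"
      by eventually_elim (use \<gamma> C in \<open>auto simp: cpath_def\<close>)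
    show "((\<lambda>x. C * N (\<gamma> x - \<gamma> t)) \<longlongrightarrow> 0) (at t within {0..1})"
      using tendsto_mult_left[OF lim, of C] by simp
  qed
  then show ?thesis by (simp add: LIM_zero_iff)
qed

lemma cpath_N_continuous:
  assumes \<gamma>: "cpath \<gamma>"
  shows "continuous_on {0..1} (\<lambda>t. N (\<gamma> t))"
  unfolding continuous_on_def
proof
  fix t :: real assume t: "t \<in> {0..1}"
  show "((\<lambda>t. N (\<gamma> t)) \<longlongrightarrow> N (\<gamma> t)) (at t within {0..1})"
    by (rule cpath_tendsto[OF \<gamma> t], rule exI[of _ 1])
       (use N_reverse_triangle \<gamma> t in \<open>auto intro!: exI[of _ 1] simp: cpath_def\<close>)
qed

lemma cpath_J_tendsto:
  assumes \<gamma>: "cpath \<gamma>" and t: "t \<in> {0..1}"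
  shows "((\<lambda>x. J (\<gamma> x)) \<longlongrightarrow> J (\<gamma> t)) (at t within {0..1})"
proof (rule cpath_tendsto[OF \<gamma> t])
  have u: "\<gamma> t \<in> S" using \<gamma> t by (simp add: cpath_def)
  obtain d where d: "d > 0" and D: "\<And>w. w \<in> S \<Longrightarrow> N w \<le> d \<Longrightarrow>
      \<bar>J (\<gamma> t + w) - J (\<gamma> t) - B (G (\<gamma> t)) w\<bar> \<le> 1 * N w"
    using diff[of 1 "N (\<gamma> t)"] u by auto
  have "\<bar>J v - J (\<gamma> t)\<bar> \<le> (1 + N (G (\<gamma> t))) * N (v - \<gamma> t)"
    if v: "v \<in> S" "N (v - \<gamma> t) \<le> d" for v
    using D[of "v - \<gamma> t"] Cauchy_Schwarz[OF G_in[OF u], of "v - \<gamma> t"] v u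
    by (simp add: S_intros distrib_right)
  then show "\<exists>d>0. \<exists>C. \<forall>v\<in>S. N (v - \<gamma> t) \<le> d \<longrightarrow> \<bar>J v - J (\<gamma> t)\<bar> \<le> C * N (v - \<gamma> t)"
    using d by blast
qed

lemma cpath_G_tendsto:
  assumes \<gamma>: "cpath \<gamma>" and t: "t \<in> {0..1}"
  shows "((\<lambda>x. N (G (\<gamma> x) - G (\<gamma> t))) \<longlongrightarrow> 0) (at t within {0..1})"
proof (rule tendstoI)
  fix e :: real assume e: "e > 0"
  have u: "\<gamma> t \<in> S" using \<gamma> t by (simp add: cpath_def)
  define R where "R = N (\<gamma> t) + 1"
  obtain d where d: "d > 0" and D: "\<And>v. \<lbrakk>v \<in> S; N v \<le> R; N (v - \<gamma> t) \<le> d\<rbrakk> \<Longrightarrow>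
      N (G v - G (\<gamma> t)) \<le> e / 2"
    using G_cont[of "e / 2" R] u e by (force simp: R_def)
  have lim: "((\<lambda>x. N (\<gamma> x - \<gamma> t)) \<longlongrightarrow> 0) (at t within {0..1})"
    using \<gamma> t by (simp add: cpath_def)
  then have "\<forall>\<^sub>F x in at t within {0..1}. N (\<gamma> x - \<gamma> t) < min d 1"
    by (rule order_tendstoD(2)) (use d in simp)
  moreover have "\<forall>\<^sub>F x in at t within {0..1}. x \<in> {0..1::real}"
    by (simp add: eventually_at_filter)
  ultimately show "\<forall>\<^sub>F x in at t within {0..1}. dist (N (G (\<gamma> x) - G (\<gamma> t))) 0 < e"
  proof eventually_elim
    case (elim x)
    have v: "\<gamma> x \<in> S" using elim \<gamma> by (simp add: cpath_def)
    have "N (\<gamma> x - \<gamma> t) < 1" using elim by simp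
    then have "N (\<gamma> x) \<le> R" using N_reverse_triangle[OF v u] unfolding R_def by linarith
    then have "N (G (\<gamma> x) - G (\<gamma> t)) \<le> e / 2" using D v elim by auto
    then show ?case using e N_nonneg[OF S_diff[OF G_in[OF v] G_in[OF u]]] by simp
  qed
qed

lemma cpath_gradient_step:
  assumes \<gamma>: "cpath \<gamma>" and \<phi>: "continuous_on UNIV \<phi>"
  shows "cpath (\<lambda>t. \<gamma> t - (s * \<phi> (J (\<gamma> t))) *\<^sub>R direction (\<gamma> t))"
  unfolding cpath_def
proof (intro conjI ballI)
  have in_S: "\<gamma> t \<in> S" if "t \<in> {0..1}" for t using \<gamma> that by (simp add: cpath_def)
  show "\<gamma> t - (s * \<phi> (J (\<gamma> t))) *\<^sub>R direction (\<gamma> t) \<in> S" if "t \<in> {0..1}" for t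
    by (intro S_intros direction_in in_S that)
  fix t :: real assume t: "t \<in> {0..1}"
  define a where "a x = s * \<phi> (J (\<gamma> x)) * (1 / (1 + N (G (\<gamma> x))))" for x
  have G: "G (\<gamma> x) \<in> S" if "x \<in> {0..1}" for x by (intro G_in in_S that)
  have ev: "\<forall>\<^sub>F x in at t within {0..1}. x \<in> {0..1::real}"
    by (simp add: eventually_at_filter)
  have "((\<lambda>x. N (G (\<gamma> x)) - N (G (\<gamma> t))) \<longlongrightarrow> 0) (at t within {0..1})"
    by (rule Lim_null_comparison[OF _ cpath_G_tendsto[OF \<gamma> t]])
       (rule eventually_mono[OF ev], use N_reverse_triangle G t in auto)
  then have NG: "((\<lambda>x. N (G (\<gamma> x))) \<longlongrightarrow> N (G (\<gamma> t))) (at t within {0..1})"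
    by (simp add: LIM_zero_iff)
  have "((\<lambda>x. \<phi> (J (\<gamma> x))) \<longlongrightarrow> \<phi> (J (\<gamma> t))) (at t within {0..1})"
    by (rule continuous_on_tendsto_compose[OF \<phi> cpath_J_tendsto[OF \<gamma> t]]) auto
  then have lima: "(a \<longlongrightarrow> a t) (at t within {0..1})"
    unfolding a_def using N_nonneg[OF G[OF t]] by (intro tendsto_intros NG) auto
  have "((\<lambda>x. N (\<gamma> x - \<gamma> t) + (\<bar>a x\<bar> * N (G (\<gamma> x) - G (\<gamma> t)) + \<bar>a x - a t\<bar> * N (G (\<gamma> t))))
      \<longlongrightarrow> 0 + (\<bar>a t\<bar> * 0 + \<bar>a t - a t\<bar> * N (G (\<gamma> t)))) (at t within {0..1})"
    using \<gamma> t by (intro tendsto_intros lima cpath_G_tendsto[OF \<gamma> t]) (simp add: cpath_def)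
  then have lim: "((\<lambda>x. N (\<gamma> x - \<gamma> t) + (\<bar>a x\<bar> * N (G (\<gamma> x) - G (\<gamma> t)) + \<bar>a x - a t\<bar> * N (G (\<gamma> t))))
      \<longlongrightarrow> 0) (at t within {0..1})" by simp
  let ?D = "\<lambda>x. (\<gamma> x - (s * \<phi> (J (\<gamma> x))) *\<^sub>R direction (\<gamma> x)) - (\<gamma> t - (s * \<phi> (J (\<gamma> t))) *\<^sub>R direction (\<gamma> t))"
  show "((\<lambda>x. N (?D x)) \<longlongrightarrow> 0) (at t within {0..1})"
  proof (rule Lim_null_comparison[OF eventually_mono[OF ev] lim])
    fix x :: real assume x: "x \<in> {0..1}"
    \<comment> \<open>A discrete product rule: the variation of the scalar factor \<open>a\<close>
      is separated from that of the gradient.\<close>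
    have *: "?D x = (\<gamma> x - \<gamma> t) - (a x *\<^sub>R (G (\<gamma> x) - G (\<gamma> t)) + (a x - a t) *\<^sub>R G (\<gamma> t))"
      by (simp add: a_def direction_def algebra_simps)
    have "N (?D x) \<le> N (\<gamma> x - \<gamma> t) + (N (a x *\<^sub>R (G (\<gamma> x) - G (\<gamma> t))) + N ((a x - a t) *\<^sub>R G (\<gamma> t)))"
      unfolding *
      by (rule order_trans[OF N_triangle_diff add_left_mono[OF N_triangle]])
         (intro S_intros in_S G x t)+
    moreover have "N (?D x) \<ge> 0"
      by (intro N_nonneg S_intros in_S direction_in x t)
    ultimately show "norm (N (?D x)) \<le>
        N (\<gamma> x - \<gamma> t) + (\<bar>a x\<bar> * N (G (\<gamma> x) - G (\<gamma> t)) + \<bar>a x - a t\<bar> * N (G (\<gamma> t)))"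
      using G[OF x] G[OF t] by (simp add: N_scale S_intros)
  qed
qed

text \<open>Instead of a gradient flow, finitely many Euler steps deform a path of almost minimal height;
  the step size is uniform because \<open>J\<close> is uniformly differentiable on bounded sets and the paths
  stay within distance 1 of the first one. The cutoff \<open>\<phi>\<close> fixes the end points.\<close>

theorem mountain_pass:
  assumes r: "r > 0" and \<eta>: "\<eta> > 0"
    and sphere: "\<And>u. u \<in> S \<Longrightarrow> N u = r \<Longrightarrow> \<eta> \<le> J u"
    and J0: "J 0 \<le> 0" and e: "e \<in> S" "N e > r" "J e \<le> 0"
  shows "\<exists>u\<in>S. \<eta> \<le> J u \<and> N (G u) = 0"
proof -
  \<comment> \<open>Upper bounds of \<open>J\<close> along paths take the place of maxima; the
    infimum of all of them is the mountain pass level.\<close>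
  define A where "A = {a. \<exists>\<gamma>. cpath \<gamma> \<and> \<gamma> 0 = 0 \<and> \<gamma> 1 = e \<and> (\<forall>t\<in>{0..1}. J (\<gamma> t) \<le> a)}"
  define c where "c = Inf A"
  have low: "\<eta> \<le> a" if "a \<in> A" for a
  proof -
    obtain \<gamma> where \<gamma>: "cpath \<gamma>" "\<gamma> 0 = 0" "\<gamma> 1 = e" "\<forall>t\<in>{0..1}. J (\<gamma> t) \<le> a"
      using \<open>a \<in> A\<close> by (auto simp: A_def)
    obtain t where t: "0 \<le> t" "t \<le> 1" "N (\<gamma> t) = r"
      using IVT'[of "\<lambda>t. N (\<gamma> t)" 0 r 1] cpath_N_continuous[OF \<gamma>(1)] \<gamma>(2,3) r e(2) N_0 by auto
    then have "\<eta> \<le> J (\<gamma> t)" using \<gamma>(1) by (intro sphere) (auto simp: cpath_def)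
    also have "\<dots> \<le> a" using \<gamma>(4) t by auto
    finally show ?thesis .
  qed
  then have bdd: "bdd_below A" unfolding bdd_below_def by blast
  have ne: "A \<noteq> {}"
  proof -
    let ?\<gamma> = "\<lambda>t. t *\<^sub>R e"
    have \<gamma>: "cpath ?\<gamma>"
    proof -
      have *: "N (x *\<^sub>R e - t *\<^sub>R e) = \<bar>x - t\<bar> * N e" for x t
        using N_scale[OF e(1), of "x - t"] by (simp add: scaleR_diff_left)
      have "((\<lambda>x. \<bar>x - t\<bar> * N e) \<longlongrightarrow> \<bar>t - t\<bar> * N e) (at t within {0..1})" for t :: real
        by (intro tendsto_intros)
      then show ?thesis by (simp add: cpath_def S_scale e(1) *)
    qed
    have "continuous_on {0..1} (\<lambda>t. J (?\<gamma> t))"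
      unfolding continuous_on_def using cpath_J_tendsto[OF \<gamma>] by blast
    then have "compact ((\<lambda>t. J (?\<gamma> t)) ` {0..1})" by (intro compact_continuous_image) auto
    then obtain a where "\<forall>x \<in> (\<lambda>t. J (?\<gamma> t)) ` {0..1}. norm x \<le> a"
      using bounded_iff compact_imp_bounded by blast
    then have "\<forall>t\<in>{0..1}. J (?\<gamma> t) \<le> a" by auto
    then have "a \<in> A" using \<gamma> by (auto simp: A_def intro!: exI[of _ ?\<gamma>])
    then show ?thesis by blast
  qed
  have c\<eta>: "\<eta> \<le> c" unfolding c_def using low ne by (auto intro: cInf_greatest)
  have "\<exists>u\<in>S. \<bar>J u - c\<bar> \<le> \<epsilon> \<and> N (G u) \<le> \<epsilon>" if \<epsilon>: "\<epsilon> > 0" for \<epsilon>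
  proof (rule ccontr)
    assume con: "\<not> ?thesis"
    \<comment> \<open>Since \<eta> is at most \<open>c\<close>, the cap gives
      \<open>c - \<epsilon>1 \<ge> 0\<close>. The cutoff therefore vanishes wherever
      \<open>J \<le> 0\<close>, in particular at both end points.\<close>
    define \<epsilon>1 where "\<epsilon>1 = min \<epsilon> \<eta>"
    have \<epsilon>1: "\<epsilon>1 > 0" "\<epsilon>1 \<le> \<eta>" "\<epsilon>1 \<le> \<epsilon>" using \<epsilon> \<eta> by (auto simp: \<epsilon>1_def)
    have big: "\<epsilon>1 \<le> N (G u)" if "u \<in> S" "\<bar>J u - c\<bar> \<le> \<epsilon>1" for u
      using con that \<epsilon>1(3) by force
    define \<kappa> where "\<kappa> = \<epsilon>1\<^sup>2 / (1 + \<epsilon>1)"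
    have \<kappa>: "\<kappa> > 0" using \<epsilon>1 by (simp add: \<kappa>_def)
    \<comment> \<open>The whole deformation can lower \<open>J\<close> by
      \<open>\<kappa> / 2\<close>, so an initial excess of at most \<open>\<kappa> / 4\<close> ends
      below \<open>c\<close>. The other bound keeps the path below \<open>c + \<epsilon>1\<close>,
      where the gradient estimate \<open>big\<close> applies.\<close>
    define \<tau> where "\<tau> = min \<epsilon>1 (\<kappa> / 4)"
    have \<tau>: "\<tau> > 0" "\<tau> \<le> \<epsilon>1" "\<tau> \<le> \<kappa> / 4" using \<epsilon>1 \<kappa> by (auto simp: \<tau>_def)
    have "Inf A < c + \<tau>" using \<tau>(1) by (simp add: c_def)
    then obtain a where a: "a \<in> A" "a < c + \<tau>"
      using ne by (subst (asm) cInf_less_iff) (auto simp: bdd)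
    then obtain \<gamma> where \<gamma>: "cpath \<gamma>" "\<gamma> 0 = 0" "\<gamma> 1 = e" "\<And>t. t \<in> {0..1} \<Longrightarrow> J (\<gamma> t) \<le> c + \<tau>"
      by (force simp: A_def)
    have "compact ((\<lambda>t. N (\<gamma> t)) ` {0..1})"
      by (intro compact_continuous_image cpath_N_continuous \<gamma>) auto
    then obtain R where "\<forall>x \<in> (\<lambda>t. N (\<gamma> t)) ` {0..1}. norm x \<le> R"
      using bounded_iff compact_imp_bounded by blast
    then have R: "N (\<gamma> t) \<le> R" if "t \<in> {0..1}" for t
      using that by (fastforce simp: abs_le_iff)
    obtain d where d: "d > 0" and D: "\<And>u s. \<lbrakk>u\<in>S; N u \<le> R + 1; 0 \<le> s; s \<le> d; \<epsilon>1 \<le> N (G u)\<rbrakk> \<Longrightarrow>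
           J (u - s *\<^sub>R direction u) \<le> J u - s * (\<kappa> / 2)"
      using gradient_step[OF \<epsilon>1(1), of "R + 1"] unfolding \<kappa>_def by blast
    obtain M where M: "inverse (real (Suc M)) < d" using reals_Archimedean[OF d] by blast
    \<comment> \<open>A unit fraction, so that \<open>Suc M\<close> steps have total length exactly
      1 and the points stay in the ball of radius \<open>R + 1\<close>.\<close>
    define s where "s = 1 / real (Suc M)"
    have s: "0 < s" "s \<le> d" using M by (simp_all add: s_def inverse_eq_divide)
    define \<phi> where "\<phi> x = max 0 (min 1 ((x - (c - \<epsilon>1)) / (\<epsilon>1 / 2)))" for x
    have \<phi>c: "continuous_on UNIV \<phi>" unfolding \<phi>_def using \<epsilon>1(1) by (intro continuous_intros) auto
    have \<phi>: "0 \<le> \<phi> x" "\<phi> x \<le> 1" "x \<le> c - \<epsilon>1 \<Longrightarrow> \<phi> x = 0" "c - \<epsilon>1 / 2 \<le> x \<Longrightarrow> \<phi> x = 1" for x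
      using \<epsilon>1(1) by (auto simp: \<phi>_def divide_le_0_iff)
    define T where "T u = u - (s * \<phi> (J u)) *\<^sub>R direction u" for u
    have TS: "T u \<in> S" if "u \<in> S" for u unfolding T_def by (intro S_intros direction_in that)
    have TN: "N (T u) \<le> N u + s" if u: "u \<in> S" for u
    proof -
      have "N (T u) \<le> N u + N ((s * \<phi> (J u)) *\<^sub>R direction u)"
        unfolding T_def by (intro N_triangle_diff S_intros direction_in u)
      also have "N ((s * \<phi> (J u)) *\<^sub>R direction u) = s * (\<phi> (J u) * N (direction u))"
        using s \<phi>(1)[of "J u"] by (simp add: N_scale direction_in u abs_mult)
      also have "\<dots> \<le> s * 1"
        using s \<phi>(1,2)[of "J u"] N_direction[OF u] N_nonneg[OF direction_in[OF u]]
        by (intro mult_left_mono mult_le_one) auto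
      finally show ?thesis by simp
    qed
    have TJ: "J (T u) \<le> J u - s * \<phi> (J u) * (\<kappa> / 2)"
      if u: "u \<in> S" "N u \<le> R + 1" "J u \<le> c + \<epsilon>1" for u
    proof (cases "J u \<le> c - \<epsilon>1")
      case True then show ?thesis by (simp add: T_def \<phi>(3))
    next
      case False
      then have "\<epsilon>1 \<le> N (G u)" using u by (intro big) auto
      moreover have "s * \<phi> (J u) \<le> d"
        using s \<phi>(1,2)[of "J u"] by (smt (verit) mult_left_le)
      ultimately show ?thesis unfolding T_def
        using D[of u "s * \<phi> (J u)"] u s \<phi>(1)[of "J u"] by simp
    qed
    have T_fix: "T u = u" if "J u \<le> 0" for u
      using \<phi>(3)[of "J u"] c\<eta> \<epsilon>1 that by (simp add: T_def)
    \<comment> \<open>The maximum records an alternative: either the point has dropped to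
      \<open>c - \<epsilon>1 / 2\<close>, from where \<open>J\<close> cannot rise again, or each of
      the \<open>k\<close> steps has gained the full \<open>s * (\<kappa> / 2)\<close>.\<close>
    have "k \<le> Suc M \<Longrightarrow> cpath (\<lambda>t. (T ^^ k) (\<gamma> t)) \<and> (T ^^ k) (\<gamma> 0) = 0 \<and> (T ^^ k) (\<gamma> 1) = e \<and>
        (\<forall>t\<in>{0..1}. N ((T ^^ k) (\<gamma> t)) \<le> R + real k * s \<and>
          J ((T ^^ k) (\<gamma> t)) \<le> max (c - \<epsilon>1 / 2) (c + \<tau> - real k * s * (\<kappa> / 2)))" for k
    proof (induction k)
      case 0
      show ?case using \<gamma> R by (auto simp: max_def) (smt (verit))
    next
      case (Suc k)
      let ?g = "\<lambda>t. (T ^^ k) (\<gamma> t)"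
      have IH: "cpath ?g" "?g 0 = 0" "?g 1 = e"
        "\<And>t. t \<in> {0..1} \<Longrightarrow> N (?g t) \<le> R + real k * s"
        "\<And>t. t \<in> {0..1} \<Longrightarrow> J (?g t) \<le> max (c - \<epsilon>1 / 2) (c + \<tau> - real k * s * (\<kappa> / 2))"
        using Suc by auto
      have ks: "real k * s \<le> 1"
        using Suc.prems by (simp add: s_def)
      show ?case
      proof (intro conjI ballI)
        show "cpath (\<lambda>t. (T ^^ Suc k) (\<gamma> t))"
          using cpath_gradient_step[OF IH(1) \<phi>c, of s] by (simp add: T_def)
        show "(T ^^ Suc k) (\<gamma> 0) = 0" using IH(2) T_fix J0 by simp
        show "(T ^^ Suc k) (\<gamma> 1) = e" using IH(3) T_fix e(3) by simp
        fix t :: real assume t: "t \<in> {0..1}"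
        have gS: "?g t \<in> S" using IH(1) t by (simp add: cpath_def)
        show "N ((T ^^ Suc k) (\<gamma> t)) \<le> R + real (Suc k) * s"
          using TN[OF gS] IH(4)[OF t] by (simp add: algebra_simps)
        have nn: "0 \<le> real k * s * (\<kappa> / 2)" using s \<kappa> by simp
        have Jg: "J (?g t) \<le> c + \<epsilon>1" using IH(5)[OF t] nn \<tau>(2) \<epsilon>1(1) by linarith
        have "N (?g t) \<le> R + 1" using IH(4)[OF t] ks by linarith
        note step = TJ[OF gS this Jg]
        have skap: "0 \<le> s * \<phi> (J (?g t)) * (\<kappa> / 2)" using s \<kappa> \<phi>(1) by simp
        show "J ((T ^^ Suc k) (\<gamma> t)) \<le> max (c - \<epsilon>1 / 2) (c + \<tau> - real (Suc k) * s * (\<kappa> / 2))"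
        proof (cases "c - \<epsilon>1 / 2 \<le> J (?g t)")
          case True
          then have *: "J (T (?g t)) \<le> J (?g t) - s * (\<kappa> / 2)" using step \<phi>(4) by simp
          show ?thesis
          proof (cases "J (?g t) \<le> c - \<epsilon>1 / 2")
            case True
            then show ?thesis using step skap by simp
          next
            case False
            then have "J (?g t) \<le> c + \<tau> - real k * s * (\<kappa> / 2)" using IH(5)[OF t] by linarith
            then have "J (T (?g t)) \<le> c + \<tau> - real k * s * (\<kappa> / 2) - s * (\<kappa> / 2)"
              using * by linarith
            also have "\<dots> = c + \<tau> - real (Suc k) * s * (\<kappa> / 2)" by (simp add: algebra_simps)
            finally show ?thesis by simp
          qed
        next
          case False
          then show ?thesis using step skap by simp
        qed
      qed
    qed
    from this[of "Suc M"] have fin: "cpath (\<lambda>t. (T ^^ Suc M) (\<gamma> t))" "(T ^^ Suc M) (\<gamma> 0) = 0"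
        "(T ^^ Suc M) (\<gamma> 1) = e"
        "\<forall>t\<in>{0..1}. J ((T ^^ Suc M) (\<gamma> t)) \<le> max (c - \<epsilon>1 / 2) (c + \<tau> - real (Suc M) * s * (\<kappa> / 2))"
      by blast+
    have "max (c - \<epsilon>1 / 2) (c + \<tau> - real (Suc M) * s * (\<kappa> / 2)) \<in> A"
      unfolding A_def using fin by blast
    then have "c \<le> max (c - \<epsilon>1 / 2) (c + \<tau> - real (Suc M) * s * (\<kappa> / 2))"
      unfolding c_def by (rule cInf_lower[OF _ bdd])
    moreover have "real (Suc M) * s = 1" by (simp add: s_def)
    ultimately show False using \<epsilon>1(1) \<tau> \<kappa> by (auto simp: max_def split: if_splits)
  qed
  then show ?thesis using critical_point_of_approximate[of c] c\<eta> by auto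
qed

end

section \<open>Functions as a real vector space\<close>

instantiation "fun" :: (type, scaleR) scaleR
begin
definition scaleR_fun_def: "c *\<^sub>R f = (\<lambda>x. c *\<^sub>R f x)"
instance ..
end

instance "fun" :: (type, real_vector) real_vector
  by standard (simp_all add: scaleR_fun_def fun_eq_iff algebra_simps)

lemma scaleR_fun_apply [simp]: "(c *\<^sub>R f) x = c *\<^sub>R f x"
  by (simp add: scaleR_fun_def)

subsection \<open>Square integrable functions\<close>

definition sqint :: "'a measure \<Rightarrow> ('a \<Rightarrow> real) set" where
  "sqint M = {u \<in> borel_measurable M. integrable M (\<lambda>x. (u x)\<^sup>2)}"

lemma sqint_measurable [measurable_dest]: "u \<in> sqint M \<Longrightarrow> u \<in> borel_measurable M"
  by (simp add: sqint_def)

lemma sqint_square: "u \<in> sqint M \<Longrightarrow> integrable M (\<lambda>x. (u x)\<^sup>2)"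
  by (simp add: sqint_def)

lemma sqint_iff_nn: "u \<in> sqint M \<longleftrightarrow> u \<in> borel_measurable M \<and> (\<integral>\<^sup>+x. ennreal ((u x)\<^sup>2) \<partial>M) < \<infinity>"
  unfolding sqint_def by (auto simp: integrable_iff_bounded)

lemma sqint_mult:
  assumes u: "u \<in> sqint M" and v: "v \<in> sqint M"
  shows "integrable M (\<lambda>x. u x * v x)"
proof (rule Bochner_Integration.integrable_bound)
  show "integrable M (\<lambda>x. (u x)\<^sup>2 + (v x)\<^sup>2)"
    using u v by (intro Bochner_Integration.integrable_add sqint_square)
  show "(\<lambda>x. u x * v x) \<in> borel_measurable M" using u v by measurable
  show "AE x in M. norm (u x * v x) \<le> norm ((u x)\<^sup>2 + (v x)\<^sup>2)"
  proof (rule AE_I2)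
    fix x
    have "2 * \<bar>u x\<bar> * \<bar>v x\<bar> \<le> (u x)\<^sup>2 + (v x)\<^sup>2"
      using sum_squares_bound[of "\<bar>u x\<bar>" "\<bar>v x\<bar>"] by simp
    moreover have "0 \<le> \<bar>u x\<bar> * \<bar>v x\<bar>" by simp
    ultimately have "\<bar>u x\<bar> * \<bar>v x\<bar> \<le> (u x)\<^sup>2 + (v x)\<^sup>2" by linarith
    then show "norm (u x * v x) \<le> norm ((u x)\<^sup>2 + (v x)\<^sup>2)"
      by (simp add: abs_mult)
  qed
qed

lemma sqint_add:
  assumes u: "u \<in> sqint M" and v: "v \<in> sqint M"
  shows "u + v \<in> sqint M"
proof -
  have "integrable M (\<lambda>x. (u x)\<^sup>2 + (v x)\<^sup>2 + 2 * (u x * v x))"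
    using u v by (intro Bochner_Integration.integrable_add sqint_square sqint_mult
      Bochner_Integration.integrable_mult_right)
  moreover have "(\<lambda>x. u x + v x) \<in> borel_measurable M" using u v by measurable
  ultimately show ?thesis
    by (simp add: sqint_def plus_fun_def power2_sum mult.assoc)
qed

lemma sqint_scale: "u \<in> sqint M \<Longrightarrow> c *\<^sub>R u \<in> sqint M"
  unfolding sqint_def by (auto simp: scaleR_fun_def power_mult_distrib)

lemma sqint_0: "0 \<in> sqint M"
  by (simp add: sqint_def zero_fun_def)

lemma sqint_diff: "u \<in> sqint M \<Longrightarrow> v \<in> sqint M \<Longrightarrow> u - v \<in> sqint M"
  using sqint_add[of u M "(-1) *\<^sub>R v"] sqint_scale[of v M "-1"] by simp

lemma subspace_sqint: "subspace (sqint M)"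
  by (simp add: subspace_def sqint_add sqint_scale sqint_0)

lemma semi_inner_sqint: "semi_inner (sqint M) (\<lambda>u v. \<integral>x. u x * v x \<partial>M)"
proof
  fix u v w assume "u \<in> sqint M" "v \<in> sqint M" "w \<in> sqint M"
  then show "(\<integral>x. (u + v) x * w x \<partial>M) = (\<integral>x. u x * w x \<partial>M) + (\<integral>x. v x * w x \<partial>M)"
    by (simp add: distrib_right sqint_mult)
  show "(\<integral>x. (c *\<^sub>R u) x * w x \<partial>M) = c * (\<integral>x. u x * w x \<partial>M)" for c
    by (simp add: mult.assoc)
qed (auto simp: subspace_sqint mult.commute mult.assoc)

lemma Cauchy_Schwarz_integral:
  assumes "u \<in> sqint M" "v \<in> sqint M"
  shows "\<bar>\<integral>x. u x * v x \<partial>M\<bar> \<le> sqrt (\<integral>x. (u x)\<^sup>2 \<partial>M) * sqrt (\<integral>x. (v x)\<^sup>2 \<partial>M)"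
  using semi_inner.Cauchy_Schwarz[OF semi_inner_sqint assms]
  by (simp add: semi_inner.N_def[OF semi_inner_sqint] power2_eq_square)

text \<open>Fatou's lemma. With the nonnegative integral a finite bound also yields square
  integrability of the limit.\<close>

lemma nn_integral_square_limit_le:
  assumes [measurable]: "\<And>k. X k \<in> borel_measurable M"
    and lim: "AE x in M. (\<lambda>k. X k x) \<longlonglongrightarrow> u x"
    and bound: "eventually (\<lambda>k. (\<integral>\<^sup>+x. ennreal ((X k x)\<^sup>2) \<partial>M) \<le> C) sequentially"
  shows "(\<integral>\<^sup>+x. ennreal ((u x)\<^sup>2) \<partial>M) \<le> C"
proof -
  have "(\<integral>\<^sup>+x. ennreal ((u x)\<^sup>2) \<partial>M) = (\<integral>\<^sup>+x. liminf (\<lambda>k. ennreal ((X k x)\<^sup>2)) \<partial>M)"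
  proof (rule nn_integral_cong_AE)
    show "AE x in M. ennreal ((u x)\<^sup>2) = liminf (\<lambda>k. ennreal ((X k x)\<^sup>2))"
      using lim
    proof eventually_elim
      case (elim x)
      then have "(\<lambda>k. ennreal ((X k x)\<^sup>2)) \<longlonglongrightarrow> ennreal ((u x)\<^sup>2)"
        by (intro tendsto_intros)
      then show ?case by (intro lim_imp_Liminf[symmetric]) auto
    qed
  qed
  also have "\<dots> \<le> liminf (\<lambda>k. \<integral>\<^sup>+x. ennreal ((X k x)\<^sup>2) \<partial>M)"
    by (rule nn_integral_liminf) measurable
  also have "\<dots> \<le> liminf (\<lambda>k. C)"
    using bound by (rule Liminf_mono)
  also have "\<dots> = C" by (simp add: Liminf_const)
  finally show ?thesis .
qed

text \<open>By the inequality \<open>\<bar>d\<bar> \<le> 2\<^sup>-\<^sup>k + 2\<^sup>k d\<^sup>2\<close>, the increments of a rapidly converging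
  subsequence are summable almost everywhere.\<close>

lemma sqint_Cauchy_AE_subsequence:
  assumes X: "\<And>k. X k \<in> sqint M"
    and Cauchy: "\<And>e. e > 0 \<Longrightarrow> \<exists>K. \<forall>i\<ge>K. \<forall>j\<ge>K. (\<integral>x. (X i x - X j x)\<^sup>2 \<partial>M) < e"
  obtains u r where "u \<in> borel_measurable M" "strict_mono (r :: nat \<Rightarrow> nat)"
    "AE x in M. (\<lambda>k. X (r k) x) \<longlonglongrightarrow> u x"
proof -
  have [measurable]: "X k \<in> borel_measurable M" for k using X by measurable
  have "\<forall>k. \<exists>K. \<forall>i\<ge>K. \<forall>j\<ge>K. (\<integral>x. (X i x - X j x)\<^sup>2 \<partial>M) < (1/4) ^ k"
    by (intro allI Cauchy) simp
  then obtain K where K: "\<And>k i j. i \<ge> K k \<Longrightarrow> j \<ge> K k \<Longrightarrow> (\<integral>x. (X i x - X j x)\<^sup>2 \<partial>M) < (1/4) ^ k"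
    by metis
  \<comment> \<open>The sum dominates \<open>K k\<close>, and the added \<open>k\<close> makes
    \<open>r\<close> strictly increasing.\<close>
  define r where "r k = (\<Sum>i\<le>k. K i) + k" for k
  have r: "strict_mono r" by (rule strict_monoI_Suc) (simp add: r_def)
  have rK: "K k \<le> r k" for k
    unfolding r_def by (rule trans_le_add1) (rule member_le_sum, auto)
  have rK': "K k \<le> r (Suc k)" for k using rK[of k] strict_monoD[OF r, of k "Suc k"] by simp
  define D where "D k x = X (r (Suc k)) x - X (r k) x" for k x
  have Dint: "integrable M (\<lambda>x. (D k x)\<^sup>2)" for k
    using sqint_square[OF sqint_diff[OF X X]] by (simp add: D_def)
  have Dm[measurable]: "D k \<in> borel_measurable M" for k unfolding D_def[abs_def] by measurable
  \<comment> \<open>The integrals of the squared increments are below 4^-k, so a convergent series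
    remains after the weight 2^k that the pointwise inequality requires.\<close>
  have "(\<integral>\<^sup>+x. ennreal (2 ^ k * (D k x)\<^sup>2) \<partial>M) \<le> ennreal ((1/2) ^ k)" for k
  proof -
    have "(\<integral>\<^sup>+x. ennreal (2 ^ k * (D k x)\<^sup>2) \<partial>M) = ennreal (2 ^ k * (\<integral>x. (D k x)\<^sup>2 \<partial>M))"
      using Dint by (subst nn_integral_eq_integral) auto
    also have "\<dots> \<le> ennreal (2 ^ k * (1/4) ^ k)"
      using K[OF rK' rK, of k] by (intro ennreal_leI mult_left_mono) (auto simp: D_def)
    also have "(2::real) ^ k * (1/4) ^ k = (1/2) ^ k" by (simp flip: power_mult_distrib)
    finally show ?thesis .
  qed
  then have "(\<integral>\<^sup>+x. (\<Sum>k. ennreal (2 ^ k * (D k x)\<^sup>2)) \<partial>M) \<le> (\<Sum>k. ennreal ((1/2) ^ k))"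
    by (subst nn_integral_suminf) (auto intro!: suminf_le)
  also have "\<dots> = ennreal (\<Sum>k. (1/2) ^ k)" by (intro suminf_ennreal2) (auto intro!: summable_geometric)
  also have "\<dots> < \<infinity>" by simp
  finally have "AE x in M. (\<Sum>k. ennreal (2 ^ k * (D k x)\<^sup>2)) \<noteq> \<infinity>"
    by (intro nn_integral_PInf_AE) auto
  then have conv: "AE x in M. convergent (\<lambda>k. X (r k) x)"
  proof eventually_elim
    case (elim x)
    have "summable (\<lambda>k. 2 ^ k * (D k x)\<^sup>2)"
      by (rule summable_suminf_not_top) (use elim in auto)
    then have s: "summable (\<lambda>k. (1/2) ^ k + 2 ^ k * (D k x)\<^sup>2)"
      by (intro summable_add summable_geometric) auto
    have b: "norm (D k x) \<le> (1/2) ^ k + 2 ^ k * (D k x)\<^sup>2" for k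
    proof -
      define y where "y = 2 ^ k * \<bar>D k x\<bar>"
      have "0 \<le> (y - 1)\<^sup>2 + y" by (simp add: y_def)
      then have "y \<le> 1 + y\<^sup>2" by (simp add: power2_diff)
      then have "(1/2) ^ k * y \<le> (1/2) ^ k * (1 + y\<^sup>2)" by (intro mult_left_mono) auto
      then show ?thesis
        by (simp add: y_def power_mult_distrib distrib_left power_divide power2_eq_square field_simps)
    qed
    have "summable (\<lambda>k. D k x)"
      by (rule summable_comparison_test'[OF s, of 0]) (use b in auto)
    then have "convergent (\<lambda>n. \<Sum>k<n. D k x)" by (simp add: summable_iff_convergent)
    also have "(\<lambda>n. \<Sum>k<n. D k x) = (\<lambda>n. X (r n) x - X (r 0) x)"
      unfolding D_def by (rule ext) (rule sum_lessThan_telescope)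
    finally have "convergent (\<lambda>n. (X (r n) x - X (r 0) x) + X (r 0) x)"
      by (intro convergent_add convergent_const)
    then show ?case by simp
  qed
  show ?thesis
  proof (rule that[of "\<lambda>x. lim (\<lambda>k. X (r k) x)", OF _ r])
    show "(\<lambda>x. lim (\<lambda>k. X (r k) x)) \<in> borel_measurable M" by measurable
    show "AE x in M. (\<lambda>k. X (r k) x) \<longlonglongrightarrow> lim (\<lambda>k. X (r k) x)"
      using conv by (simp add: convergent_LIMSEQ_iff)
  qed
qed

subsection \<open>Difference quotients on the product space\<close>

text \<open>A countable cover by Borel sets of finite measure serves the completed measure as well.
  Tonelli and Fubini on the product depend on this.\<close>

interpretation leb: sigma_finite_measure "lebesgue :: 'a::euclidean_space measure"
proof
  obtain A :: "'a set set" where A: "countable A" "A \<subseteq> sets lborel" "\<Union>A = space lborel"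
      "\<forall>a\<in>A. emeasure lborel a \<noteq> \<infinity>"
    using lborel.sigma_finite_countable by blast
  show "\<exists>A::'a set set. countable A \<and> A \<subseteq> sets lebesgue \<and> \<Union> A = space lebesgue \<and>
      (\<forall>a\<in>A. emeasure lebesgue a \<noteq> \<infinity>)"
    by (rule exI[of _ A]) (use A in \<open>auto simp: emeasure_completion\<close>)
qed

interpretation leb_pair: pair_sigma_finite "lebesgue :: 'a::euclidean_space measure"
  "lebesgue :: 'b::euclidean_space measure" ..

abbreviation leb2 :: "('a::euclidean_space \<times> 'a) measure" where
  "leb2 \<equiv> lebesgue \<Otimes>\<^sub>M lebesgue"

lemma measurable_lebesgue_ident [measurable]: "(\<lambda>x. x) \<in> lebesgue \<rightarrow>\<^sub>M borel"
  by (simp add: measurable_completion)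

lemma measurable_leb2_fst [measurable]: "fst \<in> (leb2 :: ('a::euclidean_space \<times> 'a) measure) \<rightarrow>\<^sub>M borel"
  using measurable_compose[OF measurable_fst measurable_lebesgue_ident] by (simp add: o_def)

lemma measurable_leb2_snd [measurable]: "snd \<in> (leb2 :: ('a::euclidean_space \<times> 'a) measure) \<rightarrow>\<^sub>M borel"
  using measurable_compose[OF measurable_snd measurable_lebesgue_ident] by (simp add: o_def)

text \<open>In this way almost everywhere convergence of functions passes to their difference
  quotients on the product space.\<close>

lemma AE_leb2I:
  assumes "AE x in lebesgue. Q (x :: 'a::euclidean_space)"
  shows "AE p in leb2. Q (fst p) \<and> Q (snd p)"
proof -
  obtain A where A: "A \<in> null_sets lebesgue" "\<And>x. \<not> Q x \<Longrightarrow> x \<in> A"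
    using assms by (auto simp: eventually_ae_filter)
  then have [measurable]: "A \<in> sets lebesgue" by blast
  have ae: "AE x in lebesgue. x \<notin> A" by (rule AE_not_in) fact
  have "AE p in leb2. fst p \<notin> A \<and> snd p \<notin> A"
  proof (rule leb_pair.AE_pair_measure)
    show "{x \<in> space leb2. fst x \<notin> A \<and> snd x \<notin> A} \<in> sets leb2" by measurable
    show "AE x in lebesgue. AE y in lebesgue. fst (x, y) \<notin> A \<and> snd (x, y) \<notin> A"
      using ae by (auto elim!: eventually_mono)
  qed
  then show ?thesis by eventually_elim (use A(2) in blast)
qed

text \<open>Each factor carries half of the kernel exponent, so the Gagliardo form becomes the L2
  inner product of two difference quotients, which depend linearly on the function. On the diagonal
  the numerator vanishes.\<close>

definition dquot :: "real \<Rightarrow> ('a::euclidean_space \<Rightarrow> real) \<Rightarrow> 'a \<times> 'a \<Rightarrow> real" where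
  "dquot s u p = (u (fst p) - u (snd p)) / norm (fst p - snd p) powr (s / 2)"

lemma dquot_measurable [measurable]:
  assumes [measurable]: "u \<in> borel_measurable lebesgue"
  shows "dquot s u \<in> borel_measurable leb2"
  unfolding dquot_def[abs_def] by measurable

lemma dquot_add: "dquot s (u + v) = dquot s u + dquot s v"
  and dquot_scale: "dquot s (c *\<^sub>R u) = c *\<^sub>R dquot s u"
  and dquot_0: "dquot s 0 = 0"
  by (auto simp: dquot_def fun_eq_iff diff_divide_distrib add_divide_distrib algebra_simps)

lemma dquot_mult:
  "dquot s u (x, z) * dquot s w (x, z) = (u x - u z) * (w x - w z) / norm (x - z) powr s"
  by (simp add: dquot_def flip: powr_add)

lemma dquot_square: "(dquot s u (x, z))\<^sup>2 = \<bar>u x - u z\<bar>\<^sup>2 / norm (x - z) powr s"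
  using dquot_mult[of s u x z u] by (simp add: power2_eq_square)

lemma memLp_2_iff: "memLp 2 u \<longleftrightarrow> u \<in> sqint lebesgue"
  by (simp add: memLp_def sqint_def powr_numeral)

lemma Lp_norm_2: "Lp_norm 2 u = sqrt (\<integral>x. (u x)\<^sup>2 \<partial>lebesgue)"
  by (simp add: Lp_norm_def powr_numeral powr_half_sqrt)

lemma frac_sobolev_iff:
  fixes u :: "real^'n \<Rightarrow> real"
  shows "u \<in> frac_sobolev \<alpha> \<longleftrightarrow>
    u \<in> sqint lebesgue \<and> dquot (real CARD('n) + 2 * \<alpha>) u \<in> sqint leb2"
proof -
  have "(\<integral>\<^sup>+x. (\<integral>\<^sup>+z. ennreal (\<bar>u x - u z\<bar>\<^sup>2 / norm (x - z) powr (real CARD('n) + 2 * \<alpha>)) \<partial>lebesgue) \<partial>lebesgue)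
      = (\<integral>\<^sup>+p. ennreal ((dquot (real CARD('n) + 2 * \<alpha>) u p)\<^sup>2) \<partial>leb2)"
    if [measurable]: "u \<in> borel_measurable lebesgue"
    by (subst leb.nn_integral_fst[symmetric]) (auto simp: dquot_square)
  then show ?thesis
    unfolding frac_sobolev_def by (auto simp: memLp_2_iff sqint_iff_nn)
qed

lemma frac_form_eq:
  fixes u w :: "real^'n \<Rightarrow> real"
  assumes "u \<in> frac_sobolev \<alpha>" "w \<in> frac_sobolev \<alpha>"
  shows "frac_form \<alpha> u w = (\<integral>p. dquot (real CARD('n) + 2 * \<alpha>) u p * dquot (real CARD('n) + 2 * \<alpha>) w p \<partial>leb2)"
proof -
  have "integrable leb2 (\<lambda>p. dquot (real CARD('n) + 2 * \<alpha>) u p * dquot (real CARD('n) + 2 * \<alpha>) w p)"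
    using assms by (intro sqint_mult) (auto simp: frac_sobolev_iff)
  from leb_pair.integral_fst'[OF this] show ?thesis
    by (simp add: frac_form_def dquot_mult)
qed

subsection \<open>The energy space as a Hilbert space\<close>

locale coercive_potential =
  fixes \<alpha> :: real and V :: "real^'n \<Rightarrow> real" and V0 expo :: real
  assumes alpha: "0 < \<alpha>" and expo: "expo = real CARD('n) + 2 * \<alpha>"
    and V_cont: "continuous_on UNIV V"
    and V0: "0 < V0" and V_ge: "\<And>x. V0 \<le> V x"
begin

abbreviation "H \<equiv> HV \<alpha> V"

text \<open>With the root of the potential as a factor, the potential term is an unweighted L2 inner
  product too. Membership in \<open>H\<close> becomes square integrability of \<open>u\<close>,
  \<open>dquot expo u\<close> and \<open>sV u\<close>.\<close>

definition sV :: "(real^'n \<Rightarrow> real) \<Rightarrow> real^'n \<Rightarrow> real" where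
  "sV u x = sqrt (V x) * u x"

lemma V_nonneg: "0 \<le> V x"
  using V_ge[of x] V0 by linarith

lemma V_measurable [measurable]: "V \<in> borel_measurable lebesgue"
  using borel_measurable_continuous_onI[OF V_cont] by (simp add: measurable_completion)

lemma sV_measurable [measurable]: "u \<in> borel_measurable lebesgue \<Longrightarrow> sV u \<in> borel_measurable lebesgue"
  unfolding sV_def[abs_def]
  by (intro borel_measurable_times borel_measurable_sqrt measurable_compose[OF V_measurable]) auto

lemma sV_simps: "sV (u + v) = sV u + sV v" "sV (u - v) = sV u - sV v" "sV (c *\<^sub>R u) = c *\<^sub>R sV u" "sV 0 = 0"
  by (auto simp: sV_def fun_eq_iff algebra_simps)

lemma sV_mult: "sV u x * sV w x = V x * u x * w x"
  using V_nonneg[of x] by (simp add: sV_def)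

lemma sV_square: "(sV u x)\<^sup>2 = V x * (u x)\<^sup>2"
  using V_nonneg[of x] by (simp add: sV_def power_mult_distrib)

lemma HV_iff: "u \<in> H \<longleftrightarrow> u \<in> sqint lebesgue \<and> dquot expo u \<in> sqint leb2 \<and> sV u \<in> sqint lebesgue"
  by (auto simp: HV_def frac_sobolev_iff expo sqint_def[of lebesgue] sV_square)

lemma HV_D: "u \<in> H \<Longrightarrow> u \<in> sqint lebesgue" "u \<in> H \<Longrightarrow> dquot expo u \<in> sqint leb2" "u \<in> H \<Longrightarrow> sV u \<in> sqint lebesgue"
  by (simp_all add: HV_iff)

lemma HV_measurable [measurable_dest]: "u \<in> H \<Longrightarrow> u \<in> borel_measurable lebesgue"
  by (simp add: HV_iff sqint_def)

lemma HV_inner_eq: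
  assumes "u \<in> H" "w \<in> H"
  shows "HV_inner \<alpha> V u w = (\<integral>p. dquot expo u p * dquot expo w p \<partial>leb2) + (\<integral>x. sV u x * sV w x \<partial>lebesgue)"
  using assms by (simp add: HV_inner_def HV_def frac_form_eq expo sV_mult)

lemma subspace_HV: "subspace H"
  by (auto simp: subspace_def HV_iff dquot_add dquot_scale dquot_0 sV_simps intro: sqint_add sqint_scale sqint_0)

sublocale HVspace: semi_inner H "HV_inner \<alpha> V"
proof
  show "subspace H" by (rule subspace_HV)
  fix u v w :: "real^'n \<Rightarrow> real" and c :: real
  assume u: "u \<in> H" and w: "w \<in> H"
  have add: "u + v \<in> H" if "v \<in> H" for v using subspace_HV u that by (rule subspace_add)
  have sc: "c *\<^sub>R u \<in> H" using subspace_HV u by (rule subspace_scale)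
  { assume v: "v \<in> H"
    show "HV_inner \<alpha> V (u + v) w = HV_inner \<alpha> V u w + HV_inner \<alpha> V v w"
      using u v w add[OF v]
      by (simp add: HV_inner_eq dquot_add sV_simps distrib_right sqint_mult HV_D) }
  show "HV_inner \<alpha> V (c *\<^sub>R u) w = c * HV_inner \<alpha> V u w"
    using u w sc by (simp add: HV_inner_eq dquot_scale sV_simps mult.assoc distrib_left)
  show "HV_inner \<alpha> V u w = HV_inner \<alpha> V w u"
    using u w by (simp add: HV_inner_eq mult.commute)
  show "0 \<le> HV_inner \<alpha> V u u"
    using u by (simp add: HV_inner_eq integral_nonneg_AE)
qed

abbreviation "N \<equiv> HVspace.N"

lemma N_eq: "N u = HV_norm \<alpha> V u"
  by (simp add: HVspace.N_def HV_norm_def)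

lemma N_square_eq:
  assumes "u \<in> H"
  shows "(N u)\<^sup>2 = (\<integral>p. (dquot expo u p)\<^sup>2 \<partial>leb2) + (\<integral>x. (sV u x)\<^sup>2 \<partial>lebesgue)"
  using assms by (simp add: HVspace.N_sq HV_inner_eq flip: power2_eq_square)

lemma dquot_le_N:
  assumes "u \<in> H"
  shows "(\<integral>p. (dquot expo u p)\<^sup>2 \<partial>leb2) \<le> (N u)\<^sup>2" and "(\<integral>x. (sV u x)\<^sup>2 \<partial>lebesgue) \<le> (N u)\<^sup>2"
  using N_square_eq[OF assms] by (simp_all add: integral_nonneg_AE)

lemma L2_le_N:
  assumes u: "u \<in> H"
  shows "(\<integral>x. (u x)\<^sup>2 \<partial>lebesgue) \<le> (N u)\<^sup>2 / V0"
proof -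
  have "V0 * (\<integral>x. (u x)\<^sup>2 \<partial>lebesgue) = (\<integral>x. V0 * (u x)\<^sup>2 \<partial>lebesgue)" by simp
  also have "\<dots> \<le> (\<integral>x. (sV u x)\<^sup>2 \<partial>lebesgue)"
    using HV_D[OF u] by (intro integral_mono sqint_square) (auto simp: sV_square sqint_square intro!: mult_right_mono V_ge)
  also have "\<dots> \<le> (N u)\<^sup>2" by (rule dquot_le_N[OF u])
  finally show ?thesis using V0 by (simp add: field_simps)
qed

text \<open>Fatou is applied separately to the function, its difference quotient and its weighted
  version. The factor 2 arises because the two parts of \<open>(N u)\<^sup>2\<close> are each
  bounded by \<open>C\<^sup>2\<close>.\<close>

lemma HV_norm_limit:
  assumes X: "\<And>k. X k \<in> H" and u [measurable]: "u \<in> borel_measurable lebesgue"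
    and lim: "AE x in lebesgue. (\<lambda>k. X k x) \<longlonglongrightarrow> u x"
    and bound: "eventually (\<lambda>k. N (X k) \<le> C) sequentially"
  shows "u \<in> H" "N u \<le> 2 * C"
proof -
  have C: "0 \<le> C"
    using eventually_happens[OF bound] HVspace.N_nonneg[OF X] by (auto intro: order_trans)
  have D: "AE p in leb2. (\<lambda>k. dquot expo (X k) p) \<longlonglongrightarrow> dquot expo u p"
    using AE_leb2I[OF lim]
    by eventually_elim (unfold dquot_def divide_inverse, intro tendsto_mult_right tendsto_diff; blast)
  have W: "AE x in lebesgue. (\<lambda>k. sV (X k) x) \<longlonglongrightarrow> sV u x"
    using lim by eventually_elim (unfold sV_def, rule tendsto_mult_left)
  have sq: "(N (X k))\<^sup>2 \<le> C\<^sup>2" if "N (X k) \<le> C" for k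
    using HVspace.N_nonneg[OF X] that by (simp add: power_mono)
  have nD: "(\<integral>\<^sup>+p. ennreal ((dquot expo u p)\<^sup>2) \<partial>leb2) \<le> ennreal (C\<^sup>2)"
  proof (rule nn_integral_square_limit_le[OF _ D eventually_mono[OF bound]])
    show "dquot expo (X k) \<in> borel_measurable leb2" for k using X by measurable
    show "(\<integral>\<^sup>+p. ennreal ((dquot expo (X k) p)\<^sup>2) \<partial>leb2) \<le> ennreal (C\<^sup>2)" if "N (X k) \<le> C" for k
      using dquot_le_N(1)[OF X, of k] sq[OF that] sqint_square[OF HV_D(2)[OF X], of k]
      by (subst nn_integral_eq_integral) (auto intro!: ennreal_leI)
  qed
  have nW: "(\<integral>\<^sup>+x. ennreal ((sV u x)\<^sup>2) \<partial>lebesgue) \<le> ennreal (C\<^sup>2)"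
  proof (rule nn_integral_square_limit_le[OF _ W eventually_mono[OF bound]])
    show "sV (X k) \<in> borel_measurable lebesgue" for k using X by measurable
    show "(\<integral>\<^sup>+x. ennreal ((sV (X k) x)\<^sup>2) \<partial>lebesgue) \<le> ennreal (C\<^sup>2)" if "N (X k) \<le> C" for k
      using dquot_le_N(2)[OF X, of k] sq[OF that] sqint_square[OF HV_D(3)[OF X], of k]
      by (subst nn_integral_eq_integral) (auto intro!: ennreal_leI)
  qed
  have nL: "(\<integral>\<^sup>+x. ennreal ((u x)\<^sup>2) \<partial>lebesgue) \<le> ennreal (C\<^sup>2 / V0)"
  proof (rule nn_integral_square_limit_le[OF _ lim eventually_mono[OF bound]])
    show "X k \<in> borel_measurable lebesgue" for k using X by measurable
    show "(\<integral>\<^sup>+x. ennreal ((X k x)\<^sup>2) \<partial>lebesgue) \<le> ennreal (C\<^sup>2 / V0)" if "N (X k) \<le> C" for k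
    proof -
      have "(\<integral>x. (X k x)\<^sup>2 \<partial>lebesgue) \<le> C\<^sup>2 / V0"
        using L2_le_N[OF X, of k] divide_right_mono[OF sq[OF that], of V0] V0 by linarith
      then show ?thesis using sqint_square[OF HV_D(1)[OF X], of k]
        by (subst nn_integral_eq_integral) (auto intro!: ennreal_leI)
    qed
  qed
  have fin: "y < \<infinity>" if "y \<le> ennreal c" for y c
    using le_less_trans[OF that ennreal_less_top] by simp
  show H: "u \<in> H"
    unfolding HV_iff sqint_iff_nn using fin[OF nD] fin[OF nW] fin[OF nL] by simp
  have "(\<integral>p. (dquot expo u p)\<^sup>2 \<partial>leb2) \<le> C\<^sup>2"
    using nD sqint_square[OF HV_D(2)[OF H]] by (subst (asm) nn_integral_eq_integral) auto
  moreover have "(\<integral>x. (sV u x)\<^sup>2 \<partial>lebesgue) \<le> C\<^sup>2"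
    using nW sqint_square[OF HV_D(3)[OF H]] by (subst (asm) nn_integral_eq_integral) auto
  ultimately have "(N u)\<^sup>2 \<le> 2 * C\<^sup>2" using N_square_eq[OF H] by simp
  also have "\<dots> \<le> (2 * C)\<^sup>2" by (simp add: power2_eq_square)
  finally show "N u \<le> 2 * C" by (rule power2_le_imp_le) (use C in simp)
qed

sublocale HVspace: semi_hilbert H "HV_inner \<alpha> V"
proof
  fix X :: "nat \<Rightarrow> real^'n \<Rightarrow> real"
  assume X: "\<And>k. X k \<in> H" and cau: "\<And>e. e > 0 \<Longrightarrow> \<exists>K. \<forall>i\<ge>K. \<forall>j\<ge>K. N (X i - X j) < e"
  have "\<exists>K. \<forall>i\<ge>K. \<forall>j\<ge>K. (\<integral>x. (X i x - X j x)\<^sup>2 \<partial>lebesgue) < e" if e: "e > 0" for e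
  proof -
    obtain K where K: "\<forall>i\<ge>K. \<forall>j\<ge>K. N (X i - X j) < sqrt (e * V0)"
      using cau[of "sqrt (e * V0)"] e V0 by auto
    have "(\<integral>x. (X i x - X j x)\<^sup>2 \<partial>lebesgue) < e" if "i \<ge> K" "j \<ge> K" for i j
    proof -
      have d: "X i - X j \<in> H" by (intro HVspace.S_intros X)
      have "(N (X i - X j))\<^sup>2 < (sqrt (e * V0))\<^sup>2"
        using K that HVspace.N_nonneg[OF d] by (intro power_strict_mono) auto
      then have "(N (X i - X j))\<^sup>2 / V0 < e" using e V0 by (simp add: field_simps)
      then show ?thesis using L2_le_N[OF d] by simp
    qed
    then show ?thesis by blast
  qed
  then obtain u r where u [measurable]: "u \<in> borel_measurable lebesgue" and r: "strict_mono (r :: nat \<Rightarrow> nat)"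
    and lim: "AE x in lebesgue. (\<lambda>k. X (r k) x) \<longlonglongrightarrow> u x"
    using sqint_Cauchy_AE_subsequence[of X lebesgue, OF HV_D(1)[OF X]] by blast
  \<comment> \<open>For fixed \<open>i\<close>, lower semicontinuity along
    \<open>X i - X (r k)\<close> turns the Cauchy bound \<open>e\<close> into \<open>2 * e\<close>
    for \<open>X i - u\<close>. It also shows \<open>X i - u\<close> to lie in \<open>H\<close>,
    from which \<open>u\<close> itself does.\<close>
  have est: "\<exists>K. \<forall>i\<ge>K. X i - u \<in> H \<and> N (X i - u) \<le> 2 * e" if e: "e > 0" for e
  proof -
    obtain K where K: "\<forall>i\<ge>K. \<forall>j\<ge>K. N (X i - X j) < e"
      using cau[OF e] by blast
    have "X i - u \<in> H \<and> N (X i - u) \<le> 2 * e" if i: "i \<ge> K" for i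
    proof -
      have *: "\<And>k. X i - X (r k) \<in> H" by (intro HVspace.S_intros X)
      have "(X i - u) \<in> borel_measurable lebesgue"
        using HV_measurable[OF X] by (simp add: fun_diff_def)
      moreover have "AE x in lebesgue. (\<lambda>k. (X i - X (r k)) x) \<longlonglongrightarrow> (X i - u) x"
        using lim by eventually_elim (auto intro!: tendsto_intros)
      moreover have "\<forall>\<^sub>F k in sequentially. N (X i - X (r k)) \<le> e"
        using eventually_ge_at_top[of K]
      proof eventually_elim
        case (elim k)
        then have "r k \<ge> K" using seq_suble[OF r, of k] by linarith
        then show ?case using K i by (simp add: less_imp_le)
      qed
      ultimately show ?thesis using HV_norm_limit[of "\<lambda>k. X i - X (r k)" "X i - u" e] * by blast
    qed
    then show ?thesis by blast
  qed
  obtain K where "X K - u \<in> H" using est[of 1] by auto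
  then have "X K - (X K - u) \<in> H" by (rule HVspace.S_diff[OF X])
  then have uH: "u \<in> H" by simp
  have "(\<lambda>k. N (X k - u)) \<longlonglongrightarrow> 0"
  proof (rule LIMSEQ_I)
    fix e :: real assume e: "0 < e"
    obtain K where "\<forall>i\<ge>K. X i - u \<in> H \<and> N (X i - u) \<le> 2 * (e / 4)"
      using est[of "e/4"] e by auto
    then show "\<exists>no. \<forall>n\<ge>no. norm (N (X n - u) - 0) < e"
      using HVspace.N_nonneg e by (intro exI[of _ K]) force
  qed
  then show "\<exists>x\<in>H. (\<lambda>k. N (X k - x)) \<longlonglongrightarrow> 0" using uH by blast
qed

end

subsection \<open>Compactness in \<open>L\<^sup>2\<close>\<close>

text \<open>The floors encode half-open dyadic cubes of side 2^-m. Being half-open they partition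
  the space, so sums over cells involve no overlaps.\<close>

definition cell_index :: "nat \<Rightarrow> real^'n \<Rightarrow> 'n \<Rightarrow> int" where
  "cell_index m x j = \<lfloor>2 ^ m * x $ j\<rfloor>"

definition cell :: "nat \<Rightarrow> ('n \<Rightarrow> int) \<Rightarrow> (real^'n) set" where
  "cell m i = {x. cell_index m x = i}"

lemma cell_borel [measurable]: "cell m i \<in> sets borel"
proof -
  have "cell m i = (\<Inter>j. {x. \<lfloor>2 ^ m * x $ j\<rfloor> = i j})"
    by (auto simp: cell_def cell_index_def fun_eq_iff)
  also have "\<dots> \<in> sets borel"
    by (intro sets.finite_INT) auto
  finally show ?thesis .
qed

lemma cell_lebesgue [measurable]: "cell m i \<in> sets lebesgue"
  using cell_borel[of m i] by simp

text \<open>The half-open cube lies between an open and a closed box of equal volume.\<close>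

lemma emeasure_cell: "emeasure lebesgue (cell m i :: (real^'n) set) = ennreal ((1 / 2 ^ m) ^ CARD('n))"
proof -
  define a b :: "real^'n" where "a = (\<chi> j. of_int (i j) / 2 ^ m)" and "b = (\<chi> j. of_int (i j) / 2 ^ m + 1 / 2 ^ m)"
  have ba: "(b - a) \<bullet> k = 1 / 2 ^ m" if "k \<in> Basis" for k
    using that by (auto simp: a_def b_def Basis_vec_def inner_axis)
  have le: "a \<bullet> k \<le> b \<bullet> k" if "k \<in> Basis" for k
    using ba[OF that] by (simp add: inner_diff_left) (smt (verit) zero_le_divide_1_iff zero_le_power)
  have vol: "(\<Prod>k\<in>Basis. (b - a) \<bullet> k) = (1 / 2 ^ m) ^ CARD('n)"
    using ba by simp
  have "box a b \<subseteq> cell m i"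
    by (auto simp: cell_def cell_index_def fun_eq_iff mem_box_cart a_def b_def floor_eq_iff field_simps
        intro: less_imp_le)
  then have "emeasure lborel (box a b) \<le> emeasure lborel (cell m i)"
    by (intro emeasure_mono) auto
  then have lo: "ennreal ((1 / 2 ^ m) ^ CARD('n)) \<le> emeasure lborel (cell m i)"
    using le vol by simp
  have "cell m i \<subseteq> cbox a b"
    by (auto simp: cell_def cell_index_def fun_eq_iff mem_box_cart a_def b_def floor_eq_iff field_simps)
      (meson less_imp_le)
  then have "emeasure lborel (cell m i) \<le> emeasure lborel (cbox a b)"
    by (intro emeasure_mono) auto
  then have "emeasure lborel (cell m i) \<le> ennreal ((1 / 2 ^ m) ^ CARD('n))"
    using le vol by simp
  with lo show ?thesis by (simp add: antisym)
qed

lemma measure_cell: "measure lebesgue (cell m i :: (real^'n) set) = (1 / 2 ^ m) ^ CARD('n)"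
  by (simp add: measure_def emeasure_cell)

lemma integrable_cell: "integrable lebesgue (\<lambda>x. indicator (cell m i) x :: real)"
  by (simp add: emeasure_cell)

lemma indicator_square: "(indicator A x :: real)\<^sup>2 = indicator A x"
  by (simp add: indicator_def)

lemma sqint_cell: "(\<lambda>x. indicator (cell m i) x :: real) \<in> sqint lebesgue"
  by (simp add: sqint_def indicator_square emeasure_cell)

text \<open>The dimension appears as a factor because the Euclidean norm is bounded by the l1 norm;
  only the order 2^-m in the scale matters later.\<close>

lemma dist_cell_le:
  fixes x z :: "real^'n"
  assumes "x \<in> cell m i" "z \<in> cell m i"
  shows "norm (x - z) \<le> real CARD('n) / 2 ^ m"
proof -
  have "\<bar>(x - z) $ j\<bar> \<le> 1 / 2 ^ m" for j
  proof -
    have "\<lfloor>2 ^ m * x $ j\<rfloor> = \<lfloor>2 ^ m * z $ j\<rfloor>"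
      using assms by (auto simp: cell_def cell_index_def fun_eq_iff)
    then have "\<bar>2 ^ m * x $ j - 2 ^ m * z $ j\<bar> \<le> 1" by linarith
    moreover have "2 ^ m * x $ j - 2 ^ m * z $ j = 2 ^ m * (x - z) $ j"
      by (simp add: right_diff_distrib)
    ultimately have "2 ^ m * \<bar>(x - z) $ j\<bar> \<le> 1"
      by (simp only: abs_mult power_abs abs_numeral)
    then show ?thesis by (simp add: pos_le_divide_eq mult.commute)
  qed
  then have "(\<Sum>j\<in>UNIV. \<bar>(x - z) $ j\<bar>) \<le> (\<Sum>j\<in>(UNIV::'n set). 1 / 2 ^ m)"
    by (intro sum_mono)
  then show ?thesis using norm_le_l1_cart[of "x - z"] by simp
qed

text \<open>The products Q x Q of distinct cells are disjoint; hence the seminorms localised to the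
  cells add up to at most the global one.\<close>

lemma sum_cell_products_le_1:
  fixes p :: "(real^'n) \<times> (real^'n)"
  assumes "finite I"
  shows "(\<Sum>i\<in>I. indicator (cell m i) (fst p) * indicator (cell m i) (snd p) :: real) \<le> 1"
proof -
  have "(\<Sum>i\<in>I. indicator (cell m i) (fst p) * indicator (cell m i) (snd p) :: real)
      \<le> (\<Sum>i\<in>I. if i = cell_index m (fst p) then 1 else 0)"
    by (intro sum_mono) (auto simp: cell_def indicator_def)
  also have "\<dots> \<le> 1" using assms by simp
  finally show ?thesis .
qed

text \<open>The quantity \<open>\<bar>Q\<bar> \<integral>\<^sub>Q v\<^sup>2 - (\<integral>\<^sub>Q v)\<^sup>2\<close> is half of \<open>\<integral>\<integral>\<^bsub>Q\<times>Q\<^esub> (v x - v z)\<^sup>2\<close>, in which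
  the kernel is bounded below by a power of the diameter of \<open>Q\<close>.\<close>

lemma cell_Poincare:
  fixes v :: "real^'n \<Rightarrow> real" and m :: nat
  assumes v: "v \<in> sqint lebesgue" and D: "dquot s v \<in> sqint leb2" and s: "s > 0"
  defines "q \<equiv> (1 / 2 ^ m) ^ CARD('n)"
  shows "q * (\<integral>x. indicator (cell m i) x * (v x)\<^sup>2 \<partial>lebesgue)
     \<le> (\<integral>x. indicator (cell m i) x * v x \<partial>lebesgue)\<^sup>2
       + (real CARD('n) / 2 ^ m) powr s *
         (\<integral>p. indicator (cell m i) (fst p) * indicator (cell m i) (snd p) * (dquot s v p)\<^sup>2 \<partial>leb2)"
proof -
  let ?Q = "\<lambda>x. indicator (cell m i) x :: real"
  define A S where "A = (\<integral>x. ?Q x * v x \<partial>lebesgue)" and "S = (\<integral>x. ?Q x * (v x)\<^sup>2 \<partial>lebesgue)"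
  have [measurable]: "v \<in> borel_measurable lebesgue" using v by measurable
  have hA: "has_bochner_integral lebesgue (\<lambda>x. ?Q x * v x) A"
    unfolding A_def by (intro has_bochner_integral_integrable sqint_mult sqint_cell v)
  have hS: "has_bochner_integral lebesgue (\<lambda>x. ?Q x * (v x)\<^sup>2) S"
    unfolding S_def
    by (intro has_bochner_integral_integrable Bochner_Integration.integrable_bound[OF sqint_square[OF v]])
       (auto simp: indicator_def)
  have hq: "has_bochner_integral lebesgue ?Q q"
    unfolding q_def using has_bochner_integral_integrable[OF integrable_cell, of m i] by (simp add: measure_cell)
  define g where "g p = ?Q (fst p) * ?Q (snd p) * (v (fst p) - v (snd p))\<^sup>2" for p
  define g' where "g' p = ?Q (fst p) * ?Q (snd p) * (dquot s v p)\<^sup>2" for p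
  define C where "C = (real CARD('n) / 2 ^ m) powr s"
  have [measurable]: "dquot s v \<in> borel_measurable leb2" by measurable
  have gm [measurable]: "g \<in> borel_measurable leb2" unfolding g_def[abs_def] by measurable
  have gm' [measurable]: "g' \<in> borel_measurable leb2" unfolding g'_def[abs_def] by measurable
  have ig': "integrable leb2 g'"
    by (rule Bochner_Integration.integrable_bound[OF sqint_square[OF D]]) (auto simp: g'_def indicator_def)
  have gg': "g p \<le> C * g' p" for p
  \<comment> \<open>Coinciding points go to the second case: the division by a power of their
    distance yields 0, and both sides vanish.\<close>
  proof (cases "fst p \<in> cell m i \<and> snd p \<in> cell m i \<and> fst p \<noteq> snd p")
    case True
    then have n: "0 < norm (fst p - snd p)" "norm (fst p - snd p) \<le> real CARD('n) / 2 ^ m"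
      using dist_cell_le[of "fst p" m i "snd p"] by auto
    have "norm (fst p - snd p) powr s \<le> C"
      unfolding C_def using n s by (intro powr_mono2) auto
    then have "1 \<le> C / norm (fst p - snd p) powr s" using n by simp
    then have "(v (fst p) - v (snd p))\<^sup>2 * 1 \<le> (v (fst p) - v (snd p))\<^sup>2 * (C / norm (fst p - snd p) powr s)"
      by (intro mult_left_mono) auto
    then show ?thesis
      using True dquot_square[of s v "fst p" "snd p"] by (simp add: g_def g'_def mult.commute)
  next
    case False
    then show ?thesis by (auto simp: g_def g'_def C_def indicator_def)
  qed
  have g_bound: "norm (g p) \<le> norm (C * g' p)" for p
  proof -
    have "norm (g p) = g p" by (simp add: g_def)
    then show ?thesis using gg'[of p] abs_ge_self[of "C * g' p"] unfolding real_norm_def by linarith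
  qed
  have ig: "integrable leb2 g"
    by (rule Bochner_Integration.integrable_bound[OF integrable_mult_right[OF ig', of C] gm AE_I2[OF g_bound]])
  have inner: "(\<integral>z. g (x, z) \<partial>lebesgue) = ?Q x * ((v x)\<^sup>2 * q - 2 * v x * A + S)" for x
  proof (rule has_bochner_integral_integral_eq)
    have "has_bochner_integral lebesgue
        (\<lambda>z. ?Q x * ((v x)\<^sup>2 * ?Q z - 2 * v x * (?Q z * v z) + ?Q z * (v z)\<^sup>2))
        (?Q x * ((v x)\<^sup>2 * q - 2 * v x * A + S))"
      by (intro has_bochner_integral_mult_right has_bochner_integral_add has_bochner_integral_diff hA hS hq)
    then show "has_bochner_integral lebesgue (\<lambda>z. g (x, z)) (?Q x * ((v x)\<^sup>2 * q - 2 * v x * A + S))"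
      by (simp add: g_def power2_diff algebra_simps)
  qed
  have "has_bochner_integral lebesgue
      (\<lambda>x. q * (?Q x * (v x)\<^sup>2) - 2 * A * (?Q x * v x) + S * ?Q x) (q * S - 2 * A * A + S * q)"
    by (intro has_bochner_integral_mult_right has_bochner_integral_add has_bochner_integral_diff hA hS hq)
  then have "(\<integral>x. (\<integral>z. g (x, z) \<partial>lebesgue) \<partial>lebesgue) = q * S - 2 * A * A + S * q"
    unfolding inner by (intro has_bochner_integral_integral_eq) (simp add: algebra_simps)
  then have "2 * (q * S - A\<^sup>2) = integral\<^sup>L leb2 g"
    using leb_pair.integral_fst'[OF ig] by (simp add: power2_eq_square algebra_simps)
  also have "\<dots> \<le> (\<integral>p. C * g' p \<partial>leb2)"
    by (intro integral_mono ig integrable_mult_right ig' gg')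
  finally have *: "2 * (q * S - A\<^sup>2) \<le> C * integral\<^sup>L leb2 g'" by simp
  moreover have "0 \<le> C * integral\<^sup>L leb2 g'"
    by (intro mult_nonneg_nonneg integral_nonneg_AE) (auto simp: C_def g'_def)
  moreover have "a \<le> b + t" if "2 * (a - b) \<le> t" "0 \<le> t" for a b t :: real
    using that by argo
  ultimately have "q * S \<le> A\<^sup>2 + C * integral\<^sup>L leb2 g'" by blast
  then show ?thesis by (simp add: A_def S_def C_def g'_def[abs_def])
qed

lemma finite_cell_index_bounded:
  "finite (cell_index m ` {x :: real^'n. norm x \<le> b})"
proof -
  define K where "K = \<lceil>2 ^ m * b\<rceil> + 1"
  have floor_bounds: "- (\<lceil>c\<rceil> + 1) \<le> \<lfloor>y\<rfloor> \<and> \<lfloor>y\<rfloor> \<le> \<lceil>c\<rceil> + 1" if "y \<le> c \<and> - y \<le> c" for c y :: real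
    using that by linarith
  have "cell_index m x \<in> PiE UNIV (\<lambda>_. {-K..K})" if "norm x \<le> b" for x :: "real^'n"
  proof -
    have "\<bar>2 ^ m * x $ j\<bar> \<le> 2 ^ m * b" for j
      using component_le_norm_cart[of x j] that by (simp add: abs_mult)
    then have "-K \<le> cell_index m x j \<and> cell_index m x j \<le> K" for j
      unfolding cell_index_def K_def abs_le_iff by (metis floor_bounds)
    then show ?thesis by (simp add: PiE_UNIV_domain)
  qed
  then have "cell_index m ` {x :: real^'n. norm x \<le> b} \<subseteq> PiE UNIV (\<lambda>_. {-K..K})" by blast
  moreover have "finite (PiE (UNIV :: 'n set) (\<lambda>_. {-K..K}))" by (intro finite_PiE) auto
  ultimately show ?thesis by (rule finite_subset)
qed

context coercive_potential
begin

lemma L2_compactness_estimate: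
  assumes V: "filterlim V at_top at_infinity" and e: "e > 0"
  obtains m I where "finite I"
    "\<And>v. v \<in> H \<Longrightarrow> (\<integral>x. (v x)\<^sup>2 \<partial>lebesgue)
       \<le> 2 ^ (m * CARD('n)) * (\<Sum>i\<in>I. (\<integral>x. indicator (cell m i) x * v x \<partial>lebesgue)\<^sup>2) + e * (N v)\<^sup>2"
proof -
  have s: "expo > 0" using alpha by (simp add: expo add_nonneg_pos)
  \<comment> \<open>Dividing \<open>cell_Poincare\<close> by the volume of a cell leaves this factor
    in front of the seminorm. It tends to 0 because the kernel exponent exceeds the dimension by
    \<open>2 * \<alpha>\<close>.\<close>
  have "(\<lambda>m. real CARD('n) powr expo * (2 powr (- (2 * \<alpha>))) ^ m) \<longlonglongrightarrow> real CARD('n) powr expo * 0"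
    using alpha by (intro tendsto_mult_left LIMSEQ_realpow_zero) (auto simp: powr_less_one)
  then have "\<forall>\<^sub>F m in sequentially. real CARD('n) powr expo * (2 powr (- (2 * \<alpha>))) ^ m < e / 2"
    by (rule order_tendstoD(2)) (use e in simp)
  then obtain m where m: "real CARD('n) powr expo * (2 powr (- (2 * \<alpha>))) ^ m < e / 2"
    by (auto simp: eventually_sequentially)
  \<comment> \<open>Where \<open>V\<close> is at least \<open>2 / e\<close>, the square of
    \<open>v\<close> is at most \<open>e / 2\<close> times the potential density. Only the finitely
    many cells meeting the ball of radius \<open>b\<close> need their integrals.\<close>
  obtain b where b: "\<And>x. norm x \<ge> b \<Longrightarrow> 2 / e \<le> V x"
    using V by (auto simp: filterlim_at_top eventually_at_infinity)
  define I where "I = cell_index m ` {x :: real^'n. norm x \<le> b}"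
  have fin: "finite I" unfolding I_def by (rule finite_cell_index_bounded)
  define q :: real where "q = (1 / 2 ^ m) ^ CARD('n)"
  have q: "q > 0" and q1: "1 / q = 2 ^ (m * CARD('n))" by (simp_all add: q_def power_divide power_mult)
  define C where "C = (real CARD('n) / 2 ^ m) powr expo"
  have Cq: "C / q = real CARD('n) powr expo * (2 powr (- (2 * \<alpha>))) ^ m"
  proof -
    have "C = real CARD('n) powr expo / (2 powr real m) powr expo"
      by (simp add: C_def powr_divide powr_realpow)
    moreover have "q = 1 / (2 powr (real m * real CARD('n)))"
      by (simp add: q_def power_divide powr_realpow flip: power_mult of_nat_mult)
    moreover have "(2 powr (- (2 * \<alpha>))) ^ m = 2 powr (- (2 * \<alpha>) * real m)"
      by (simp add: powr_realpow[symmetric] powr_powr)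
    ultimately have "C / q = real CARD('n) powr expo * 2 powr (real m * real CARD('n) - real m * expo)"
      by (simp add: powr_powr powr_diff)
    moreover have "real m * real CARD('n) - real m * expo = - (2 * \<alpha>) * real m"
      by (simp add: expo algebra_simps)
    ultimately show ?thesis
      using \<open>(2 powr (- (2 * \<alpha>))) ^ m = _\<close> by simp
  qed
  have "(\<integral>x. (v x)\<^sup>2 \<partial>lebesgue)
       \<le> 2 ^ (m * CARD('n)) * (\<Sum>i\<in>I. (\<integral>x. indicator (cell m i) x * v x \<partial>lebesgue)\<^sup>2) + e * (N v)\<^sup>2"
    if v: "v \<in> H" for v
  proof -
    note vD = HV_D[OF v]
    let ?A = "\<lambda>i. (\<integral>x. indicator (cell m i) x * v x \<partial>lebesgue)"
    let ?G = "\<lambda>i p. indicator (cell m i) (fst p) * indicator (cell m i) (snd p) * (dquot expo v p)\<^sup>2"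
    have [measurable]: "v \<in> borel_measurable lebesgue" using v by measurable
    have iG: "integrable leb2 (?G i)" for i
      by (rule Bochner_Integration.integrable_bound[OF sqint_square[OF vD(2)]]) (auto simp: indicator_def)
    have iS: "integrable lebesgue (\<lambda>x. indicator (cell m i) x * (v x)\<^sup>2)" for i
      by (rule Bochner_Integration.integrable_bound[OF sqint_square[OF vD(1)]]) (auto simp: indicator_def)
    have pt: "(v x)\<^sup>2 \<le> (\<Sum>i\<in>I. indicator (cell m i) x * (v x)\<^sup>2) + e / 2 * (sV v x)\<^sup>2" for x
    proof (cases "cell_index m x \<in> I")
      case True
      have sum_eq: "(\<Sum>i\<in>I. indicator (cell m i) x * (v x)\<^sup>2) = (\<Sum>i\<in>I. if i = cell_index m x then (v x)\<^sup>2 else 0)"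
        by (intro sum.cong) (auto simp: cell_def indicator_def)
      then show ?thesis unfolding sum_eq using fin True e by simp
    next
      case False
      then have "norm x \<ge> b" by (auto simp: I_def)
      then have "1 * (v x)\<^sup>2 \<le> (e / 2 * V x) * (v x)\<^sup>2"
        using b[of x] e by (intro mult_right_mono) (auto simp: field_simps)
      moreover have "0 \<le> (\<Sum>i\<in>I. indicator (cell m i) x * (v x)\<^sup>2)"
        by (intro sum_nonneg) auto
      ultimately show ?thesis by (simp add: sV_square)
    qed
    have "(\<integral>x. (v x)\<^sup>2 \<partial>lebesgue)
       \<le> (\<integral>x. (\<Sum>i\<in>I. indicator (cell m i) x * (v x)\<^sup>2) + e / 2 * (sV v x)\<^sup>2 \<partial>lebesgue)"
      using vD pt by (intro integral_mono Bochner_Integration.integrable_add Bochner_Integration.integrable_sum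
          integrable_mult_right iS sqint_square)
    also have "\<dots> = (\<Sum>i\<in>I. \<integral>x. indicator (cell m i) x * (v x)\<^sup>2 \<partial>lebesgue) + e / 2 * (\<integral>x. (sV v x)\<^sup>2 \<partial>lebesgue)"
      using iS sqint_square[OF vD(3)] by (simp add: Bochner_Integration.integral_add Bochner_Integration.integral_sum)
    also have "\<dots> \<le> (\<Sum>i\<in>I. (?A i)\<^sup>2 / q + C / q * (\<integral>p. ?G i p \<partial>leb2)) + e / 2 * (N v)\<^sup>2"
    proof (intro add_mono sum_mono mult_left_mono dquot_le_N[OF v])
      fix i
      show "(\<integral>x. indicator (cell m i) x * (v x)\<^sup>2 \<partial>lebesgue) \<le> (?A i)\<^sup>2 / q + C / q * (\<integral>p. ?G i p \<partial>leb2)"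
        using cell_Poincare[OF vD(1,2) s, of m i] q unfolding q_def[symmetric] C_def[symmetric]
        by (simp add: field_simps)
    qed (use e in auto)
    also have "(\<Sum>i\<in>I. (?A i)\<^sup>2 / q + C / q * (\<integral>p. ?G i p \<partial>leb2))
        = 1 / q * (\<Sum>i\<in>I. (?A i)\<^sup>2) + C / q * (\<integral>p. (\<Sum>i\<in>I. ?G i p) \<partial>leb2)"
      using iG by (simp add: sum.distrib sum_distrib_left Bochner_Integration.integral_sum)
    also have "(\<integral>p. (\<Sum>i\<in>I. ?G i p) \<partial>leb2) \<le> (\<integral>p. (dquot expo v p)\<^sup>2 \<partial>leb2)"
    proof (intro integral_mono Bochner_Integration.integrable_sum iG sqint_square vD)
      fix p
      have "(\<Sum>i\<in>I. ?G i p) = (\<Sum>i\<in>I. indicator (cell m i) (fst p) * indicator (cell m i) (snd p)) * (dquot expo v p)\<^sup>2"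
        by (simp add: sum_distrib_right)
      also have "\<dots> \<le> 1 * (dquot expo v p)\<^sup>2"
        by (intro mult_right_mono sum_cell_products_le_1 fin) auto
      finally show "(\<Sum>i\<in>I. ?G i p) \<le> (dquot expo v p)\<^sup>2" by simp
    qed
    also have "\<dots> \<le> (N v)\<^sup>2" by (rule dquot_le_N[OF v])
    finally have "(\<integral>x. (v x)\<^sup>2 \<partial>lebesgue) \<le> 1 / q * (\<Sum>i\<in>I. (?A i)\<^sup>2) + C / q * (N v)\<^sup>2 + e / 2 * (N v)\<^sup>2"
      using q by (simp add: C_def mult_left_mono divide_right_mono)
    also have "C / q * (N v)\<^sup>2 \<le> e / 2 * (N v)\<^sup>2"
      using m Cq by (intro mult_right_mono) auto
    finally show ?thesis unfolding q1 by (simp add: algebra_simps)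
  qed
  then show ?thesis using that fin by blast
qed

lemma L2_Cauchy_subsequence:
  assumes V: "filterlim V at_top at_infinity"
    and X: "\<And>k. X k \<in> H" and R: "\<And>k. N (X k) \<le> R"
  obtains r where "strict_mono (r :: nat \<Rightarrow> nat)"
    "\<And>e. e > 0 \<Longrightarrow> \<exists>K. \<forall>i\<ge>K. \<forall>j\<ge>K. (\<integral>x. (X (r i) x - X (r j) x)\<^sup>2 \<partial>lebesgue) < e"
proof -
  \<comment> \<open>The scale \<open>m\<close> depends on the accuracy, but one subsequence must
    serve all accuracies. So the integrals over all cells of all scales, a countable family, are
    made to converge together.\<close>
  define F where "F k p = (\<integral>x. indicator (cell (fst p) (snd p)) x * X k x \<partial>lebesgue)" for k p
  have "norm (F k p) \<le> sqrt (R\<^sup>2 / V0)" for k p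
  proof -
    have "\<bar>F k p\<bar> \<le> sqrt (\<integral>x. (indicator (cell (fst p) (snd p)) x)\<^sup>2 \<partial>lebesgue) * sqrt (\<integral>x. (X k x)\<^sup>2 \<partial>lebesgue)"
      unfolding F_def by (intro Cauchy_Schwarz_integral sqint_cell HV_D X)
    also have "\<dots> \<le> 1 * sqrt (R\<^sup>2 / V0)"
    proof (intro mult_mono)
      show "sqrt (\<integral>x. (indicator (cell (fst p) (snd p)) x)\<^sup>2 \<partial>lebesgue) \<le> 1"
        by (simp add: indicator_square measure_cell power_le_one)
      have "(\<integral>x. (X k x)\<^sup>2 \<partial>lebesgue) \<le> (N (X k))\<^sup>2 / V0" by (intro L2_le_N X)
      also have "\<dots> \<le> R\<^sup>2 / V0"
        using HVspace.N_nonneg[OF X, of k] R[of k] V0 by (intro divide_right_mono power_mono) auto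
      finally show "sqrt (\<integral>x. (X k x)\<^sup>2 \<partial>lebesgue) \<le> sqrt (R\<^sup>2 / V0)" by simp
    qed (auto simp: integral_nonneg_AE)
    finally show ?thesis by simp
  qed
  then obtain r where r: "strict_mono (r :: nat \<Rightarrow> nat)"
      and conv: "\<And>p. \<exists>l. (\<lambda>k. F (r k) p) \<longlonglongrightarrow> l"
    using function_convergent_subsequence[of UNIV F "sqrt (R\<^sup>2 / V0)"]
    by (metis UNIV_I countableI_type)
  have "\<exists>K. \<forall>i\<ge>K. \<forall>j\<ge>K. (\<integral>x. (X (r i) x - X (r j) x)\<^sup>2 \<partial>lebesgue) < e" if e: "e > 0" for e
  proof -
    \<comment> \<open>Differences have length at most \<open>2 * R\<close>, so the remainder
      \<open>e' * (N ?v)\<^sup>2\<close> stays below \<open>e / 2\<close>; the added 1 covers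
      \<open>R = 0\<close>.\<close>
    define e' where "e' = e / (2 * (4 * R\<^sup>2 + 1))"
    have e': "e' > 0" using e by (simp add: e'_def add_nonneg_pos)
    obtain m I where fin: "finite I" and est: "\<And>v. v \<in> H \<Longrightarrow> (\<integral>x. (v x)\<^sup>2 \<partial>lebesgue)
       \<le> 2 ^ (m * CARD('n)) * (\<Sum>i\<in>I. (\<integral>x. indicator (cell m i) x * v x \<partial>lebesgue)\<^sup>2) + e' * (N v)\<^sup>2"
    proof (rule L2_compactness_estimate[OF V e'], goal_cases)
      case (1 m I)
      show ?case by (rule 1(1)[OF 1(2)]) (rule 1(3))
    qed
    define P c :: real where "P = 2 * 2 ^ (m * CARD('n))" and "c = real (card I)"
    have P: "0 < P" and c: "0 \<le> c" by (simp_all add: P_def c_def)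
    \<comment> \<open>Solves for \<open>card I\<close> squares of size
      \<open>\<delta>\<^sup>2\<close>, multiplied by \<open>P\<close>, to be at most
      \<open>e\<close>; the added 1 covers empty \<open>I\<close>.\<close>
    define \<delta> where "\<delta> = sqrt (e / P / (c + 1))"
    have \<delta>: "\<delta> > 0" unfolding \<delta>_def
      using P c e by (intro real_sqrt_gt_zero divide_pos_pos) auto
    have \<delta>_sq: "\<delta>\<^sup>2 = e / P / (c + 1)"
      unfolding \<delta>_def using P c e by (intro real_sqrt_pow2) auto
    have "\<exists>K. \<forall>k\<ge>K. \<forall>l\<ge>K. \<bar>F (r k) (m, i) - F (r l) (m, i)\<bar> < \<delta>" for i
    proof -
      have "Cauchy (\<lambda>k. F (r k) (m, i))" using conv[of "(m, i)"] by (auto intro: LIMSEQ_imp_Cauchy)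
      then show ?thesis using \<delta> by (auto simp: Cauchy_def dist_real_def)
    qed
    then obtain Ki where Ki: "\<And>i k l. k \<ge> Ki i \<Longrightarrow> l \<ge> Ki i \<Longrightarrow> \<bar>F (r k) (m, i) - F (r l) (m, i)\<bar> < \<delta>"
      by metis
    define K where "K = (\<Sum>i\<in>I. Ki i)"
    have K: "Ki i \<le> K" if "i \<in> I" for i unfolding K_def using fin that by (intro member_le_sum) auto
    have "(\<integral>x. (X (r k) x - X (r l) x)\<^sup>2 \<partial>lebesgue) < e" if kl: "k \<ge> K" "l \<ge> K" for k l
    proof -
      let ?v = "X (r k) - X (r l)"
      have vH: "?v \<in> H" by (intro HVspace.S_intros X)
      have "(\<Sum>i\<in>I. (\<integral>x. indicator (cell m i) x * ?v x \<partial>lebesgue)\<^sup>2) \<le> (\<Sum>i\<in>I. \<delta>\<^sup>2)"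
      proof (intro sum_mono)
        fix i assume i: "i \<in> I"
        have "(\<integral>x. indicator (cell m i) x * ?v x \<partial>lebesgue) = F (r k) (m, i) - F (r l) (m, i)"
          using sqint_mult[OF sqint_cell HV_D(1)[OF X]] by (simp add: F_def right_diff_distrib)
        moreover have "\<bar>F (r k) (m, i) - F (r l) (m, i)\<bar> < \<delta>"
          using Ki K[OF i] kl by (meson order_trans)
        ultimately show "(\<integral>x. indicator (cell m i) x * ?v x \<partial>lebesgue)\<^sup>2 \<le> \<delta>\<^sup>2"
          using \<delta> by (simp add: abs_le_square_iff[symmetric])
      qed
      also have "\<dots> = c * \<delta>\<^sup>2" by (simp add: c_def)
      also have "\<dots> = e / P * (c / (c + 1))" by (simp add: \<delta>_sq)
      also have "\<dots> \<le> e / P * 1"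
        using P c e by (intro mult_left_mono) auto
      finally have "P * (\<Sum>i\<in>I. (\<integral>x. indicator (cell m i) x * ?v x \<partial>lebesgue)\<^sup>2) \<le> e"
        using P by (simp add: pos_le_divide_eq mult.commute)
      then have 1: "2 ^ (m * CARD('n)) * (\<Sum>i\<in>I. (\<integral>x. indicator (cell m i) x * ?v x \<partial>lebesgue)\<^sup>2) \<le> e / 2"
        unfolding P_def mult.assoc by linarith
      have "N ?v \<le> 2 * R"
        using HVspace.N_triangle_diff[OF X X, of "r k" "r l"] R[of "r k"] R[of "r l"] by linarith
      then have "(N ?v)\<^sup>2 \<le> (2 * R)\<^sup>2" using HVspace.N_nonneg[OF vH] by (intro power_mono)
      then have "e' * (N ?v)\<^sup>2 \<le> e' * (4 * R\<^sup>2)" using e' by (simp add: power_mult_distrib)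
      also have "\<dots> < e' * (4 * R\<^sup>2 + 1)" using e' by simp
      also have "\<dots> = e / 2"
      proof -
        have *: "e / (2 * K) * K = e / 2" if "K \<noteq> 0" for K :: real using that by simp
        have "0 < 4 * R\<^sup>2 + 1" by (intro add_nonneg_pos) auto
        then show ?thesis unfolding e'_def by (intro *) simp
      qed
      finally show ?thesis using est[OF vH] 1 by simp
    qed
    then show ?thesis by blast
  qed
  with r show ?thesis using that by blast
qed

end

subsection \<open>The energy space is nontrivial\<close>

lemma ex_power_two_between:
  fixes t :: real
  assumes "1 \<le> t"
  shows "\<exists>j. 2 ^ j \<le> t \<and> t < 2 ^ Suc j"
proof -
  obtain n where "t < 2 ^ n" using real_arch_pow[of 2 t] by auto
  define m where "m = (LEAST n. t < 2 ^ n)"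
  have m: "t < 2 ^ m" unfolding m_def by (rule LeastI) fact
  then have "m \<noteq> 0" using assms by (intro notI) simp
  then obtain j where j: "m = Suc j" using not0_implies_Suc by blast
  have "\<not> t < 2 ^ j"
    using not_less_Least[of j "\<lambda>n. t < 2 ^ n"] j by (simp add: m_def)
  then show ?thesis using m j by (intro exI[of _ j]) auto
qed

lemma powr_of_two_power: "(2 ^ k) powr y = (2 powr y :: real) ^ k"
  by (simp add: powr_realpow[symmetric] powr_powr mult.commute)

text \<open>Dyadic majorant of the kernel \<open>min 1 (t\<^sup>2) / t\<^sup>s\<close>; the balls of radius \<open>t\<close> around a point enter
  only through their volume, so that the integral over \<open>\<real>\<^sup>n\<close> reduces to geometric series.\<close>

lemma kernel_dyadic_bound:
  fixes x z :: "'a::euclidean_space"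
  assumes s: "2 \<le> s"
  shows "ennreal (min 1 ((norm (x - z))\<^sup>2) / norm (x - z) powr s)
    \<le> (\<Sum>j. ennreal ((2 powr (s - 2)) ^ Suc j) * indicator (cball x ((1/2) ^ j)) z
          + ennreal ((2 powr - s) ^ j) * indicator (cball x (2 ^ Suc j)) z)"
    (is "_ \<le> (\<Sum>j. ?a j z + ?b j z)")
proof -
  define t where "t = norm (x - z)"
  have part: "?a j z + ?b j z \<le> (\<Sum>j. ?a j z + ?b j z)" for j
    using sum_le_suminf[of "\<lambda>j. ?a j z + ?b j z" "{j}"] by auto
  consider "t = 0" | "0 < t" "t \<le> 1" | "1 < t"
    using norm_ge_zero[of "x - z"] unfolding t_def by linarith
  then show ?thesis
  proof cases
    case 1 then show ?thesis by (simp add: t_def)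
  next
    case 2
    then obtain j where j: "2 ^ j \<le> 1 / t" "1 / t < 2 ^ Suc j"
      using ex_power_two_between[of "1 / t"] by auto
    have tj: "t \<le> (1/2) ^ j" using j(1) 2 by (simp add: field_simps power_divide)
    have "min 1 (t\<^sup>2) / t powr s = t powr 2 / t powr s"
      using 2 by (simp add: powr_numeral power_le_one min_absorb2)
    also have "\<dots> = (1 / t) powr (s - 2)"
      using 2 by (simp add: powr_divide powr_diff)
    also have "\<dots> \<le> (2 ^ Suc j) powr (s - 2)"
      using j(2) 2 s by (intro powr_mono2) auto
    also have "\<dots> = (2 powr (s - 2)) ^ Suc j"
      by (rule powr_of_two_power)
    finally have "ennreal (min 1 (t\<^sup>2) / t powr s) \<le> ?a j z"
      using tj by (simp add: t_def dist_norm ennreal_leI)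
    also have "\<dots> \<le> ?a j z + ?b j z" by simp
    also note part
    finally show ?thesis by (simp add: t_def)
  next
    case 3
    then obtain j where j: "2 ^ j \<le> t" "t < 2 ^ Suc j"
      using ex_power_two_between[of t] by auto
    have "min 1 (t\<^sup>2) / t powr s = t powr - s"
      using 3 by (simp add: powr_minus divide_inverse min_absorb1)
    also have "\<dots> \<le> (2 ^ j) powr - s"
      using j(1) s by (intro powr_mono2') auto
    also have "\<dots> = (2 powr - s) ^ j"
      by (rule powr_of_two_power)
    finally have "ennreal (min 1 (t\<^sup>2) / t powr s) \<le> ?b j z"
      using j(2) by (simp add: t_def dist_norm ennreal_leI)
    also have "\<dots> \<le> ?a j z + ?b j z" by simp
    also note part
    finally show ?thesis by (simp add: t_def)
  qed
qed

text \<open>After multiplication by the volumes of the balls the two dyadic series have ratios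
  \<open>2 powr (- (2 - 2 * \<alpha>))\<close> and \<open>2 powr (- (2 * \<alpha>))\<close>:
  convergence near \<open>x\<close> comes from \<alpha> < 1, convergence at infinity from 0 <
  \<alpha>.\<close>

lemma kernel_integral_bounded:
  assumes \<alpha>: "0 < \<alpha>" "\<alpha> < 1" and s: "s = real CARD('n) + 2 * \<alpha>" "2 \<le> s"
  obtains C where "C < \<infinity>" "\<And>x :: real^'n.
    (\<integral>\<^sup>+z. ennreal (min 1 ((norm (x - z))\<^sup>2) / norm (x - z) powr s) \<partial>lebesgue) \<le> C"
proof -
  define \<omega> where "\<omega> = unit_ball_vol (real CARD('n))"
  define n where "n = CARD('n)"
  define c where "c j = (2 powr (s - 2)) ^ Suc j * (\<omega> * ((1/2) ^ j) ^ n)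
      + (2 powr - s) ^ j * (\<omega> * (2 ^ Suc j) ^ n)" for j
  have \<omega>: "0 \<le> \<omega>" by (simp add: \<omega>_def)
  have ball: "emeasure lborel (cball x r) = ennreal (\<omega> * r ^ n)" if "r \<ge> 0" for x :: "real^'n" and r
    using emeasure_cball[OF that, of x] by (simp add: \<omega>_def n_def)
  have combine: "ennreal a * ennreal b + ennreal a' * ennreal b' = ennreal (a * b + a' * b')"
    if "0 \<le> a" "0 \<le> b" "0 \<le> a'" "0 \<le> b'" for a b a' b'
    using that by (simp add: ennreal_mult ennreal_plus)
  have c0: "0 \<le> c j" for j using \<omega> by (simp add: c_def)
  have pn: "2 powr real n = (2::real) ^ n" by (simp add: powr_realpow)
  have r1: "2 powr (s - 2) * (1/2) ^ n = 2 powr (- (2 - 2 * \<alpha>))"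
  proof -
    have "2 powr (s - 2) * (1/2) ^ n = 2 powr (s - 2) / 2 powr real n"
      by (simp add: pn power_divide)
    also have "\<dots> = 2 powr (s - 2 - real n)" by (simp add: powr_diff)
    finally show ?thesis by (simp add: s n_def)
  qed
  have r2: "2 powr - s * 2 ^ n = 2 powr (- (2 * \<alpha>))"
  proof -
    have "2 powr - s * 2 ^ n = 2 powr (- s + real n)" by (subst powr_add) (simp add: pn)
    then show ?thesis by (simp add: s n_def)
  qed
  have c_eq: "c j = \<omega> * 2 powr (s - 2) * (2 powr (- (2 - 2 * \<alpha>))) ^ j + \<omega> * 2 ^ n * (2 powr (- (2 * \<alpha>))) ^ j" for j
  proof -
    have swap: "(x ^ j) ^ n = (x ^ n) ^ j" for x :: real
      by (simp only: power_mult[symmetric] mult.commute)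
    have "(2 powr (s - 2)) ^ Suc j * (\<omega> * ((1/2) ^ j) ^ n)
        = \<omega> * 2 powr (s - 2) * (2 powr (s - 2) * (1/2) ^ n) ^ j"
      unfolding swap by (simp add: power_mult_distrib)
    moreover have "(2 powr - s) ^ j * (\<omega> * (2 ^ Suc j) ^ n) = \<omega> * 2 ^ n * (2 powr - s * 2 ^ n) ^ j"
      unfolding power_Suc power_mult_distrib swap by simp
    ultimately show ?thesis unfolding c_def by (simp only: r1 r2)
  qed
  have "summable c"
    unfolding c_eq[abs_def] using \<alpha>
    by (intro summable_add summable_mult summable_geometric) (auto simp: powr_less_one)
  then have "(\<Sum>j. ennreal (c j)) = ennreal (suminf c)"
    by (rule suminf_ennreal2[OF c0])
  then have fin: "(\<Sum>j. ennreal (c j)) < \<infinity>" by simp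
  have "(\<integral>\<^sup>+z. ennreal (min 1 ((norm (x - z))\<^sup>2) / norm (x - z) powr s) \<partial>lebesgue) \<le> (\<Sum>j. ennreal (c j))"
    for x :: "real^'n"
  proof -
    have [measurable]: "cball x r \<in> sets lebesgue" for r by simp
    have "(\<integral>\<^sup>+z. ennreal (min 1 ((norm (x - z))\<^sup>2) / norm (x - z) powr s) \<partial>lebesgue)
      \<le> (\<integral>\<^sup>+z. (\<Sum>j. ennreal ((2 powr (s - 2)) ^ Suc j) * indicator (cball x ((1/2) ^ j)) z
          + ennreal ((2 powr - s) ^ j) * indicator (cball x (2 ^ Suc j)) z) \<partial>lebesgue)"
      by (intro nn_integral_mono kernel_dyadic_bound s)
    also have "\<dots> = (\<Sum>j. \<integral>\<^sup>+z. ennreal ((2 powr (s - 2)) ^ Suc j) * indicator (cball x ((1/2) ^ j)) z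
          + ennreal ((2 powr - s) ^ j) * indicator (cball x (2 ^ Suc j)) z \<partial>lebesgue)"
      by (intro nn_integral_suminf) measurable
    also have "\<dots> = (\<Sum>j. ennreal (c j))"
    proof (intro suminf_cong)
      fix j
      have "(\<integral>\<^sup>+z. ennreal ((2 powr (s - 2)) ^ Suc j) * indicator (cball x ((1/2) ^ j)) z
          + ennreal ((2 powr - s) ^ j) * indicator (cball x (2 ^ Suc j)) z \<partial>lebesgue)
        = ennreal ((2 powr (s - 2)) ^ Suc j) * ennreal (\<omega> * ((1/2) ^ j) ^ n)
          + ennreal ((2 powr - s) ^ j) * ennreal (\<omega> * (2 ^ Suc j) ^ n)"
        by (subst nn_integral_add) (simp_all add: nn_integral_cmult ball del: power_Suc)
      also have "\<dots> = ennreal (c j)"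
        unfolding c_def by (rule combine) (use \<omega> in \<open>auto intro!: mult_nonneg_nonneg\<close>)
      finally show "(\<integral>\<^sup>+z. ennreal ((2 powr (s - 2)) ^ Suc j) * indicator (cball x ((1/2) ^ j)) z
          + ennreal ((2 powr - s) ^ j) * indicator (cball x (2 ^ Suc j)) z \<partial>lebesgue) = ennreal (c j)" .
    qed
    finally show ?thesis .
  qed
  with fin show ?thesis using that by blast
qed

text \<open>This tent will span the ray along which the energy becomes negative. It is Lipschitz
  with bounded support, which is enough for a finite Gagliardo seminorm when \<alpha> < 1.\<close>

definition hat :: "'a::euclidean_space \<Rightarrow> real" where
  "hat x = max 0 (1 - norm x)"

lemma hat_bounds: "0 \<le> hat x" "hat x \<le> 1" "x \<notin> cball 0 1 \<Longrightarrow> hat x = 0"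
  by (auto simp: hat_def)

lemma hat_ge_half: "norm x \<le> 1 / 2 \<Longrightarrow> 1 / 2 \<le> hat x"
  by (simp add: hat_def)

lemma hat_continuous: "continuous_on A hat"
  unfolding hat_def[abs_def] by (intro continuous_intros)

lemma hat_measurable [measurable]: "hat \<in> borel_measurable lebesgue"
  using borel_measurable_continuous_onI[OF hat_continuous] by (intro measurable_completion) simp

text \<open>The minimum combines the Lipschitz bound with the bound 1, and the indicators record
  that one of the points must lie in the support. The double integral thus reduces to integrals over
  a ball of a uniformly bounded inner integral.\<close>

lemma hat_diff_square_le:
  "(hat x - hat z)\<^sup>2 \<le> (indicator (cball 0 1) x + indicator (cball 0 1) z) * min 1 ((norm (x - z))\<^sup>2)"
proof (cases "x \<in> cball 0 1 \<or> z \<in> cball 0 1")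
  case True
  have "\<bar>hat x - hat z\<bar> \<le> norm (x - z)"
    using norm_triangle_ineq3[of x z] by (simp add: hat_def)
  moreover have "\<bar>hat x - hat z\<bar> \<le> 1"
    using hat_bounds(1,2)[of x] hat_bounds(1,2)[of z] by simp
  ultimately have "\<bar>hat x - hat z\<bar>\<^sup>2 \<le> min 1 ((norm (x - z))\<^sup>2)"
    by (simp only: min.bounded_iff) (metis abs_ge_zero power_mono power_one)
  also have "\<dots> \<le> (indicator (cball 0 1) x + indicator (cball 0 1) z) * min 1 ((norm (x - z))\<^sup>2)"
    using True by (auto simp: indicator_def)
  finally show ?thesis by simp
next
  case False
  then show ?thesis using hat_bounds(3)[of x] hat_bounds(3)[of z] by simp
qed

context coercive_potential
begin

lemma hat_in_HV:
  assumes \<alpha>1: "\<alpha> < 1" and n: "CARD('n) \<ge> 2"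
  shows "(hat :: real^'n \<Rightarrow> real) \<in> H"
proof -
  let ?h = "hat :: real^'n \<Rightarrow> real"
  let ?B = "cball 0 1 :: (real^'n) set"
  have B: "integrable lebesgue (\<lambda>x. indicator ?B x :: real)" by (simp add: emeasure_cball)
  have hB: "(hat x)\<^sup>2 \<le> indicator ?B x" for x
    using hat_bounds[of x] by (cases "x \<in> ?B") (auto simp: power_le_one)
  have 1: "hat \<in> sqint (lebesgue :: (real^'n) measure)"
    unfolding sqint_def
    using hB by (auto intro!: Bochner_Integration.integrable_bound[OF B])
  have "compact (V ` ?B)"
    by (intro compact_continuous_image continuous_on_subset[OF V_cont]) auto
  then have "bdd_above (V ` ?B)"
    by (intro bounded_imp_bdd_above compact_imp_bounded)
  then obtain M where M: "\<And>x. x \<in> ?B \<Longrightarrow> V x \<le> M"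
    unfolding bdd_above_def by blast
  have M0: "0 \<le> M" using M[of 0] V_nonneg[of 0] by simp
  have VB: "V x * (hat x)\<^sup>2 \<le> M * indicator ?B x" for x
  proof -
    have "V x * (hat x)\<^sup>2 \<le> V x * indicator ?B x"
      by (intro mult_left_mono hB V_nonneg)
    also have "\<dots> \<le> M * indicator ?B x"
      using M[of x] by (auto simp: indicator_def)
    finally show ?thesis .
  qed
  have 2: "sV hat \<in> sqint lebesgue"
  proof -
    have "norm ((sV hat x)\<^sup>2) \<le> norm (M * indicator ?B x)" for x
      using VB[of x] M0 by (simp add: sV_square V_nonneg abs_mult)
    then have "integrable lebesgue (\<lambda>x. (sV hat x)\<^sup>2)"
      by (intro Bochner_Integration.integrable_bound[OF integrable_mult_right[OF B, of M]]) auto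
    then show ?thesis by (simp add: sqint_def)
  qed
  have s: "2 \<le> expo" using alpha n by (simp add: expo)
  obtain C where C: "C < \<infinity>" "\<And>x :: real^'n.
    (\<integral>\<^sup>+z. ennreal (min 1 ((norm (x - z))\<^sup>2) / norm (x - z) powr expo) \<partial>lebesgue) \<le> C"
    using kernel_integral_bounded[OF alpha \<alpha>1 expo s] by blast
  define k where "k p = ennreal (min 1 ((norm (fst p - snd p))\<^sup>2) / norm (fst p - snd p) powr expo)"
    for p :: "(real^'n) \<times> (real^'n)"
  have [measurable]: "k \<in> borel_measurable leb2" unfolding k_def[abs_def] by measurable
  have [measurable]: "?B \<in> sets lebesgue" by simp
  have C1: "(\<integral>\<^sup>+z. k (x, z) \<partial>lebesgue) \<le> C" for x using C(2)[of x] by (simp add: k_def)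
  have C2: "(\<integral>\<^sup>+x. k (x, z) \<partial>lebesgue) \<le> C" for z using C(2)[of z] by (simp add: k_def norm_minus_commute)
  have "(\<integral>\<^sup>+p. ennreal ((dquot expo ?h p)\<^sup>2) \<partial>leb2)
      \<le> (\<integral>\<^sup>+p. indicator ?B (fst p) * k p + indicator ?B (snd p) * k p \<partial>leb2)"
  proof (rule nn_integral_mono)
    fix p :: "(real^'n) \<times> (real^'n)"
    have "(dquot expo ?h p)\<^sup>2 = (hat (fst p) - hat (snd p))\<^sup>2 / norm (fst p - snd p) powr expo"
      using dquot_square[of expo ?h "fst p" "snd p"] by simp
    also have "\<dots> \<le> (indicator ?B (fst p) + indicator ?B (snd p)) * min 1 ((norm (fst p - snd p))\<^sup>2)
         / norm (fst p - snd p) powr expo"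
      by (intro divide_right_mono hat_diff_square_le) simp
    finally have "ennreal ((dquot expo ?h p)\<^sup>2) \<le> ennreal ((indicator ?B (fst p) + indicator ?B (snd p)) *
        (min 1 ((norm (fst p - snd p))\<^sup>2) / norm (fst p - snd p) powr expo))"
      by (intro ennreal_leI) simp
    also have "\<dots> = indicator ?B (fst p) * k p + indicator ?B (snd p) * k p"
      by (auto simp: k_def indicator_def ennreal_plus[symmetric] simp del: ennreal_plus)
    finally show "ennreal ((dquot expo ?h p)\<^sup>2) \<le> indicator ?B (fst p) * k p + indicator ?B (snd p) * k p" .
  qed
  also have "\<dots> = (\<integral>\<^sup>+p. indicator ?B (fst p) * k p \<partial>leb2) + (\<integral>\<^sup>+p. indicator ?B (snd p) * k p \<partial>leb2)"
    by (intro nn_integral_add) measurable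
  also have "(\<integral>\<^sup>+p. indicator ?B (fst p) * k p \<partial>leb2) = (\<integral>\<^sup>+x. indicator ?B x * (\<integral>\<^sup>+z. k (x, z) \<partial>lebesgue) \<partial>lebesgue)"
    by (subst leb.nn_integral_fst[symmetric]) (auto simp: nn_integral_cmult)
  also have "\<dots> \<le> (\<integral>\<^sup>+x. indicator ?B x * C \<partial>lebesgue)"
    by (intro nn_integral_mono mult_left_mono C1) auto
  also have "(\<integral>\<^sup>+p. indicator ?B (snd p) * k p \<partial>leb2) = (\<integral>\<^sup>+z. indicator ?B z * (\<integral>\<^sup>+x. k (x, z) \<partial>lebesgue) \<partial>lebesgue)"
    by (subst leb_pair.nn_integral_snd[symmetric]) (auto simp: nn_integral_cmult)
  also have "\<dots> \<le> (\<integral>\<^sup>+x. indicator ?B x * C \<partial>lebesgue)"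
    by (intro nn_integral_mono mult_left_mono C2) auto
  finally have "(\<integral>\<^sup>+p. ennreal ((dquot expo ?h p)\<^sup>2) \<partial>leb2)
      \<le> (\<integral>\<^sup>+x. indicator ?B x * C \<partial>lebesgue) + (\<integral>\<^sup>+x. indicator ?B x * C \<partial>lebesgue)"
    by (simp add: add_mono)
  also have "(\<integral>\<^sup>+x. indicator ?B x * C \<partial>lebesgue) = emeasure lborel ?B * C"
    by (simp add: nn_integral_multc)
  also have "\<dots> + \<dots> < \<infinity>"
    using C(1) by (simp add: emeasure_cball ennreal_mult_less_top)
  finally have 3: "dquot expo ?h \<in> sqint leb2" by (simp add: sqint_iff_nn)
  show ?thesis using 1 2 3 by (simp add: HV_iff)
qed

end

subsection \<open>The nonlinearity\<close>

lemma primitive_has_derivative: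
  assumes f: "continuous_on UNIV f"
  shows "(primitive f has_real_derivative f t) (at t)"
proof -
  \<comment> \<open>The closed interval has to contain the base point 0 and to have \<open>t\<close>
    in its interior, where the derivative within it is the full derivative.\<close>
  define a b where "a = - \<bar>t\<bar> - 1" and "b = \<bar>t\<bar> + 1"
  have ab: "a \<le> 0" "0 \<le> b" "a < t" "t < b" by (auto simp: a_def b_def)
  have "((\<lambda>u. LBINT y=ereal 0..ereal u. f y) has_vector_derivative f t) (at t within {a..b})"
    using ab continuous_on_subset[OF f] by (intro interval_integral_FTC2) auto
  then have "(primitive f has_vector_derivative f t) (at t within {a..b})"
    by (simp add: primitive_def[abs_def])
  then show ?thesis
    using ab by (simp add: at_within_Icc_at has_real_derivative_iff_has_vector_derivative)
qed

lemma primitive_0: "primitive f 0 = 0"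
  by (simp add: primitive_def)

lemma primitive_mean_value:
  assumes f: "continuous_on UNIV f"
  shows "\<exists>c. min a b \<le> c \<and> c \<le> max a b \<and> primitive f b - primitive f a = (b - a) * f c"
proof -
  have *: "\<exists>c. a \<le> c \<and> c \<le> b \<and> primitive f b - primitive f a = (b - a) * f c" if "a < b" for a b
    using MVT2[OF that, of "primitive f" f] primitive_has_derivative[OF f] by (meson less_imp_le)
  consider "a < b" | "a = b" | "b < a" by linarith
  then show ?thesis
  proof cases
    case 1 then show ?thesis using *[of a b] by (simp add: min_def max_def)
  next
    case 2 then show ?thesis by auto
  next
    case 3
    then obtain c where "b \<le> c" "c \<le> a" "primitive f a - primitive f b = (a - b) * f c"
      using *[of b a] by auto
    then show ?thesis using 3 by (intro exI[of _ c]) (auto simp: algebra_simps)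
  qed
qed

locale subcritical_nonlinearity =
  fixes n :: nat and \<alpha> q :: real and f :: "real \<Rightarrow> real"
  assumes q: "q = (real n + 2 * \<alpha>) / (real n - 2 * \<alpha>)" "1 < q"
    and f_cont: "continuous_on UNIV f" and f0: "f 0 = 0"
    and f_zero: "f \<in> o[at 0](\<lambda>t. \<bar>t\<bar>)"
    and f_inf: "f \<in> o[at_infinity](\<lambda>t. \<bar>t\<bar> powr ((real n + 2 * \<alpha>) / (real n - 2 * \<alpha>)))"
begin

lemma bounded_on_interval:
  obtains M where "0 \<le> M" "\<And>t. \<bar>t\<bar> \<le> R \<Longrightarrow> \<bar>f t\<bar> \<le> M"
proof -
  have "compact (f ` {-R..R})"
    by (intro compact_continuous_image continuous_on_subset[OF f_cont]) auto
  then obtain M where "\<forall>x \<in> f ` {-R..R}. norm x \<le> M"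
    using bounded_iff compact_imp_bounded by blast
  then have "\<bar>f t\<bar> \<le> M" if "\<bar>t\<bar> \<le> R" for t using that by (force simp: abs_le_iff)
  then show ?thesis by (intro that[of "max M 0"]) (auto intro: max.coboundedI1)
qed

lemma growth_thresholds_exist:
  assumes \<eta>: "\<eta> > 0"
  obtains \<delta> \<rho> where "growth_thresholds n \<alpha> f \<eta> \<delta> \<rho>"
proof -
  have "\<forall>\<^sub>F t in at 0. norm (f t) \<le> \<eta> * norm \<bar>t\<bar>"
    using f_zero \<eta> by (rule landau_o.smallD)
  then obtain d where d: "d > 0" "\<And>t. t \<noteq> 0 \<Longrightarrow> \<bar>t\<bar> < d \<Longrightarrow> \<bar>f t\<bar> \<le> \<eta> * \<bar>t\<bar>"
    by (auto simp: eventually_at dist_real_def)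
  have "\<forall>\<^sub>F t in at_infinity. norm (f t) \<le> \<eta> * norm (\<bar>t\<bar> powr q)"
    using f_inf \<eta> unfolding q(1) by (rule landau_o.smallD)
  then obtain b where b: "\<And>t. b \<le> \<bar>t\<bar> \<Longrightarrow> \<bar>f t\<bar> \<le> \<eta> * \<bar>t\<bar> powr q"
    by (auto simp: eventually_at_infinity)
  have "\<bar>f t\<bar> \<le> \<eta> * \<bar>t\<bar>" if "\<bar>t\<bar> \<le> d / 2" for t
    using d(1) d(2)[of t] that f0 by (cases "t = 0") auto
  then have "growth_thresholds n \<alpha> f \<eta> (d / 2) (max d b)"
    using d(1) b unfolding growth_thresholds_def q(1)[symmetric] by auto
  then show ?thesis by (rule that)
qed

text \<open>Below \<delta> and above \<rho> the thresholds apply. \<open>K_const\<close> is made for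
  the range between: there \<open>\<bar>f t\<bar>\<close> is at most its supremum, which is
  \<open>K_const\<close> times \<open>\<delta> powr q\<close>, and \<delta> is at most
  \<open>\<bar>t\<bar>\<close>.\<close>

lemma growth_bound:
  assumes g: "growth_thresholds n \<alpha> f \<eta> \<delta> \<rho>" and \<eta>: "0 < \<eta>"
  shows "0 \<le> K_const n \<alpha> f \<delta> \<rho>"
    and "\<bar>f t\<bar> \<le> \<eta> * \<bar>t\<bar> + (\<eta> + K_const n \<alpha> f \<delta> \<rho>) * \<bar>t\<bar> powr q"
proof -
  have \<delta>: "0 < \<delta>" "\<delta> < \<rho>" and small: "\<And>t. \<bar>t\<bar> \<le> \<delta> \<Longrightarrow> \<bar>f t\<bar> \<le> \<eta> * \<bar>t\<bar>"
    and large: "\<And>t. \<bar>t\<bar> \<ge> \<rho> \<Longrightarrow> \<bar>f t\<bar> \<le> \<eta> * \<bar>t\<bar> powr q"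
    using g unfolding growth_thresholds_def q(1) by auto
  define A where "A = {t. \<delta> \<le> \<bar>t\<bar> \<and> \<bar>t\<bar> \<le> \<rho>}"
  define M where "M = (SUP t\<in>A. \<bar>f t\<bar>)"
  obtain M' where "\<And>t. \<bar>t\<bar> \<le> \<rho> \<Longrightarrow> \<bar>f t\<bar> \<le> M'" using bounded_on_interval[of \<rho>] by blast
  then have bdd: "bdd_above ((\<lambda>t. \<bar>f t\<bar>) ` A)" by (auto simp: A_def intro!: bdd_aboveI2)
  have M: "\<bar>f t\<bar> \<le> M" if "t \<in> A" for t
    unfolding M_def using bdd that by (rule cSUP_upper2) simp
  have "\<delta> \<in> A" using \<delta> by (simp add: A_def)
  from M[OF this] have M0: "0 \<le> M" by linarith
  have K: "K_const n \<alpha> f \<delta> \<rho> = \<delta> powr (- q) * M"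
    by (simp add: K_const_def M_def A_def q(1))
  show K0: "0 \<le> K_const n \<alpha> f \<delta> \<rho>" using M0 by (simp add: K)
  have pos: "0 \<le> \<eta> * \<bar>t\<bar>" "0 \<le> \<eta> * \<bar>t\<bar> powr q" "0 \<le> K_const n \<alpha> f \<delta> \<rho> * \<bar>t\<bar> powr q"
    using \<eta> K0 by auto
  consider "\<bar>t\<bar> \<le> \<delta>" | "\<bar>t\<bar> \<ge> \<rho>" | "t \<in> A" unfolding A_def by fastforce
  then show "\<bar>f t\<bar> \<le> \<eta> * \<bar>t\<bar> + (\<eta> + K_const n \<alpha> f \<delta> \<rho>) * \<bar>t\<bar> powr q"
  proof cases
    case 1 then show ?thesis using small[OF 1] pos by (simp add: distrib_right)
  next
    case 2 then show ?thesis using large[OF 2] pos by (simp add: distrib_right)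
  next
    case 3
    then have "\<delta> powr q \<le> \<bar>t\<bar> powr q" using \<delta> q by (intro powr_mono2) (auto simp: A_def)
    then have "1 \<le> \<delta> powr (- q) * \<bar>t\<bar> powr q" using \<delta> by (simp add: powr_minus field_simps)
    then have "M * 1 \<le> M * (\<delta> powr (- q) * \<bar>t\<bar> powr q)" using M0 by (intro mult_left_mono)
    then have "M \<le> K_const n \<alpha> f \<delta> \<rho> * \<bar>t\<bar> powr q" by (simp add: K mult_ac)
    then show ?thesis using M[OF 3] pos by (simp add: distrib_right)
  qed
qed

text \<open>This modulus of continuity makes the superposition operator continuous from \<open>L\<^sup>2\<close>, on sets
  bounded in the energy space, into the dual of the energy space: the first term is small there
  and the second one is controlled by the \<open>L\<^sup>2\<close> distance.\<close>

lemma modulus_of_continuity: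
  assumes \<eta>: "\<eta> > 0"
  obtains C where "0 \<le> C"
    "\<And>a b. \<bar>f a - f b\<bar> \<le> \<eta> * (\<bar>a\<bar> + \<bar>b\<bar> + \<bar>a\<bar> powr q + \<bar>b\<bar> powr q) + C * \<bar>a - b\<bar>"
proof -
  obtain \<delta> \<rho> where "growth_thresholds n \<alpha> f \<eta> \<delta> \<rho>" using growth_thresholds_exist[OF \<eta>] .
  then have \<delta>: "0 < \<delta>" "\<delta> < \<rho>" and small: "\<And>t. \<bar>t\<bar> \<le> \<delta> \<Longrightarrow> \<bar>f t\<bar> \<le> \<eta> * \<bar>t\<bar>"
    and large: "\<And>t. \<bar>t\<bar> \<ge> \<rho> \<Longrightarrow> \<bar>f t\<bar> \<le> \<eta> * \<bar>t\<bar> powr q"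
    unfolding growth_thresholds_def q(1) by auto
  obtain M where M: "0 \<le> M" "\<And>t. \<bar>t\<bar> \<le> \<rho> + 1 \<Longrightarrow> \<bar>f t\<bar> \<le> M" using bounded_on_interval[of "\<rho> + 1"] by blast
  have "uniformly_continuous_on {-(\<rho> + 1)..\<rho> + 1} f"
    by (intro compact_uniformly_continuous continuous_on_subset[OF f_cont]) auto
  then obtain d0 where d0: "d0 > 0" "\<And>a b. \<bar>a\<bar> \<le> \<rho> + 1 \<Longrightarrow> \<bar>b\<bar> \<le> \<rho> + 1 \<Longrightarrow> \<bar>a - b\<bar> < d0 \<Longrightarrow> \<bar>f a - f b\<bar> < \<eta> * \<delta>"
    unfolding uniformly_continuous_on_def dist_real_def
    using \<eta> \<delta>(1) by (metis abs_le_iff atLeastAtMost_iff minus_le_iff mult_pos_pos)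
  define d where "d = min d0 1"
  have d: "0 < d" "d \<le> d0" "d \<le> 1" using d0(1) by (auto simp: d_def)
  define C where "C = 2 * M / d"
  have C: "0 \<le> C" using M(1) d(1) by (simp add: C_def)
  have fM: "\<bar>f t\<bar> \<le> \<eta> * \<bar>t\<bar> powr q + M" for t
  proof (cases "\<bar>t\<bar> \<le> \<rho> + 1")
    case True
    have "0 \<le> \<eta> * \<bar>t\<bar> powr q" using \<eta> by simp
    then show ?thesis using M(2)[OF True] by linarith
  next
    case False then show ?thesis using large[of t] M(1) by linarith
  qed
  have "\<bar>f a - f b\<bar> \<le> \<eta> * (\<bar>a\<bar> + \<bar>b\<bar> + \<bar>a\<bar> powr q + \<bar>b\<bar> powr q) + C * \<bar>a - b\<bar>" for a b
  proof -
    have nn: "0 \<le> \<eta> * \<bar>a\<bar>" "0 \<le> \<eta> * \<bar>b\<bar>" "0 \<le> \<eta> * \<bar>a\<bar> powr q" "0 \<le> \<eta> * \<bar>b\<bar> powr q" "0 \<le> C * \<bar>a - b\<bar>"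
      using \<eta> C by auto
    have split: "\<eta> * (\<bar>a\<bar> + \<bar>b\<bar> + \<bar>a\<bar> powr q + \<bar>b\<bar> powr q)
        = \<eta> * \<bar>a\<bar> + \<eta> * \<bar>b\<bar> + \<eta> * \<bar>a\<bar> powr q + \<eta> * \<bar>b\<bar> powr q"
      by (simp add: distrib_left)
    \<comment> \<open>If the arguments are at least \<open>d\<close> apart, the constant
      \<open>2 * M\<close> is absorbed by \<open>C * \<bar>a - b\<bar>\<close>. Closer arguments
      differ by less than 1, so they both lie within \<open>\<rho> + 1\<close> or both beyond
      \<rho>; in the former range either both are below \<delta>, or one is at least \<delta> and
      the tolerance \<open>\<eta> * \<delta>\<close> of uniform continuity is absorbed by
      \<open>\<eta> * (\<bar>a\<bar> + \<bar>b\<bar>)\<close>.\<close>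
    consider "d \<le> \<bar>a - b\<bar>" | "\<bar>a - b\<bar> < d" "\<bar>a\<bar> \<le> \<rho> + 1" "\<bar>b\<bar> \<le> \<rho> + 1" "\<delta> \<le> \<bar>a\<bar> \<or> \<delta> \<le> \<bar>b\<bar>"
      | "\<bar>a\<bar> \<le> \<delta>" "\<bar>b\<bar> \<le> \<delta>" | "\<rho> \<le> \<bar>a\<bar>" "\<rho> \<le> \<bar>b\<bar>"
      using d(3) by argo
    then show ?thesis
    proof cases
      case 1
      have "2 * M * d \<le> 2 * M * \<bar>a - b\<bar>" using 1 M(1) by (intro mult_left_mono) auto
      then have "2 * M \<le> C * \<bar>a - b\<bar>" using d(1) by (simp add: C_def field_simps)
      then show ?thesis using fM[of a] fM[of b] nn abs_triangle_ineq4[of "f a" "f b"] unfolding split by linarith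
    next
      case 2
      have "\<eta> * \<delta> \<le> \<eta> * \<bar>a\<bar> + \<eta> * \<bar>b\<bar>"
        using 2(4)
      proof
        assume "\<delta> \<le> \<bar>a\<bar>"
        then show ?thesis using mult_left_mono[of \<delta> "\<bar>a\<bar>" \<eta>] \<eta> nn by linarith
      next
        assume "\<delta> \<le> \<bar>b\<bar>"
        then show ?thesis using mult_left_mono[of \<delta> "\<bar>b\<bar>" \<eta>] \<eta> nn by linarith
      qed
      moreover have "\<bar>f a - f b\<bar> < \<eta> * \<delta>" using d0(2)[of a b] 2 d(2) by linarith
      ultimately show ?thesis using nn unfolding split by linarith
    next
      case 3
      then show ?thesis using small[of a] small[of b] nn abs_triangle_ineq4[of "f a" "f b"] unfolding split by linarith
    next
      case 4
      then show ?thesis using large[of a] large[of b] nn abs_triangle_ineq4[of "f a" "f b"] unfolding split by linarith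
    qed
  qed
  with C show ?thesis using that by blast
qed

text \<open>The mean value theorem reduces the claim to the modulus of continuity between
  \<open>a\<close> and an intermediate point. The terms are grouped so that, integrated, they become
  \<open>pairing u w\<close> and \<open>pairing (u + w) w\<close>.\<close>

lemma primitive_expansion:
  assumes "0 \<le> C" and \<eta>: "0 < \<eta>" and
    mod: "\<And>a b. \<bar>f a - f b\<bar> \<le> \<eta> * (\<bar>a\<bar> + \<bar>b\<bar> + \<bar>a\<bar> powr q + \<bar>b\<bar> powr q) + C * \<bar>a - b\<bar>"
  shows "\<bar>primitive f (a + b) - primitive f a - f a * b\<bar>
    \<le> 2 * \<eta> * ((\<bar>a\<bar> + \<bar>a\<bar> powr q) * \<bar>b\<bar> + (\<bar>a + b\<bar> + \<bar>a + b\<bar> powr q) * \<bar>b\<bar>) + C * b\<^sup>2"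
proof -
  obtain c where c: "min a (a + b) \<le> c" "c \<le> max a (a + b)"
    and F: "primitive f (a + b) - primitive f a = b * f c"
    using primitive_mean_value[OF f_cont, of a "a + b"] by auto
  have ca: "\<bar>c - a\<bar> \<le> \<bar>b\<bar>" and cm: "\<bar>c\<bar> \<le> max \<bar>a\<bar> \<bar>a + b\<bar>" using c by auto
  then have "\<bar>c\<bar> powr q \<le> max \<bar>a\<bar> \<bar>a + b\<bar> powr q" using q by (intro powr_mono2) auto
  also have "\<dots> \<le> \<bar>a\<bar> powr q + \<bar>a + b\<bar> powr q" by (auto simp: max_def)
  finally have cq: "\<bar>c\<bar> powr q \<le> \<bar>a\<bar> powr q + \<bar>a + b\<bar> powr q" .
  have c1: "\<bar>c\<bar> \<le> \<bar>a\<bar> + \<bar>a + b\<bar>" using cm by (auto simp: max_def split: if_splits)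
  have nn: "0 \<le> \<bar>a + b\<bar> powr q" "0 \<le> \<bar>a + b\<bar>" by auto
  have "\<bar>c\<bar> + \<bar>a\<bar> + \<bar>c\<bar> powr q + \<bar>a\<bar> powr q
      \<le> 2 * (\<bar>a\<bar> + \<bar>a\<bar> powr q + (\<bar>a + b\<bar> + \<bar>a + b\<bar> powr q))"
    unfolding distrib_left using cq c1 nn by linarith
  then have "\<eta> * (\<bar>c\<bar> + \<bar>a\<bar> + \<bar>c\<bar> powr q + \<bar>a\<bar> powr q) + C * \<bar>c - a\<bar>
     \<le> \<eta> * (2 * (\<bar>a\<bar> + \<bar>a\<bar> powr q + (\<bar>a + b\<bar> + \<bar>a + b\<bar> powr q))) + C * \<bar>b\<bar>"
    using \<eta> assms(1) ca by (intro add_mono mult_left_mono) auto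
  with mod[of c a] have "\<bar>f c - f a\<bar> \<le> \<eta> * (2 * (\<bar>a\<bar> + \<bar>a\<bar> powr q + (\<bar>a + b\<bar> + \<bar>a + b\<bar> powr q))) + C * \<bar>b\<bar>"
    by linarith
  then have "\<bar>b\<bar> * \<bar>f c - f a\<bar> \<le> \<bar>b\<bar> * (\<eta> * (2 * (\<bar>a\<bar> + \<bar>a\<bar> powr q + (\<bar>a + b\<bar> + \<bar>a + b\<bar> powr q))) + C * \<bar>b\<bar>)"
    by (intro mult_left_mono) auto
  also have "\<dots> = 2 * \<eta> * ((\<bar>a\<bar> + \<bar>a\<bar> powr q) * \<bar>b\<bar> + (\<bar>a + b\<bar> + \<bar>a + b\<bar> powr q) * \<bar>b\<bar>) + C * (\<bar>b\<bar> * \<bar>b\<bar>)"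
    by (simp add: algebra_simps)
  also have "\<bar>b\<bar> * \<bar>b\<bar> = b\<^sup>2" by (simp add: power2_eq_square)
  also have "\<bar>b\<bar> * \<bar>f c - f a\<bar> = \<bar>primitive f (a + b) - primitive f a - f a * b\<bar>"
    unfolding F by (simp add: abs_mult[symmetric] algebra_simps)
  finally show ?thesis .
qed

text \<open>The mean value theorem is used instead of integrating the growth bound. Its coarser
  coefficients \<eta> and \<open>\<eta> + K_const n \<alpha> f \<delta> \<rho>\<close> are those of
  the smallness condition on \<open>h\<close>.\<close>

lemma primitive_bound:
  assumes g: "growth_thresholds n \<alpha> f \<eta> \<delta> \<rho>" and \<eta>: "0 < \<eta>"
  shows "\<bar>primitive f t\<bar> \<le> \<eta> * t\<^sup>2 + (\<eta> + K_const n \<alpha> f \<delta> \<rho>) * \<bar>t\<bar> powr (q + 1)"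
proof -
  obtain c where c: "min 0 t \<le> c" "c \<le> max 0 t" and F: "primitive f t = t * f c"
    using primitive_mean_value[OF f_cont, of 0 t] by (auto simp: primitive_0)
  have ct: "\<bar>c\<bar> \<le> \<bar>t\<bar>" using c by (auto simp: min_def max_def split: if_splits)
  note K = growth_bound[OF g \<eta>]
  have "\<bar>f c\<bar> \<le> \<eta> * \<bar>c\<bar> + (\<eta> + K_const n \<alpha> f \<delta> \<rho>) * \<bar>c\<bar> powr q" by (rule K)
  also have "\<dots> \<le> \<eta> * \<bar>t\<bar> + (\<eta> + K_const n \<alpha> f \<delta> \<rho>) * \<bar>t\<bar> powr q"
    using ct \<eta> K(1) q by (intro add_mono mult_left_mono powr_mono2) auto
  finally have "\<bar>t\<bar> * \<bar>f c\<bar> \<le> \<bar>t\<bar> * (\<eta> * \<bar>t\<bar> + (\<eta> + K_const n \<alpha> f \<delta> \<rho>) * \<bar>t\<bar> powr q)"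
    by (intro mult_left_mono) auto
  also have "\<dots> = \<eta> * (\<bar>t\<bar> * \<bar>t\<bar>) + (\<eta> + K_const n \<alpha> f \<delta> \<rho>) * (\<bar>t\<bar> powr q * \<bar>t\<bar>)"
    by (simp add: algebra_simps)
  also have "\<bar>t\<bar> powr q * \<bar>t\<bar> = \<bar>t\<bar> powr (q + 1)"
    by (cases "t = 0") (auto simp: powr_add)
  also have "\<bar>t\<bar> * \<bar>t\<bar> = t\<^sup>2" by (simp add: power2_eq_square)
  finally show ?thesis by (simp add: F abs_mult)
qed

text \<open>The Ambrosetti-Rabinowitz inequality says that
  \<open>primitive f t * t powr (- \<mu>)\<close> has nonnegative derivative for
  \<open>t \<ge> 1\<close>. As \<mu> exceeds 2, the resulting growth beats the quadratic part of the
  energy.\<close>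

lemma primitive_superlinear:
  assumes \<mu>: "2 < \<mu>" and AR: "\<And>t. t \<noteq> 0 \<Longrightarrow> 0 < \<mu> * primitive f t \<and> \<mu> * primitive f t \<le> t * f t"
  shows "0 \<le> primitive f t" and "1 \<le> t \<Longrightarrow> primitive f 1 * t powr \<mu> \<le> primitive f t" and "0 < primitive f 1"
proof -
  have pos: "0 < primitive f t" if "t \<noteq> 0" for t
    using AR[OF that] \<mu> by (simp add: zero_less_mult_iff)
  show "0 \<le> primitive f t" using pos[of t] by (cases "t = 0") (auto simp: primitive_0)
  show "0 < primitive f 1" using pos[of 1] by simp
  assume t: "1 \<le> t"
  have "primitive f 1 * 1 powr (- \<mu>) \<le> primitive f t * t powr (- \<mu>)"
  proof (rule DERIV_nonneg_imp_nondecreasing[OF t])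
    fix x :: real assume x: "1 \<le> x" "x \<le> t"
    have "((\<lambda>x. primitive f x * x powr (- \<mu>)) has_real_derivative
        f x * x powr (- \<mu>) + primitive f x * (- \<mu> * x powr (- \<mu> - 1))) (at x)"
      using x by (auto intro!: derivative_eq_intros primitive_has_derivative f_cont)
    moreover have "0 \<le> f x * x powr (- \<mu>) + primitive f x * (- \<mu> * x powr (- \<mu> - 1))"
    proof -
      have "f x * x powr (- \<mu>) + primitive f x * (- \<mu> * x powr (- \<mu> - 1))
          = (x * f x - \<mu> * primitive f x) * x powr (- \<mu> - 1)"
        using x by (simp add: powr_diff field_simps)
      moreover have "0 \<le> (x * f x - \<mu> * primitive f x) * x powr (- \<mu> - 1)"
        using AR[of x] x by (intro mult_nonneg_nonneg) auto
      ultimately show ?thesis by simp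
    qed
    ultimately show "\<exists>y. ((\<lambda>x. primitive f x * x powr (- \<mu>)) has_real_derivative y) (at x) \<and> 0 \<le> y"
      by blast
  qed
  then show "primitive f 1 * t powr \<mu> \<le> primitive f t"
    using t by (simp add: powr_minus field_simps)
qed

lemma f_measurable [measurable]: "f \<in> borel_measurable borel"
  using f_cont by (rule borel_measurable_continuous_onI)

lemma primitive_measurable [measurable]: "primitive f \<in> borel_measurable borel"
  by (intro borel_measurable_continuous_onI continuous_at_imp_continuous_on ballI
      DERIV_isCont[OF primitive_has_derivative[OF f_cont]])

end

subsection \<open>The energy functional\<close>

locale schroedinger_problem =
  coercive_potential \<alpha> V V0 expo + subcritical_nonlinearity "CARD('n)" \<alpha> q f
  for \<alpha> :: real and V :: "real^'n \<Rightarrow> real" and V0 expo q :: real and f :: "real \<Rightarrow> real" +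
  fixes h :: "real^'n \<Rightarrow> real" and C \<mu> :: real
  assumes alpha_less_1: "\<alpha> < 1" and card: "2 \<le> CARD('n)"
    and V_lim: "filterlim V at_top at_infinity"
    and embedding: "embedding_constant \<alpha> V C"
    and h: "h \<in> sqint lebesgue"
    and \<mu>: "2 < \<mu>"
    and AR: "\<And>t. t \<noteq> 0 \<Longrightarrow> 0 < \<mu> * primitive f t \<and> \<mu> * primitive f t \<le> t * f t"
begin

abbreviation "p \<equiv> q + 1"
abbreviation "F \<equiv> primitive f"
abbreviation "hn \<equiv> Lp_norm 2 h"

lemma C_pos: "0 < C" using embedding by (simp add: embedding_constant_def)

lemma hn_nonneg: "0 \<le> hn" by (simp add: Lp_norm_def)

lemma crit: "crit_exponent CARD('n) \<alpha> = p"
proof -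
  have "real CARD('n) - 2 * \<alpha> > 0" using card alpha_less_1 by linarith
  then show ?thesis by (simp add: crit_exponent_def q(1) field_simps)
qed

section \<open>Estimates of the lower-order terms by the energy norm\<close>

lemma L2_bound:
  assumes "u \<in> H"
  shows "sqrt (\<integral>x. (u x)\<^sup>2 \<partial>lebesgue) \<le> C * N u" and "(\<integral>x. (u x)\<^sup>2 \<partial>lebesgue) \<le> (C * N u)\<^sup>2"
proof -
  show *: "sqrt (\<integral>x. (u x)\<^sup>2 \<partial>lebesgue) \<le> C * N u"
    using embedding assms by (simp add: embedding_constant_def Lp_norm_2 N_eq)
  have "(sqrt (\<integral>x. (u x)\<^sup>2 \<partial>lebesgue))\<^sup>2 \<le> (C * N u)\<^sup>2"
    by (rule power_mono[OF *]) (simp add: integral_nonneg_AE)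
  then show "(\<integral>x. (u x)\<^sup>2 \<partial>lebesgue) \<le> (C * N u)\<^sup>2"
    by (simp add: integral_nonneg_AE)
qed

lemma Lp_bound:
  assumes "u \<in> H"
  shows "integrable lebesgue (\<lambda>x. \<bar>u x\<bar> powr p)" and "(\<integral>x. \<bar>u x\<bar> powr p \<partial>lebesgue) \<le> (C * N u) powr p"
proof -
  have *: "memLp p u" "Lp_norm p u \<le> C * N u"
    using embedding assms unfolding embedding_constant_def crit N_eq by blast+
  show "integrable lebesgue (\<lambda>x. \<bar>u x\<bar> powr p)" using *(1) by (simp add: memLp_def)
  have "((\<integral>x. \<bar>u x\<bar> powr p \<partial>lebesgue) powr (1 / p)) powr p \<le> (C * N u) powr p"
    using *(2) q(2) unfolding Lp_norm_def by (intro powr_mono2) auto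
  then show "(\<integral>x. \<bar>u x\<bar> powr p \<partial>lebesgue) \<le> (C * N u) powr p"
    using q(2) by (simp add: powr_powr integral_nonneg_AE)
qed

lemma h_pairing_bound:
  assumes "u \<in> H"
  shows "\<bar>\<integral>x. h x * u x \<partial>lebesgue\<bar> \<le> hn * C * N u"
proof -
  have "\<bar>\<integral>x. h x * u x \<partial>lebesgue\<bar> \<le> hn * sqrt (\<integral>x. (u x)\<^sup>2 \<partial>lebesgue)"
    unfolding Lp_norm_2 by (intro Cauchy_Schwarz_integral h HV_D assms)
  also have "\<dots> \<le> hn * (C * N u)"
    by (intro mult_left_mono L2_bound assms hn_nonneg)
  finally show ?thesis by simp
qed

text \<open>A common majorant for the integrals involving \<open>f\<close>, which grows at most like
  \<open>\<bar>t\<bar> + \<bar>t\<bar> powr q\<close>. It is not linear in \<open>w\<close>, but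
  absolutely homogeneous.\<close>

definition pairing :: "(real^'n \<Rightarrow> real) \<Rightarrow> (real^'n \<Rightarrow> real) \<Rightarrow> real" where
  "pairing u w = (\<integral>x. (\<bar>u x\<bar> + \<bar>u x\<bar> powr q) * \<bar>w x\<bar> \<partial>lebesgue)"

text \<open>Takes the place of the Hoelder inequality: a product of
  \<open>\<bar>a\<bar> powr q\<close> and \<open>\<bar>b\<bar>\<close> is at most the power
  \<open>p\<close> of the larger of \<open>\<bar>a\<bar>\<close> and
  \<open>\<bar>b\<bar>\<close>.\<close>

lemma pairing_pointwise: "(\<bar>a\<bar> + \<bar>a\<bar> powr q) * \<bar>b\<bar> \<le> a\<^sup>2 + b\<^sup>2 + (\<bar>a\<bar> powr p + \<bar>b\<bar> powr p)" for a b :: real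
proof -
  have pw: "\<bar>c\<bar> powr q * \<bar>c\<bar> = \<bar>c\<bar> powr p" for c :: real
    by (cases "c = 0") (auto simp: powr_add)
  have "\<bar>a\<bar> powr q * \<bar>b\<bar> \<le> \<bar>a\<bar> powr p + \<bar>b\<bar> powr p"
  proof (cases "\<bar>a\<bar> \<le> \<bar>b\<bar>")
    case True
    have "\<bar>a\<bar> powr q * \<bar>b\<bar> \<le> \<bar>b\<bar> powr q * \<bar>b\<bar>"
      using True q(2) by (intro mult_right_mono powr_mono2) auto
    then show ?thesis unfolding pw using powr_ge_zero[of "\<bar>a\<bar>" p] by linarith
  next
    case False
    then have "\<bar>a\<bar> powr q * \<bar>b\<bar> \<le> \<bar>a\<bar> powr q * \<bar>a\<bar>"
      by (intro mult_left_mono) auto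
    then show ?thesis unfolding pw using powr_ge_zero[of "\<bar>b\<bar>" p] by linarith
  qed
  moreover have "\<bar>a\<bar> * \<bar>b\<bar> \<le> a\<^sup>2 + b\<^sup>2"
  proof -
    have "2 * \<bar>a\<bar> * \<bar>b\<bar> \<le> a\<^sup>2 + b\<^sup>2" using sum_squares_bound[of "\<bar>a\<bar>" "\<bar>b\<bar>"] by simp
    moreover have "0 \<le> \<bar>a\<bar> * \<bar>b\<bar>" by simp
    ultimately show ?thesis by linarith
  qed
  ultimately show ?thesis unfolding distrib_right by linarith
qed

lemma pairing_integrable:
  assumes u: "u \<in> H" and w: "w \<in> H"
  shows "integrable lebesgue (\<lambda>x. (\<bar>u x\<bar> + \<bar>u x\<bar> powr q) * \<bar>w x\<bar>)"
proof (rule Bochner_Integration.integrable_bound)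
  show "integrable lebesgue (\<lambda>x. (u x)\<^sup>2 + (w x)\<^sup>2 + (\<bar>u x\<bar> powr p + \<bar>w x\<bar> powr p))"
    using u w by (intro Bochner_Integration.integrable_add sqint_square HV_D Lp_bound)
  have [measurable]: "u \<in> borel_measurable lebesgue" "w \<in> borel_measurable lebesgue" using u w by measurable
  show "(\<lambda>x. (\<bar>u x\<bar> + \<bar>u x\<bar> powr q) * \<bar>w x\<bar>) \<in> borel_measurable lebesgue" by measurable
  have "norm ((\<bar>a\<bar> + \<bar>a\<bar> powr q) * \<bar>b\<bar>) \<le> norm (a\<^sup>2 + b\<^sup>2 + (\<bar>a\<bar> powr p + \<bar>b\<bar> powr p))" for a b :: real
    using pairing_pointwise[of a b] by (simp add: abs_mult)
  then show "AE x in lebesgue. norm ((\<bar>u x\<bar> + \<bar>u x\<bar> powr q) * \<bar>w x\<bar>)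
      \<le> norm ((u x)\<^sup>2 + (w x)\<^sup>2 + (\<bar>u x\<bar> powr p + \<bar>w x\<bar> powr p))" by blast
qed

lemma pairing_nonneg: "0 \<le> pairing u w"
  unfolding pairing_def by (intro integral_nonneg_AE) auto

definition pairing_const :: "real \<Rightarrow> real" where
  "pairing_const R = (C * R)\<^sup>2 + C\<^sup>2 + ((C * R) powr p + C powr p)"

lemma pairing_const_nonneg: "0 \<le> pairing_const R"
  by (simp add: pairing_const_def add_nonneg_nonneg)

text \<open>The pointwise bound is not homogeneous in \<open>w\<close>; it is integrated for
  \<open>N w \<le> 1\<close>, where it gives \<open>pairing_const R\<close>, and the factor
  \<open>N w\<close> comes from scaling.\<close>

lemma pairing_le:
  assumes u: "u \<in> H" "N u \<le> R" and w: "w \<in> H"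
  shows "pairing u w \<le> pairing_const R * N w"
proof -
  have "\<bar>pairing u w\<bar> \<le> pairing_const R * N w"
  proof (rule HVspace.bounded_functional_homogeneous[OF _ _ w])
    show "\<bar>pairing u (c *\<^sub>R v)\<bar> = \<bar>c\<bar> * \<bar>pairing u v\<bar>" for c v
    proof -
      have "pairing u (c *\<^sub>R v) = (\<integral>x. \<bar>c\<bar> * ((\<bar>u x\<bar> + \<bar>u x\<bar> powr q) * \<bar>v x\<bar>) \<partial>lebesgue)"
        by (simp add: pairing_def abs_mult mult_ac)
      also have "\<dots> = \<bar>c\<bar> * pairing u v" by (simp add: pairing_def)
      finally show ?thesis by (simp add: abs_mult)
    qed
    fix v assume v: "v \<in> H" "N v \<le> 1"
    have nn: "0 \<le> N u" "0 \<le> N v" using u v HVspace.N_nonneg by auto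
    have "pairing u v \<le> (\<integral>x. (u x)\<^sup>2 + (v x)\<^sup>2 + (\<bar>u x\<bar> powr p + \<bar>v x\<bar> powr p) \<partial>lebesgue)"
      unfolding pairing_def using u v
      by (intro integral_mono pairing_integrable pairing_pointwise Bochner_Integration.integrable_add
          sqint_square HV_D Lp_bound)
    also have "\<dots> = (\<integral>x. (u x)\<^sup>2 \<partial>lebesgue) + (\<integral>x. (v x)\<^sup>2 \<partial>lebesgue)
        + ((\<integral>x. \<bar>u x\<bar> powr p \<partial>lebesgue) + (\<integral>x. \<bar>v x\<bar> powr p \<partial>lebesgue))"
      using u v by (simp add: sqint_square HV_D Lp_bound)
    also have "\<dots> \<le> (C * N u)\<^sup>2 + (C * N v)\<^sup>2 + ((C * N u) powr p + (C * N v) powr p)"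
      using u v by (intro add_mono L2_bound Lp_bound)
    also have "\<dots> \<le> (C * R)\<^sup>2 + (C * 1)\<^sup>2 + ((C * R) powr p + (C * 1) powr p)"
      using u v nn C_pos q(2) by (intro add_mono power_mono powr_mono2 mult_left_mono) auto
    finally show "\<bar>pairing u v\<bar> \<le> pairing_const R"
      using pairing_nonneg[of u v] by (simp add: pairing_const_def)
  qed
  then show ?thesis by simp
qed

lemma f_linear_growth: obtains c where "0 \<le> c" "\<And>t. \<bar>f t\<bar> \<le> c * (\<bar>t\<bar> + \<bar>t\<bar> powr q)"
proof -
  obtain \<delta> \<rho> where g: "growth_thresholds CARD('n) \<alpha> f 1 \<delta> \<rho>"
    using growth_thresholds_exist[of 1] by auto
  define K where "K = K_const CARD('n) \<alpha> f \<delta> \<rho>"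
  have K: "0 \<le> K" "\<And>t. \<bar>f t\<bar> \<le> \<bar>t\<bar> + (1 + K) * \<bar>t\<bar> powr q"
    using growth_bound[OF g] by (simp_all add: K_def)
  have "\<bar>f t\<bar> \<le> (1 + K) * (\<bar>t\<bar> + \<bar>t\<bar> powr q)" for t
  proof -
    have "0 \<le> K * \<bar>t\<bar>" using K(1) by simp
    then show ?thesis using K(2)[of t] by (simp add: algebra_simps)
  qed
  then show ?thesis using that[of "1 + K"] K(1) by simp
qed

lemma f_integrable:
  assumes u: "u \<in> H" and w: "w \<in> H"
  shows "integrable lebesgue (\<lambda>x. f (u x) * w x)"
proof -
  obtain c where c: "0 \<le> c" "\<And>t. \<bar>f t\<bar> \<le> c * (\<bar>t\<bar> + \<bar>t\<bar> powr q)" using f_linear_growth by blast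
  have [measurable]: "u \<in> borel_measurable lebesgue" "w \<in> borel_measurable lebesgue" using u w by measurable
  have b: "norm (f (u x) * w x) \<le> norm (c * ((\<bar>u x\<bar> + \<bar>u x\<bar> powr q) * \<bar>w x\<bar>))" for x
  proof -
    have "\<bar>f (u x)\<bar> * \<bar>w x\<bar> \<le> c * (\<bar>u x\<bar> + \<bar>u x\<bar> powr q) * \<bar>w x\<bar>"
      by (intro mult_right_mono c) simp
    then show ?thesis using c(1) by (simp add: abs_mult mult.assoc)
  qed
  show ?thesis
    by (rule Bochner_Integration.integrable_bound[OF integrable_mult_right[OF pairing_integrable[OF u w], of c] _ AE_I2[OF b]])
       measurable
qed

lemma h_integrable: "w \<in> H \<Longrightarrow> integrable lebesgue (\<lambda>x. h x * w x)"
  by (intro sqint_mult h HV_D)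

lemma F_integrable:
  assumes u: "u \<in> H"
  shows "integrable lebesgue (\<lambda>x. F (u x))"
proof -
  obtain \<delta> \<rho> where g: "growth_thresholds CARD('n) \<alpha> f 1 \<delta> \<rho>"
    using growth_thresholds_exist[of 1] by auto
  define K where "K = K_const CARD('n) \<alpha> f \<delta> \<rho>"
  have [measurable]: "u \<in> borel_measurable lebesgue" using u by measurable
  have i: "integrable lebesgue (\<lambda>x. (u x)\<^sup>2 + (1 + K) * \<bar>u x\<bar> powr p)"
    using u by (intro Bochner_Integration.integrable_add integrable_mult_right sqint_square HV_D Lp_bound)
  have b: "norm (F (u x)) \<le> norm ((u x)\<^sup>2 + (1 + K) * \<bar>u x\<bar> powr p)" for x
    using primitive_bound[OF g, of "u x"] abs_ge_self[of "(u x)\<^sup>2 + (1 + K) * \<bar>u x\<bar> powr p"]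
    by (simp add: K_def)
  show ?thesis
    by (rule Bochner_Integration.integrable_bound[OF i _ AE_I2[OF b]]) measurable
qed

section \<open>The right-hand side as a functional and its Riesz representative\<close>

definition load :: "(real^'n \<Rightarrow> real) \<Rightarrow> (real^'n \<Rightarrow> real) \<Rightarrow> real" where
  "load u w = (\<integral>x. (f (u x) + h x) * w x \<partial>lebesgue)"

lemma load_integrable:
  assumes "u \<in> H" "w \<in> H"
  shows "integrable lebesgue (\<lambda>x. (f (u x) + h x) * w x)"
  unfolding distrib_right using assms by (intro Bochner_Integration.integrable_add f_integrable h_integrable)

lemma load_eq:
  assumes "u \<in> H" "w \<in> H"
  shows "load u w = (\<integral>x. f (u x) * w x \<partial>lebesgue) + (\<integral>x. h x * w x \<partial>lebesgue)"
  unfolding load_def distrib_right using assms by (simp add: f_integrable h_integrable)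

lemma load_add: "u \<in> H \<Longrightarrow> v \<in> H \<Longrightarrow> w \<in> H \<Longrightarrow> load u (v + w) = load u v + load u w"
  using load_integrable[of u v] load_integrable[of u w] by (simp add: load_def distrib_left)

lemma load_scale: "load u (c *\<^sub>R v) = c * load u v"
proof -
  have "load u (c *\<^sub>R v) = (\<integral>x. c * ((f (u x) + h x) * v x) \<partial>lebesgue)"
    by (simp add: load_def mult_ac)
  then show ?thesis by (simp add: load_def)
qed

lemma load_diff_le:
  assumes u: "u \<in> H" "N u \<le> R" and v: "v \<in> H" "N v \<le> R" and w: "w \<in> H"
    and \<eta>: "0 \<le> \<eta>" and c: "0 \<le> c"
    and mod: "\<And>a b. \<bar>f a - f b\<bar> \<le> \<eta> * (\<bar>a\<bar> + \<bar>b\<bar> + \<bar>a\<bar> powr q + \<bar>b\<bar> powr q) + c * \<bar>a - b\<bar>"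
  shows "\<bar>load u w - load v w\<bar>
    \<le> (2 * \<eta> * pairing_const R + c * C * sqrt (\<integral>x. (u x - v x)\<^sup>2 \<partial>lebesgue)) * N w"
proof -
  have uv: "u - v \<in> H" using u v by (intro HVspace.S_intros)
  have abs_sq: "(\<lambda>x. \<bar>y x\<bar>) \<in> sqint lebesgue" if "y \<in> H" for y
    using HV_D(1)[OF that] by (auto simp: sqint_def)
  have i: "integrable lebesgue (\<lambda>x. \<bar>u x - v x\<bar> * \<bar>w x\<bar>)"
    using sqint_mult[OF abs_sq[OF uv] abs_sq[OF w]] by simp
  have "\<bar>load u w - load v w\<bar> = \<bar>\<integral>x. (f (u x) - f (v x)) * w x \<partial>lebesgue\<bar>"
    using u v w by (simp add: load_eq left_diff_distrib f_integrable)
  also have "\<dots> \<le> (\<integral>x. \<bar>(f (u x) - f (v x)) * w x\<bar> \<partial>lebesgue)"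
    using integral_norm_bound[of lebesgue "\<lambda>x. (f (u x) - f (v x)) * w x"] by simp
  also have "\<dots> \<le> (\<integral>x. \<eta> * ((\<bar>u x\<bar> + \<bar>u x\<bar> powr q) * \<bar>w x\<bar> + (\<bar>v x\<bar> + \<bar>v x\<bar> powr q) * \<bar>w x\<bar>)
      + c * (\<bar>u x - v x\<bar> * \<bar>w x\<bar>) \<partial>lebesgue)"
  proof (rule integral_mono)
    show "integrable lebesgue (\<lambda>x. \<bar>(f (u x) - f (v x)) * w x\<bar>)"
      unfolding left_diff_distrib using u v w
      by (intro integrable_abs Bochner_Integration.integrable_diff f_integrable)
    show "integrable lebesgue (\<lambda>x. \<eta> * ((\<bar>u x\<bar> + \<bar>u x\<bar> powr q) * \<bar>w x\<bar> + (\<bar>v x\<bar> + \<bar>v x\<bar> powr q) * \<bar>w x\<bar>)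
      + c * (\<bar>u x - v x\<bar> * \<bar>w x\<bar>))"
      using u v w i by (intro Bochner_Integration.integrable_add integrable_mult_right pairing_integrable)
    fix x
    have "\<bar>f (u x) - f (v x)\<bar> * \<bar>w x\<bar>
      \<le> (\<eta> * (\<bar>u x\<bar> + \<bar>v x\<bar> + \<bar>u x\<bar> powr q + \<bar>v x\<bar> powr q) + c * \<bar>u x - v x\<bar>) * \<bar>w x\<bar>"
      by (intro mult_right_mono mod) simp
    also have "\<dots> = \<eta> * ((\<bar>u x\<bar> + \<bar>u x\<bar> powr q) * \<bar>w x\<bar> + (\<bar>v x\<bar> + \<bar>v x\<bar> powr q) * \<bar>w x\<bar>)
        + c * (\<bar>u x - v x\<bar> * \<bar>w x\<bar>)"
      by (simp add: algebra_simps)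
    finally show "\<bar>(f (u x) - f (v x)) * w x\<bar>
      \<le> \<eta> * ((\<bar>u x\<bar> + \<bar>u x\<bar> powr q) * \<bar>w x\<bar> + (\<bar>v x\<bar> + \<bar>v x\<bar> powr q) * \<bar>w x\<bar>) + c * (\<bar>u x - v x\<bar> * \<bar>w x\<bar>)"
      unfolding abs_mult .
  qed
  also have "\<dots> = \<eta> * (pairing u w + pairing v w) + c * (\<integral>x. \<bar>u x - v x\<bar> * \<bar>w x\<bar> \<partial>lebesgue)"
    unfolding pairing_def using i pairing_integrable[OF u(1) w] pairing_integrable[OF v(1) w] by simp
  also have "\<dots> \<le> \<eta> * (pairing_const R * N w + pairing_const R * N w)
      + c * (sqrt (\<integral>x. (u x - v x)\<^sup>2 \<partial>lebesgue) * (C * N w))"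
  proof (intro add_mono mult_left_mono pairing_le u v w \<eta> c)
    have "(\<integral>x. \<bar>u x - v x\<bar> * \<bar>w x\<bar> \<partial>lebesgue)
        \<le> sqrt (\<integral>x. (u x - v x)\<^sup>2 \<partial>lebesgue) * sqrt (\<integral>x. (w x)\<^sup>2 \<partial>lebesgue)"
      using Cauchy_Schwarz_integral[OF abs_sq[OF uv] abs_sq[OF w]] by simp
    also have "\<dots> \<le> sqrt (\<integral>x. (u x - v x)\<^sup>2 \<partial>lebesgue) * (C * N w)"
      by (intro mult_left_mono L2_bound w) (simp add: integral_nonneg_AE)
    finally show "(\<integral>x. \<bar>u x - v x\<bar> * \<bar>w x\<bar> \<partial>lebesgue)
      \<le> sqrt (\<integral>x. (u x - v x)\<^sup>2 \<partial>lebesgue) * (C * N w)" .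
  qed
  finally show ?thesis by (simp add: algebra_simps)
qed

lemma load_representation: "u \<in> H \<Longrightarrow> \<exists>g. g \<in> H \<and> (\<forall>v\<in>H. load u v = HV_inner \<alpha> V g v)"
proof -
  assume u: "u \<in> H"
  obtain c where c: "0 \<le> c" "\<And>t. \<bar>f t\<bar> \<le> c * (\<bar>t\<bar> + \<bar>t\<bar> powr q)" using f_linear_growth by blast
  have "\<bar>load u v\<bar> \<le> (c * pairing_const (N u) + hn * C) * N v" if v: "v \<in> H" for v
  proof -
    have "\<bar>\<integral>x. f (u x) * v x \<partial>lebesgue\<bar> \<le> (\<integral>x. \<bar>f (u x) * v x\<bar> \<partial>lebesgue)"
      using integral_norm_bound[of lebesgue "\<lambda>x. f (u x) * v x"] by simp
    also have "\<dots> \<le> (\<integral>x. c * ((\<bar>u x\<bar> + \<bar>u x\<bar> powr q) * \<bar>v x\<bar>) \<partial>lebesgue)"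
    proof (rule integral_mono)
      show "\<bar>f (u x) * v x\<bar> \<le> c * ((\<bar>u x\<bar> + \<bar>u x\<bar> powr q) * \<bar>v x\<bar>)" for x
        unfolding abs_mult mult.assoc[symmetric] by (intro mult_right_mono c) simp
    qed (use u v in \<open>auto intro!: integrable_mult_right integrable_abs f_integrable pairing_integrable\<close>)
    also have "\<dots> = c * pairing u v" by (simp add: pairing_def)
    also have "\<dots> \<le> c * (pairing_const (N u) * N v)"
      by (intro mult_left_mono pairing_le u v c) simp
    finally have "\<bar>\<integral>x. f (u x) * v x \<partial>lebesgue\<bar> \<le> c * pairing_const (N u) * N v" by simp
    then show ?thesis
      using h_pairing_bound[OF v] load_eq[OF u v] unfolding distrib_right by linarith
  qed
  then show ?thesis
    using HVspace.Riesz_representation[of "load u" "c * pairing_const (N u) + hn * C"]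
      load_add[OF u] load_scale by metis
qed

text \<open>The representative is determined only up to elements of length zero, hence the choice
  operator.\<close>

definition K :: "(real^'n \<Rightarrow> real) \<Rightarrow> real^'n \<Rightarrow> real" where
  "K u = (SOME g. g \<in> H \<and> (\<forall>v\<in>H. load u v = HV_inner \<alpha> V g v))"

lemma K_in: "u \<in> H \<Longrightarrow> K u \<in> H" and K_inner: "u \<in> H \<Longrightarrow> v \<in> H \<Longrightarrow> HV_inner \<alpha> V (K u) v = load u v"
  using someI_ex[OF load_representation[of u]] unfolding K_def by auto

text \<open>Closeness of \<open>u\<close> and \<open>v\<close> is measured in L2 and not in
  \<open>N\<close>. Together with the L2-Cauchy subsequences of bounded sequences this makes
  \<open>K\<close> a compact map.\<close>

lemma K_continuous:
  assumes \<eta>: "0 < \<eta>"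
  shows "\<exists>d>0. \<forall>u\<in>H. \<forall>v\<in>H. N u \<le> R \<longrightarrow> N v \<le> R \<longrightarrow>
    sqrt (\<integral>x. (u x - v x)\<^sup>2 \<partial>lebesgue) \<le> d \<longrightarrow> N (K u - K v) \<le> \<eta>"
proof -
  define M where "M = pairing_const R"
  have M: "0 \<le> M" by (simp add: M_def pairing_const_nonneg)
  \<comment> \<open>Leaves \<open>\<eta> / 2\<close> for the term of critical growth, with the added
    1 covering \<open>M = 0\<close>. The constant \<open>c\<close> depends on this choice, so
    \<open>d\<close> is fixed only afterwards.\<close>
  define \<eta>' where "\<eta>' = \<eta> / (4 * (M + 1))"
  have \<eta>': "0 < \<eta>'" using \<eta> M by (simp add: \<eta>'_def)
  obtain c where c: "0 \<le> c"
    "\<And>a b. \<bar>f a - f b\<bar> \<le> \<eta>' * (\<bar>a\<bar> + \<bar>b\<bar> + \<bar>a\<bar> powr q + \<bar>b\<bar> powr q) + c * \<bar>a - b\<bar>"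
    using modulus_of_continuity[OF \<eta>'] by blast
  define d where "d = \<eta> / (2 * (c * C + 1))"
  have cC: "0 \<le> c * C" using c(1) C_pos by simp
  have d: "0 < d" using \<eta> cC by (simp add: d_def)
  have "N (K u - K v) \<le> \<eta>"
    if u: "u \<in> H" "N u \<le> R" and v: "v \<in> H" "N v \<le> R" and s: "sqrt (\<integral>x. (u x - v x)\<^sup>2 \<partial>lebesgue) \<le> d" for u v
  proof -
    define z where "z = K u - K v"
    have z: "z \<in> H" unfolding z_def by (intro HVspace.S_intros K_in u v)
    have "(N z)\<^sup>2 = load u z - load v z"
      using u v z K_in by (simp add: HVspace.N_sq) (simp add: z_def HVspace.B_diff K_inner HVspace.S_intros)
    also have "\<dots> \<le> (2 * \<eta>' * M + c * C * sqrt (\<integral>x. (u x - v x)\<^sup>2 \<partial>lebesgue)) * N z"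
      using load_diff_le[OF u v z less_imp_le[OF \<eta>'] c] by (simp add: M_def)
    also have "\<dots> \<le> \<eta> * N z"
    proof (intro mult_right_mono HVspace.N_nonneg z)
      have "2 * \<eta>' * M \<le> 2 * \<eta>' * (M + 1)" using \<eta>' by (intro mult_left_mono) auto
      also have "\<dots> = \<eta> / 2" using M by (simp add: \<eta>'_def field_simps)
      finally have 1: "2 * \<eta>' * M \<le> \<eta> / 2" .
      have "c * C * sqrt (\<integral>x. (u x - v x)\<^sup>2 \<partial>lebesgue) \<le> c * C * d"
        using cC s by (intro mult_left_mono)
      also have "\<dots> \<le> (c * C + 1) * d" using d by simp
      also have "\<dots> = \<eta> / 2" using cC by (simp add: d_def field_simps)
      finally show "2 * \<eta>' * M + c * C * sqrt (\<integral>x. (u x - v x)\<^sup>2 \<partial>lebesgue) \<le> \<eta>" using 1 by linarith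
    qed
    finally have "N z * N z \<le> \<eta> * N z" by (simp add: power2_eq_square)
    then have "N z \<le> \<eta>"
      using HVspace.N_nonneg[OF z] \<eta> by (cases "N z = 0") auto
    then show ?thesis by (simp add: z_def)
  qed
  then show ?thesis using d by blast
qed

section \<open>The energy and its gradient\<close>

definition J :: "(real^'n \<Rightarrow> real) \<Rightarrow> real" where
  "J u = HV_inner \<alpha> V u u / 2 - (\<integral>x. F (u x) \<partial>lebesgue) - (\<integral>x. h x * u x \<partial>lebesgue)"

definition G :: "(real^'n \<Rightarrow> real) \<Rightarrow> real^'n \<Rightarrow> real" where
  "G u = u - K u"

lemma G_in_H: "u \<in> H \<Longrightarrow> G u \<in> H"
  unfolding G_def by (intro HVspace.S_intros K_in)

lemma G_inner: "u \<in> H \<Longrightarrow> v \<in> H \<Longrightarrow> HV_inner \<alpha> V (G u) v = HV_inner \<alpha> V u v - load u v"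
  by (simp add: G_def HVspace.B_diff K_in K_inner)

text \<open>The error has a part linear in \<open>N w\<close>, whose coefficient is small through
  the choice of \<open>\<eta>'\<close>, and a part quadratic in \<open>N w\<close>. Only the latter
  requires \<open>w\<close> to be small.\<close>

lemma J_differentiable:
  assumes \<eta>: "0 < \<eta>"
  shows "\<exists>d>0. \<forall>u\<in>H. \<forall>w\<in>H. N u \<le> R \<longrightarrow> N w \<le> d \<longrightarrow>
    \<bar>J (u + w) - J u - HV_inner \<alpha> V (G u) w\<bar> \<le> \<eta> * N w"
proof -
  define M where "M = pairing_const R + pairing_const (R + 1)"
  have M: "0 \<le> M" by (simp add: M_def pairing_const_nonneg)
  define \<eta>' where "\<eta>' = \<eta> / (4 * (M + 1))"
  have \<eta>': "0 < \<eta>'" using \<eta> M by (simp add: \<eta>'_def)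
  obtain c where c: "0 \<le> c"
    "\<And>a b. \<bar>f a - f b\<bar> \<le> \<eta>' * (\<bar>a\<bar> + \<bar>b\<bar> + \<bar>a\<bar> powr q + \<bar>b\<bar> powr q) + c * \<bar>a - b\<bar>"
    using modulus_of_continuity[OF \<eta>'] by blast
  define c' where "c' = 1 + c * C\<^sup>2"
  have c': "0 < c'" using c(1) by (simp add: c'_def add_pos_nonneg)
  define d where "d = min 1 (\<eta> / (2 * c'))"
  have d: "0 < d" "d \<le> 1" "c' * d \<le> \<eta> / 2" using \<eta> c' by (auto simp: d_def min_def field_simps)
  have "\<bar>J (u + w) - J u - HV_inner \<alpha> V (G u) w\<bar> \<le> \<eta> * N w"
    if u: "u \<in> H" "N u \<le> R" and w: "w \<in> H" "N w \<le> d" for u w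
  proof -
    have uw: "u + w \<in> H" using u w by (intro HVspace.S_intros)
    have Nuw: "N (u + w) \<le> R + 1" using HVspace.N_triangle[OF u(1) w(1)] u w d by linarith
    have Nw: "0 \<le> N w" using w by (simp add: HVspace.N_nonneg)
    let ?E = "\<lambda>x. F (u x + w x) - F (u x) - f (u x) * w x"
    have iF: "integrable lebesgue (\<lambda>x. F (u x + w x))" using F_integrable[OF uw] by simp
    have iE: "integrable lebesgue ?E"
      by (intro Bochner_Integration.integrable_diff iF F_integrable[OF u(1)] f_integrable[OF u(1) w(1)])
    have iR: "integrable lebesgue (\<lambda>x. (\<bar>u x + w x\<bar> + \<bar>u x + w x\<bar> powr q) * \<bar>w x\<bar>)"
      using pairing_integrable[OF uw w(1)] by simp
    have "\<bar>\<integral>x. ?E x \<partial>lebesgue\<bar> \<le> (\<integral>x. \<bar>?E x\<bar> \<partial>lebesgue)"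
      using integral_norm_bound[of lebesgue ?E] by simp
    also have "\<dots> \<le> (\<integral>x. 2 * \<eta>' * ((\<bar>u x\<bar> + \<bar>u x\<bar> powr q) * \<bar>w x\<bar> + (\<bar>u x + w x\<bar> + \<bar>u x + w x\<bar> powr q) * \<bar>w x\<bar>)
         + c * (w x)\<^sup>2 \<partial>lebesgue)"
    proof (rule integral_mono)
      show "integrable lebesgue (\<lambda>x. 2 * \<eta>' * ((\<bar>u x\<bar> + \<bar>u x\<bar> powr q) * \<bar>w x\<bar> +
          (\<bar>u x + w x\<bar> + \<bar>u x + w x\<bar> powr q) * \<bar>w x\<bar>) + c * (w x)\<^sup>2)"
        by (intro Bochner_Integration.integrable_add integrable_mult_right pairing_integrable[OF u(1) w(1)] iR
            sqint_square HV_D(1) w(1))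
    qed (use iE primitive_expansion[OF c(1) \<eta>' c(2)] in auto)
    also have "\<dots> = 2 * \<eta>' * (pairing u w + pairing (u + w) w) + c * (\<integral>x. (w x)\<^sup>2 \<partial>lebesgue)"
      unfolding pairing_def using iR sqint_square[OF HV_D(1)[OF w(1)]] pairing_integrable[OF u(1) w(1)]
      by simp
    also have "\<dots> \<le> 2 * \<eta>' * (pairing_const R * N w + pairing_const (R + 1) * N w) + c * (C * N w)\<^sup>2"
      using \<eta>' c(1) by (intro add_mono mult_left_mono pairing_le u w uw Nuw L2_bound) auto
    also have "\<dots> = 2 * \<eta>' * M * N w + c * C\<^sup>2 * (N w)\<^sup>2"
      by (simp add: M_def algebra_simps power_mult_distrib)
    finally have E: "\<bar>\<integral>x. ?E x \<partial>lebesgue\<bar> \<le> 2 * \<eta>' * M * N w + c * C\<^sup>2 * (N w)\<^sup>2" .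
    have "(\<integral>x. ?E x \<partial>lebesgue) = (\<integral>x. F (u x + w x) \<partial>lebesgue) - (\<integral>x. F (u x) \<partial>lebesgue) - (\<integral>x. f (u x) * w x \<partial>lebesgue)"
      using iF F_integrable[OF u(1)] f_integrable[OF u(1) w(1)] by simp
    moreover have "(\<integral>x. h x * (u + w) x \<partial>lebesgue) = (\<integral>x. h x * u x \<partial>lebesgue) + (\<integral>x. h x * w x \<partial>lebesgue)"
      using h_integrable u w by (simp add: distrib_left)
    moreover have "HV_inner \<alpha> V (u + w) (u + w) = HV_inner \<alpha> V u u + 2 * HV_inner \<alpha> V u w + (N w)\<^sup>2"
      using u w HVspace.B_sym[OF u(1) w(1)] by (simp add: HVspace.B_simps HVspace.S_intros HVspace.N_sq)
    ultimately have "J (u + w) - J u - HV_inner \<alpha> V (G u) w = (N w)\<^sup>2 / 2 - (\<integral>x. ?E x \<partial>lebesgue)"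
      using u w by (simp add: J_def G_inner load_eq field_simps)
    then have "\<bar>J (u + w) - J u - HV_inner \<alpha> V (G u) w\<bar> \<le> (N w)\<^sup>2 + (2 * \<eta>' * M * N w + c * C\<^sup>2 * (N w)\<^sup>2)"
      using E zero_le_power2[of "N w"] by linarith
    also have "\<dots> = (2 * \<eta>' * M + c' * N w) * N w"
      by (simp add: c'_def power2_eq_square algebra_simps)
    also have "\<dots> \<le> \<eta> * N w"
    proof (intro mult_right_mono Nw)
      have "2 * \<eta>' * M \<le> 2 * \<eta>' * (M + 1)" using \<eta>' by (intro mult_left_mono) auto
      also have "\<dots> = \<eta> / 2" using M by (simp add: \<eta>'_def field_simps)
      finally have 1: "2 * \<eta>' * M \<le> \<eta> / 2" .
      have "c' * N w \<le> c' * d" using c' w by (intro mult_left_mono) auto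
      then show "2 * \<eta>' * M + c' * N w \<le> \<eta>" using 1 d(3) by linarith
    qed
    finally show ?thesis .
  qed
  then show ?thesis using d(1) by blast
qed

lemma G_continuous:
  assumes \<eta>: "0 < \<eta>"
  shows "\<exists>d>0. \<forall>u\<in>H. \<forall>v\<in>H. N u \<le> R \<longrightarrow> N v \<le> R \<longrightarrow> N (u - v) \<le> d \<longrightarrow> N (G u - G v) \<le> \<eta>"
proof -
  obtain d where d: "0 < d" "\<And>u v. \<lbrakk>u \<in> H; v \<in> H; N u \<le> R; N v \<le> R;
      sqrt (\<integral>x. (u x - v x)\<^sup>2 \<partial>lebesgue) \<le> d\<rbrakk> \<Longrightarrow> N (K u - K v) \<le> \<eta> / 2"
    using K_continuous[of "\<eta> / 2" R] \<eta> by auto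
  define d' where "d' = min (\<eta> / 2) (d / C)"
  have d': "0 < d'" "d' \<le> \<eta> / 2" "C * d' \<le> d"
    using \<eta> d(1) C_pos by (auto simp: d'_def min_def field_simps)
  have "N (G u - G v) \<le> \<eta>" if "u \<in> H" "v \<in> H" "N u \<le> R" "N v \<le> R" "N (u - v) \<le> d'" for u v
  proof -
    have uv: "u - v \<in> H" using that by (intro HVspace.S_intros)
    have "sqrt (\<integral>x. (u x - v x)\<^sup>2 \<partial>lebesgue) \<le> C * N (u - v)" using L2_bound(1)[OF uv] by simp
    also have "\<dots> \<le> d"
      using mult_left_mono[OF that(5), of C] C_pos d'(3) by linarith
    finally have "N (K u - K v) \<le> \<eta> / 2" using d(2) that by blast
    moreover have "N (G u - G v) \<le> N (u - v) + N (K u - K v)"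
    proof -
      have "G u - G v = (u - v) - (K u - K v)" by (simp add: G_def)
      then show ?thesis using HVspace.N_triangle_diff[of "u - v" "K u - K v"] that K_in
        by (simp add: HVspace.S_intros)
    qed
    ultimately show ?thesis using that(5) d'(2) by linarith
  qed
  then show ?thesis using d'(1) by blast
qed

text \<open>In \<open>\<mu> * J u - HV_inner \<alpha> V (G u) u\<close> the nonlinear terms combine
  to the integral of \<open>f (u x) * u x - \<mu> * F (u x)\<close>, which is nonnegative, and the
  quadratic terms leave the positive coefficient \<open>\<mu> / 2 - 1\<close>.\<close>

lemma norm_bound_by_energy_and_gradient:
  assumes u: "u \<in> H"
  shows "(\<mu> / 2 - 1) * (N u)\<^sup>2 \<le> \<mu> * J u + (N (G u) + (\<mu> - 1) * (hn * C)) * N u"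
proof -
  define I where "I = (\<integral>x. h x * u x \<partial>lebesgue)"
  have "\<mu> * (\<integral>x. F (u x) \<partial>lebesgue) = (\<integral>x. \<mu> * F (u x) \<partial>lebesgue)" by simp
  also have "\<dots> \<le> (\<integral>x. f (u x) * u x \<partial>lebesgue)"
  proof (intro integral_mono integrable_mult_right F_integrable f_integrable u)
    show "\<mu> * F (u x) \<le> f (u x) * u x" for x
      using AR[of "u x"] by (cases "u x = 0") (auto simp: primitive_0 mult.commute)
  qed
  finally have 1: "\<mu> * (\<integral>x. F (u x) \<partial>lebesgue) \<le> (\<integral>x. f (u x) * u x \<partial>lebesgue)" .
  have 2: "HV_inner \<alpha> V (G u) u = (N u)\<^sup>2 - (\<integral>x. f (u x) * u x \<partial>lebesgue) - I"
    using u by (simp add: G_inner load_eq HVspace.N_sq I_def)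
  have 3: "\<mu> * J u = \<mu> / 2 * (N u)\<^sup>2 - \<mu> * (\<integral>x. F (u x) \<partial>lebesgue) - \<mu> * I"
    using u by (simp add: J_def HVspace.N_sq I_def algebra_simps)
  have 4: "- (N (G u) * N u) \<le> HV_inner \<alpha> V (G u) u \<and> HV_inner \<alpha> V (G u) u \<le> N (G u) * N u"
    using HVspace.Cauchy_Schwarz[OF G_in_H[OF u] u] by (simp add: abs_le_iff)
  have "\<bar>I\<bar> \<le> hn * C * N u" unfolding I_def by (rule h_pairing_bound[OF u])
  then have "(\<mu> - 1) * \<bar>I\<bar> \<le> (\<mu> - 1) * (hn * C * N u)" using \<mu> by (intro mult_left_mono) auto
  moreover have "- ((\<mu> - 1) * \<bar>I\<bar>) \<le> (\<mu> - 1) * I"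
    using \<mu> by (cases "0 \<le> I") (auto simp: abs_if mult_nonneg_nonneg)
  moreover have "(\<mu> - 1) * I = \<mu> * I - I" by (simp add: algebra_simps)
  moreover have "(\<mu> / 2 - 1) * (N u)\<^sup>2 = \<mu> / 2 * (N u)\<^sup>2 - (N u)\<^sup>2" by (simp add: algebra_simps)
  moreover have "(N (G u) + (\<mu> - 1) * (hn * C)) * N u = N (G u) * N u + (\<mu> - 1) * (hn * C * N u)"
    by (simp add: algebra_simps)
  moreover have "(\<mu> - 1) * I \<le> (\<mu> - 1) * \<bar>I\<bar>" using \<mu> by (intro mult_left_mono) auto
  ultimately show ?thesis using 1 2 3 4 by linarith
qed

lemma Palais_Smale_condition:
  assumes X: "\<And>k. X k \<in> H" and JX: "(\<lambda>k. J (X k)) \<longlonglongrightarrow> c" and GX: "(\<lambda>k. N (G (X k))) \<longlonglongrightarrow> 0"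
  shows "\<exists>u\<in>H. J u = c \<and> N (G u) = 0"
proof -
  obtain c1 where c1: "\<And>k. norm (J (X k)) \<le> c1"
    using convergent_imp_Bseq[OF convergentI[OF JX]] by (auto simp: Bseq_def)
  obtain g1 where g1: "\<And>k. norm (N (G (X k))) \<le> g1"
    using convergent_imp_Bseq[OF convergentI[OF GX]] by (auto simp: Bseq_def)
  define a b where "a = \<mu> / 2 - 1" and "b = g1 + (\<mu> - 1) * (hn * C)"
  \<comment> \<open>For \<open>y = N (X k)\<close> above 1 the estimate reads
    \<open>a * y\<^sup>2 \<le> (\<mu> * c1 + b) * y\<close>, since the constant term may be
    multiplied by \<open>y\<close>.\<close>
  define R where "R = max 1 ((\<mu> * c1 + b) / a)"
  have a: "0 < a" using \<mu> by (simp add: a_def)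
  have R: "N (X k) \<le> R" for k
  proof (cases "N (X k) \<le> 1")
    case False
    define y where "y = N (X k)"
    have y: "1 < y" using False by (simp add: y_def)
    have "0 \<le> c1" using order_trans[OF norm_ge_zero c1] .
    have "a * y\<^sup>2 \<le> \<mu> * J (X k) + (N (G (X k)) + (\<mu> - 1) * (hn * C)) * y"
      unfolding a_def y_def by (rule norm_bound_by_energy_and_gradient[OF X])
    also have "\<dots> \<le> \<mu> * c1 + b * y"
      using c1[of k] g1[of k] \<mu> y hn_nonneg C_pos unfolding b_def
      by (intro add_mono mult_left_mono mult_right_mono) auto
    also have "\<dots> \<le> \<mu> * c1 * y + b * y"
      using y \<mu> \<open>0 \<le> c1\<close> mult_left_mono[of 1 y "\<mu> * c1"] by simp
    finally have "(a * y) * y \<le> (\<mu> * c1 + b) * y" by (simp add: power2_eq_square algebra_simps)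
    then have "a * y \<le> \<mu> * c1 + b" using y by simp
    then have "y \<le> (\<mu> * c1 + b) / a" using a by (simp add: field_simps)
    then show ?thesis by (simp add: R_def y_def)
  qed (simp add: R_def)
  obtain r where r: "strict_mono (r :: nat \<Rightarrow> nat)" and cau: "\<And>e. e > 0 \<Longrightarrow>
      \<exists>K. \<forall>i\<ge>K. \<forall>j\<ge>K. (\<integral>x. (X (r i) x - X (r j) x)\<^sup>2 \<partial>lebesgue) < e"
  proof (rule L2_Cauchy_subsequence[where X = X and R = R, OF V_lim X R], goal_cases)
    case (1 r)
    show ?case by (rule 1(1)[OF 1(2)]) (rule 1(3))
  qed
  define Y where "Y k = X (r k)" for k
  have Y: "Y k \<in> H" "N (Y k) \<le> R" for k using X R by (auto simp: Y_def)
  have GY: "(\<lambda>k. N (G (Y k))) \<longlonglongrightarrow> 0" and JY: "(\<lambda>k. J (Y k)) \<longlonglongrightarrow> c"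
    using LIMSEQ_subseq_LIMSEQ[OF GX r] LIMSEQ_subseq_LIMSEQ[OF JX r] by (simp_all add: Y_def o_def)
  have "\<exists>M. \<forall>i\<ge>M. \<forall>j\<ge>M. N (Y i - Y j) < e" if e: "0 < e" for e
  proof -
    obtain d where d: "0 < d" "\<And>u v. \<lbrakk>u \<in> H; v \<in> H; N u \<le> R; N v \<le> R;
      sqrt (\<integral>x. (u x - v x)\<^sup>2 \<partial>lebesgue) \<le> d\<rbrakk> \<Longrightarrow> N (K u - K v) \<le> e / 4"
      using K_continuous[of "e / 4" R] e by auto
    obtain M1 where M1: "\<forall>i\<ge>M1. \<forall>j\<ge>M1. (\<integral>x. (Y i x - Y j x)\<^sup>2 \<partial>lebesgue) < d\<^sup>2"
      using cau[of "d\<^sup>2"] d(1) unfolding Y_def by auto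
    have "\<forall>\<^sub>F k in sequentially. N (G (Y k)) < e / 4"
      by (rule order_tendstoD(2)[OF GY]) (use e in simp)
    then obtain M2 where M2: "\<forall>k\<ge>M2. N (G (Y k)) < e / 4" by (auto simp: eventually_sequentially)
    have "N (Y i - Y j) < e" if ij: "max M1 M2 \<le> i" "max M1 M2 \<le> j" for i j
    proof -
      have "sqrt (\<integral>x. (Y i x - Y j x)\<^sup>2 \<partial>lebesgue) \<le> sqrt (d\<^sup>2)"
        using M1 ij by (intro real_sqrt_le_mono) (auto intro: less_imp_le)
      then have "N (K (Y i) - K (Y j)) \<le> e / 4" using d Y by simp
      moreover have "N (G (Y i) - G (Y j)) \<le> N (G (Y i)) + N (G (Y j))"
        by (intro HVspace.N_triangle_diff G_in_H Y)
      moreover have "N (Y i - Y j) \<le> N (G (Y i) - G (Y j)) + N (K (Y i) - K (Y j))"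
      proof -
        have "Y i - Y j = (G (Y i) - G (Y j)) + (K (Y i) - K (Y j))" by (simp add: G_def)
        then show ?thesis
          using HVspace.N_triangle[of "G (Y i) - G (Y j)" "K (Y i) - K (Y j)"] Y K_in G_in_H
          by (simp add: HVspace.S_intros)
      qed
      moreover have "N (G (Y i)) < e / 4" "N (G (Y j)) < e / 4" using M2 ij by auto
      ultimately show ?thesis using e by linarith
    qed
    then show ?thesis by blast
  qed
  then obtain u where u: "u \<in> H" and lim: "(\<lambda>k. N (Y k - u)) \<longlonglongrightarrow> 0"
    using HVspace.complete[of Y] Y(1) by blast
  have "(\<lambda>k. J (Y k) - J u) \<longlonglongrightarrow> 0"
  proof -
    obtain d where d: "0 < d" and D: "\<And>w. w \<in> H \<Longrightarrow> N w \<le> d \<Longrightarrow>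
        \<bar>J (u + w) - J u - HV_inner \<alpha> V (G u) w\<bar> \<le> 1 * N w"
      using J_differentiable[of 1 "N u"] u by auto
    have "\<forall>\<^sub>F k in sequentially. N (Y k - u) < d"
      by (rule order_tendstoD(2)[OF lim d])
    then have "\<forall>\<^sub>F k in sequentially. norm (J (Y k) - J u) \<le> (1 + N (G u)) * N (Y k - u)"
    proof eventually_elim
      case (elim k)
      have w: "Y k - u \<in> H" by (intro HVspace.S_intros Y u)
      then show ?case
        using D[OF w] elim HVspace.Cauchy_Schwarz[OF G_in_H[OF u] w] by (simp add: distrib_right)
    qed
    moreover have "(\<lambda>k. (1 + N (G u)) * N (Y k - u)) \<longlonglongrightarrow> 0"
      using tendsto_mult_left[OF lim, of "1 + N (G u)"] by simp
    ultimately show ?thesis by (rule Lim_null_comparison)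
  qed
  then have "J u = c" using JY by (metis LIM_zero_cancel LIMSEQ_unique)
  moreover have "N (G u) = 0"
  proof (rule ccontr)
    assume "N (G u) \<noteq> 0"
    then have pos: "0 < N (G u)" using HVspace.N_nonneg[OF G_in_H[OF u]] by linarith
    define R' where "R' = max R (N u)"
    obtain d where d: "0 < d" "\<And>v w. \<lbrakk>v \<in> H; w \<in> H; N v \<le> R'; N w \<le> R'; N (v - w) \<le> d\<rbrakk> \<Longrightarrow>
        N (G v - G w) \<le> N (G u) / 3"
      using G_continuous[of "N (G u) / 3" R'] pos by auto
    have "\<forall>\<^sub>F k in sequentially. N (Y k - u) < d" "\<forall>\<^sub>F k in sequentially. N (G (Y k)) < N (G u) / 3"
      by (rule order_tendstoD(2)[OF lim d(1)], rule order_tendstoD(2)[OF GY]) (use pos in simp)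
    then have "\<forall>\<^sub>F k in sequentially. False"
    proof eventually_elim
      case (elim k)
      have "N (G (Y k) - G u) \<le> N (G u) / 3"
        using d(2)[OF Y(1)[of k] u] Y(2)[of k] elim by (simp add: R'_def)
      then show False
        using HVspace.N_reverse_triangle[OF G_in_H[OF Y(1)] G_in_H[OF u], of k] elim pos by linarith
    qed
    then show False by simp
  qed
  ultimately show ?thesis using u by blast
qed

sublocale energy: smooth_functional H "HV_inner \<alpha> V" J G
  by unfold_locales (fact G_in_H J_differentiable G_continuous Palais_Smale_condition)+

section \<open>Mountain pass geometry of the energy\<close>

lemma J_lower_bound:
  assumes u: "u \<in> H" and \<epsilon>: "0 < \<epsilon>" and g: "growth_thresholds CARD('n) \<alpha> f \<epsilon> \<delta> \<rho>"
  shows "(N u)\<^sup>2 / 2 - \<epsilon> * (C * N u)\<^sup>2 - (\<epsilon> + K_const CARD('n) \<alpha> f \<delta> \<rho>) * (C * N u) powr p - hn * C * N u \<le> J u"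
proof -
  define k where "k = \<epsilon> + K_const CARD('n) \<alpha> f \<delta> \<rho>"
  have k: "0 \<le> k" using growth_bound(1)[OF g \<epsilon>] \<epsilon> by (simp add: k_def)
  have "(\<integral>x. F (u x) \<partial>lebesgue) \<le> (\<integral>x. \<epsilon> * (u x)\<^sup>2 + k * \<bar>u x\<bar> powr p \<partial>lebesgue)"
  proof (intro integral_mono F_integrable u Bochner_Integration.integrable_add integrable_mult_right
      sqint_square HV_D Lp_bound)
    show "F (u x) \<le> \<epsilon> * (u x)\<^sup>2 + k * \<bar>u x\<bar> powr p" for x
      using primitive_bound[OF g \<epsilon>, of "u x"] by (simp add: k_def)
  qed
  also have "\<dots> = \<epsilon> * (\<integral>x. (u x)\<^sup>2 \<partial>lebesgue) + k * (\<integral>x. \<bar>u x\<bar> powr p \<partial>lebesgue)"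
    using u by (simp add: sqint_square HV_D Lp_bound)
  also have "\<dots> \<le> \<epsilon> * (C * N u)\<^sup>2 + k * (C * N u) powr p"
    using \<epsilon> k u by (intro add_mono mult_left_mono L2_bound Lp_bound) auto
  finally show ?thesis
    using h_pairing_bound[OF u] u unfolding J_def k_def by (simp add: HVspace.N_sq abs_le_iff)
qed

text \<open>On the ball of radius 1/2 the tent \<phi> is at least 1/2, so there
  \<open>F (t * \<phi> x)\<close> is at least \<open>F 1 * (t / 2) powr \<mu>\<close>. This outgrows
  the quadratic and linear terms.\<close>

lemma J_unbounded_below: "\<exists>e\<in>H. r < N e \<and> J e \<le> 0"
proof -
  define \<phi> where "\<phi> = (hat :: real^'n \<Rightarrow> real)"
  have \<phi>: "\<phi> \<in> H" unfolding \<phi>_def by (rule hat_in_HV[OF alpha_less_1 card])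
  define A :: "(real^'n) set" where "A = cball 0 (1/2)"
  have [measurable]: "A \<in> sets lebesgue" by (simp add: A_def)
  define m where "m = measure lebesgue A"
  have m: "0 < m"
    by (simp add: m_def A_def content_cball_pos)
  have iA: "integrable lebesgue (\<lambda>x. indicator A x :: real)"
    by (simp add: A_def emeasure_cball)
  have half: "1 / 2 \<le> \<phi> x" if "x \<in> A" for x using that hat_ge_half[of x] by (simp add: \<phi>_def A_def)
  \<comment> \<open>\<open>N\<close> is only a seminorm, so its positivity at \<phi> has to come
    from the positive L2 norm.\<close>
  have "1 / 4 * m = (\<integral>x. 1 / 4 * indicator A x \<partial>lebesgue)" by (simp add: m_def)
  also have "\<dots> \<le> (\<integral>x. (\<phi> x)\<^sup>2 \<partial>lebesgue)"
  proof (intro integral_mono integrable_mult_right iA sqint_square HV_D \<phi>)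
    fix x show "1 / 4 * indicator A x \<le> (\<phi> x)\<^sup>2"
      using half[of x] power_mono[of "1/2" "\<phi> x" 2] by (cases "x \<in> A") (auto simp: power2_eq_square)
  qed
  also have "\<dots> \<le> (C * N \<phi>)\<^sup>2" by (rule L2_bound[OF \<phi>])
  finally have "N \<phi> \<noteq> 0" using m by auto
  then have N\<phi>: "0 < N \<phi>" using HVspace.N_nonneg[OF \<phi>] by linarith
  define I where "I = \<bar>\<integral>x. h x * \<phi> x \<partial>lebesgue\<bar>"
  define a where "a = (N \<phi>)\<^sup>2 / 2 + I"
  have a: "0 < a" using N\<phi> by (simp add: a_def I_def add_pos_nonneg)
  define \<kappa> where "\<kappa> = F 1 * (1 / 2) powr \<mu> * m"
  have \<kappa>: "0 < \<kappa>" using primitive_superlinear(3)[OF \<mu> AR] m by (simp add: \<kappa>_def)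
  \<comment> \<open>One summand for each demand on \<open>t\<close>: 2 gives
    \<open>t / 2 \<ge> 1\<close>, as superlinear growth requires, the second gives
    \<open>a \<le> \<kappa> * t powr (\<mu> - 2)\<close>, and the third carries the point out of the
    ball of radius \<open>r\<close>.\<close>
  define t where "t = 2 + (a / \<kappa>) powr (1 / (\<mu> - 2)) + (\<bar>r\<bar> + 1) / N \<phi>"
  have t2: "2 \<le> t" and t1: "(a / \<kappa>) powr (1 / (\<mu> - 2)) \<le> t" and t3: "(\<bar>r\<bar> + 1) / N \<phi> \<le> t"
    using N\<phi> by (auto simp: t_def)
  have e: "t *\<^sub>R \<phi> \<in> H" by (intro HVspace.S_intros \<phi>)
  have "\<bar>r\<bar> + 1 \<le> t * N \<phi>" using t3 N\<phi> by (simp add: field_simps)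
  then have Ne: "r < N (t *\<^sub>R \<phi>)" using t2 by (simp add: HVspace.N_scale \<phi>)
  have "\<kappa> * t powr \<mu> = (\<integral>x. F 1 * (t / 2) powr \<mu> * indicator A x \<partial>lebesgue)"
    using t2 by (simp add: \<kappa>_def m_def powr_divide)
  also have "\<dots> \<le> (\<integral>x. F ((t *\<^sub>R \<phi>) x) \<partial>lebesgue)"
  proof (intro integral_mono integrable_mult_right iA F_integrable e)
    fix x
    show "F 1 * (t / 2) powr \<mu> * indicator A x \<le> F ((t *\<^sub>R \<phi>) x)"
    proof (cases "x \<in> A")
      case True
      have *: "t / 2 \<le> t * \<phi> x" using mult_left_mono[OF half[OF True], of t] t2 by simp
      have "F 1 * (t / 2) powr \<mu> \<le> F 1 * (t * \<phi> x) powr \<mu>"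
        using primitive_superlinear(3)[OF \<mu> AR] * t2 \<mu> by (intro mult_left_mono powr_mono2) auto
      also have "\<dots> \<le> F (t * \<phi> x)"
      proof (rule primitive_superlinear(2)[OF \<mu> AR])
        show "1 \<le> t * \<phi> x" using * t2 by linarith
      qed
      finally show ?thesis using True by simp
    next
      case False
      then show ?thesis using primitive_superlinear(1)[OF \<mu> AR] by simp
    qed
  qed
  finally have F: "\<kappa> * t powr \<mu> \<le> (\<integral>x. F ((t *\<^sub>R \<phi>) x) \<partial>lebesgue)" .
  have "(\<integral>x. h x * (t *\<^sub>R \<phi>) x \<partial>lebesgue) = t * (\<integral>x. h x * \<phi> x \<partial>lebesgue)"
    by (simp add: mult.left_commute)
  moreover have "- (t * I) \<le> t * (\<integral>x. h x * \<phi> x \<partial>lebesgue)"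
  proof -
    have "t * (- I) \<le> t * (\<integral>x. h x * \<phi> x \<partial>lebesgue)"
      using t2 by (intro mult_left_mono) (auto simp: I_def)
    then show ?thesis by simp
  qed
  moreover have "HV_inner \<alpha> V (t *\<^sub>R \<phi>) (t *\<^sub>R \<phi>) / 2 = t\<^sup>2 * ((N \<phi>)\<^sup>2 / 2)"
  proof -
    have "HV_inner \<alpha> V (t *\<^sub>R \<phi>) (t *\<^sub>R \<phi>) = t * (t * (N \<phi>)\<^sup>2)"
      using \<phi> by (simp add: HVspace.B_scale HVspace.B_scale_right HVspace.S_scale HVspace.N_sq)
    then show ?thesis by (simp add: power2_eq_square)
  qed
  ultimately have "J (t *\<^sub>R \<phi>) \<le> t\<^sup>2 * ((N \<phi>)\<^sup>2 / 2) - \<kappa> * t powr \<mu> + t * I"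
    using F unfolding J_def by linarith
  also have "t * I \<le> t\<^sup>2 * I"
    using t2 by (intro mult_right_mono) (auto simp: I_def power2_eq_square)
  finally have "J (t *\<^sub>R \<phi>) \<le> t\<^sup>2 * a - \<kappa> * t powr \<mu>" by (simp add: a_def algebra_simps)
  moreover have "t\<^sup>2 * a \<le> \<kappa> * t powr \<mu>"
  proof -
    have "((a / \<kappa>) powr (1 / (\<mu> - 2))) powr (\<mu> - 2) \<le> t powr (\<mu> - 2)"
      using t1 \<mu> by (intro powr_mono2) auto
    then have "a / \<kappa> \<le> t powr (\<mu> - 2)" using \<mu> a \<kappa> by (simp add: powr_powr)
    then have "a \<le> \<kappa> * t powr (\<mu> - 2)" using \<kappa> by (simp add: field_simps)
    then have "t\<^sup>2 * a \<le> t\<^sup>2 * (\<kappa> * t powr (\<mu> - 2))" by (intro mult_left_mono) auto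
    also have "\<dots> = \<kappa> * (t powr 2 * t powr (\<mu> - 2))" using t2 by (simp add: powr_numeral)
    also have "t powr 2 * t powr (\<mu> - 2) = t powr \<mu>" by (simp flip: powr_add)
    finally show ?thesis .
  qed
  ultimately show ?thesis using e Ne by (intro bexI[of _ "t *\<^sub>R \<phi>"]) auto
qed

text \<open>\<open>N (G u) = 0\<close> does not make \<open>G u\<close> the zero function, but by
  the Cauchy-Schwarz inequality its product with every test function vanishes.\<close>

lemma weak_solution_of_critical_point:
  assumes u: "u \<in> H" and G0: "N (G u) = 0"
  shows "weak_solution \<alpha> V f h u"
proof -
  have "HV_inner \<alpha> V u w = load u w" if w: "w \<in> H" for w
    using HVspace.Cauchy_Schwarz[OF G_in_H[OF u] w] G_inner[OF u w] G0 by simp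
  then show ?thesis
    using u load_integrable[OF u] by (simp add: weak_solution_def load_def)
qed

text \<open>Testing the equation with the solution itself turns the quadratic part into the integral
  of \<open>(f (u x) + h x) * u x\<close>. Then \<open>J\<close> consists of single integrals, which
  ignore null sets, and different energies exclude equality almost everywhere.\<close>

lemma J_weak_solution_cong:
  assumes u: "weak_solution \<alpha> V f h u" and v: "weak_solution \<alpha> V f h v"
    and ae: "AE x in lebesgue. u x = v x"
  shows "J u = J v"
proof -
  have H: "u \<in> H" "v \<in> H" using u v by (auto simp: weak_solution_def)
  have [measurable]: "u \<in> borel_measurable lebesgue" "v \<in> borel_measurable lebesgue"
    "h \<in> borel_measurable lebesgue" using H h by measurable
  have "HV_inner \<alpha> V u u = (\<integral>x. (f (u x) + h x) * u x \<partial>lebesgue)"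
    using u H by (simp add: weak_solution_def)
  also have "\<dots> = (\<integral>x. (f (v x) + h x) * v x \<partial>lebesgue)"
    by (intro integral_cong_AE) (use ae in \<open>auto elim: eventually_mono\<close>)
  also have "\<dots> = HV_inner \<alpha> V v v"
    using v H by (simp add: weak_solution_def)
  finally have 1: "HV_inner \<alpha> V u u = HV_inner \<alpha> V v v" .
  have 2: "(\<integral>x. F (u x) \<partial>lebesgue) = (\<integral>x. F (v x) \<partial>lebesgue)"
    by (intro integral_cong_AE) (use ae in \<open>auto elim: eventually_mono\<close>)
  have 3: "(\<integral>x. h x * u x \<partial>lebesgue) = (\<integral>x. h x * v x \<partial>lebesgue)"
    by (intro integral_cong_AE) (use ae in \<open>auto elim: eventually_mono\<close>)
  show ?thesis by (simp add: J_def 1 2 3)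
qed

theorem two_weak_solutions:
  assumes \<epsilon>: "0 < \<epsilon>" and r: "0 < r" and g: "growth_thresholds CARD('n) \<alpha> f \<epsilon> \<delta> \<rho>"
    and small: "hn < r / C * (1 / 2 - \<epsilon> * C\<^sup>2 - (\<epsilon> + K_const CARD('n) \<alpha> f \<delta> \<rho>) * C powr p * r powr (p - 2))"
  shows "\<exists>u v. weak_solution \<alpha> V f h u \<and> weak_solution \<alpha> V f h v \<and> \<not> (AE x in lebesgue. u x = v x)"
proof -
  define k where "k = \<epsilon> + K_const CARD('n) \<alpha> f \<delta> \<rho>"
  have k: "0 \<le> k" using growth_bound(1)[OF g \<epsilon>] \<epsilon> by (simp add: k_def)
  \<comment> \<open>The value of the lower bound for \<open>J\<close> at \<open>N u = r\<close>. The
    assumption \<open>small\<close> multiplied by \<open>C * r\<close> is the statement that it is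
    positive.\<close>
  define \<eta> where "\<eta> = r\<^sup>2 / 2 - \<epsilon> * (C * r)\<^sup>2 - k * (C * r) powr p - hn * C * r"
  have \<eta>: "0 < \<eta>"
  proof -
    have "r\<^sup>2 * r powr (p - 2) = r powr 2 * r powr (p - 2)" using r by (simp add: powr_numeral)
    also have "\<dots> = r powr p" unfolding powr_add[symmetric] by (simp add: add.commute)
    finally have rp: "r\<^sup>2 * r powr (p - 2) = r powr p" .
    have "hn * (C * r) < r / C * (1 / 2 - \<epsilon> * C\<^sup>2 - k * C powr p * r powr (p - 2)) * (C * r)"
      using small C_pos r by (intro mult_strict_right_mono) (auto simp: k_def)
    also have "\<dots> = r\<^sup>2 * (1 / 2 - \<epsilon> * C\<^sup>2 - k * C powr p * r powr (p - 2))"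
      using C_pos by (simp add: power2_eq_square)
    also have "\<dots> = r\<^sup>2 / 2 - \<epsilon> * (C * r)\<^sup>2 - k * (C powr p * (r\<^sup>2 * r powr (p - 2)))"
      by (simp add: algebra_simps power_mult_distrib)
    also have "C powr p * (r\<^sup>2 * r powr (p - 2)) = (C * r) powr p"
      unfolding rp using C_pos r by (simp add: powr_mult)
    finally show ?thesis by (simp add: \<eta>_def)
  qed
  have sphere: "\<eta> \<le> J u" if "u \<in> H" "N u = r" for u
    using J_lower_bound[OF that(1) \<epsilon> g] that(2) by (simp add: \<eta>_def k_def)
  have lower: "- (\<epsilon> * (C * r)\<^sup>2 + k * (C * r) powr p + hn * C * r) \<le> J u" if u: "u \<in> H" "N u \<le> r" for u
  proof -
    have nn: "0 \<le> N u" using u by (simp add: HVspace.N_nonneg)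
    have "\<epsilon> * (C * N u)\<^sup>2 + k * (C * N u) powr p + hn * C * N u
        \<le> \<epsilon> * (C * r)\<^sup>2 + k * (C * r) powr p + hn * C * r"
      using \<epsilon> k C_pos nn u q(2) hn_nonneg
      by (intro add_mono mult_left_mono power_mono powr_mono2) auto
    then show ?thesis
      using J_lower_bound[OF u(1) \<epsilon> g] zero_le_power2[of "N u"] unfolding k_def by linarith
  qed
  have J0: "J 0 \<le> 0"
    using HVspace.N_sq[OF HVspace.S_0] HVspace.N_0 by (simp add: J_def primitive_0 zero_fun_def)
  obtain u where u: "u \<in> H" "J u \<le> 0" "N (G u) = 0"
    using energy.critical_point_in_ball[OF r \<eta> sphere lower J0] by blast
  obtain e where e: "e \<in> H" "r < N e" "J e \<le> 0" using J_unbounded_below by blast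
  obtain v where v: "v \<in> H" "\<eta> \<le> J v" "N (G v) = 0"
    using energy.mountain_pass[OF r \<eta> sphere J0 e] by blast
  have wu: "weak_solution \<alpha> V f h u" and wv: "weak_solution \<alpha> V f h v"
    using weak_solution_of_critical_point u v by blast+
  moreover have "\<not> (AE x in lebesgue. u x = v x)"
    using J_weak_solution_cong[OF wu wv] u(2) v(2) \<eta> by linarith
  ultimately show ?thesis by blast
qed

end

theorem theorem1p1:
  fixes \<alpha> :: real
    and V h :: "real^'n \<Rightarrow> real"
    and f :: "real \<Rightarrow> real"
    and C_e \<epsilon> \<delta> \<rho> r :: real
  assumes n: "CARD('n) \<ge> 2"
    and alpha: "0 < \<alpha>" "\<alpha> < 1"
    and V1: "continuous_on UNIV V" "\<exists>V0>0. \<forall>x. V x \<ge> V0"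
    and V2: "filterlim V at_top at_infinity"
    and f1: "continuous_on UNIV f" "f 0 = 0"
    and f2: "f \<in> o[at 0](\<lambda>t. \<bar>t\<bar>)"
    and f3: "f \<in> o[at_infinity](\<lambda>t. \<bar>t\<bar> powr ((real CARD('n) + 2 * \<alpha>) / (real CARD('n) - 2 * \<alpha>)))"
    and f4: "\<exists>\<mu>>2. \<forall>t. t \<noteq> 0 \<longrightarrow> 0 < \<mu> * primitive f t \<and> \<mu> * primitive f t \<le> t * f t"
    and C_e: "embedding_constant \<alpha> V C_e"
    and H1: "memLp 2 h" "\<not> (AE x in lebesgue. h x = 0)"
    and H2: "\<epsilon> > 0" "r > 0" "growth_thresholds CARD('n) \<alpha> f \<epsilon> \<delta> \<rho>"
    and H3: "Lp_norm 2 h < r / C_e *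
      (1 / 2 - \<epsilon> * C_e\<^sup>2
        - (\<epsilon> + K_const CARD('n) \<alpha> f \<delta> \<rho>) * C_e powr crit_exponent CARD('n) \<alpha>
            * r powr (crit_exponent CARD('n) \<alpha> - 2))"
  shows "\<exists>u v. weak_solution \<alpha> V f h u \<and> weak_solution \<alpha> V f h v \<and>
    \<not> (AE x in lebesgue. u x = v x)"
proof -
  obtain V0 where V0: "0 < V0" "\<And>x. V0 \<le> V x" using V1(2) by blast
  obtain \<mu> where \<mu>: "2 < \<mu>" "\<And>t. t \<noteq> 0 \<Longrightarrow> 0 < \<mu> * primitive f t \<and> \<mu> * primitive f t \<le> t * f t"
    using f4 by blast
  define q where "q = (real CARD('n) + 2 * \<alpha>) / (real CARD('n) - 2 * \<alpha>)"
  have "0 < real CARD('n) - 2 * \<alpha>" using n alpha by linarith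
  then have q: "1 < q" using alpha by (simp add: q_def less_divide_eq)
  interpret schroedinger_problem \<alpha> V V0 "real CARD('n) + 2 * \<alpha>" q f h C_e \<mu>
    using assms V0 \<mu> q q_def by unfold_locales (auto simp: memLp_2_iff)
  show ?thesis
    using two_weak_solutions[OF H2(1,2,3)] H3 unfolding crit by blast
qed

end
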